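(* Let $v:\mathbb{R}^2\times[0,T]\to\mathbb{R}^2$ be a continuous divergence-free vector field and let $\Omega_t$, $t\in[0,T]$, be an evolving $C^1$ bounded domain in $\mathbb{R}^2$. Suppose that $x\mapsto v(x,t)$ is continuous on $\mathbb{R}^2$ uniformly on $\mathbb{R}^2\times[0,T]$ (i.e. with a modulus of continuity in space independent of $(x,t)$). Then $\theta=\chi_{\Omega_t}$ is a weak solution of the transport equation $$\partial_t\theta+v\cdot\nabla\theta=0$$ if and only if $\Omega_t$ flows with $v$ on $[0,T]$.
   Context: Bounded domains are connected bounded open subsets of $\mathbb{R}^2$ whose boundary is a simple closed curve; a domain is $C^1$ if its boundary is locally the graph of a $C^1$ function. An evolving (moving) domain on $[0,T]$ is a map $t\mapsto\Omega_t$ assigning a bounded domain to each $t\in[0,T]$. Weak solution: $\theta=\chi_{\Omega_t}$ is a weak solution if for every $\varphi\in C_c^\infty(\mathbb{R}^2\times[0,T))$, $$\int_{\Omega_0}\varphi(\cdot,0)\,dx=-\int_0^T\int_{\mathbb{R}^2}\chi_{\Omega_t}(\partial_t\varphi+v\cdot\nabla\varphi)\,dx\,dt.$$ Flowing with $v$: $\Omega_t$ flows with the velocity $v$ if for all $t\in[0,T]$ and all $x\in\partial\Omega_t$, $$\lim_{h\to0}\frac{\operatorname{dist}(x+h\,v(x,t),\partial\Omega_{t+h})}{h}=0$$ (one-sided limits at $t=0$ and $t=T$), where $\operatorname{dist}(x,E)=\inf_{y\in E}|x-y|$.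
   Formalization: The evolving domain is additionally assumed to have boundary varying continuously in t in Hausdorff distance; without it the claim fails (v=0, unit disc at all times except one, when it is the disc of radius 2: a weak solution that does not flow with v). *)

theory Defs
  imports "HOL-Analysis.Analysis"
begin

section \<open>Smooth compactly supported functions\<close>

primrec Ck :: "nat \<Rightarrow> ('a::euclidean_space \<Rightarrow> real) \<Rightarrow> bool" where
  "Ck 0 f \<longleftrightarrow> continuous_on UNIV f"
| "Ck (Suc k) f \<longleftrightarrow> (\<forall>x. f differentiable (at x)) \<and>
      (\<forall>b\<in>Basis. Ck k (\<lambda>x. frechet_derivative f (at x) b))"

definition smooth :: "('a::euclidean_space \<Rightarrow> real) \<Rightarrow> bool" where
  "smooth f \<longleftrightarrow> (\<forall>k. Ck k f)"

definition support :: "('a::topological_space \<Rightarrow> real) \<Rightarrow> 'a set" where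
  "support f = closure {x. f x \<noteq> 0}"

definition gradient :: "('a::euclidean_space \<Rightarrow> real) \<Rightarrow> 'a \<Rightarrow> 'a" where
  "gradient f x = (\<Sum>b\<in>Basis. frechet_derivative f (at x) b *\<^sub>R b)"

text \<open>The space $C_c^\infty(R^2 \times [0,T))$: its elements are smooth up to and including
  \<open>t = 0\<close> and need not vanish there, so they are represented by smooth functions on all of
  space-time whose support is a compact subset of $R^2 \times (-\infty,T)$. Only the values for
  \<open>t \<ge> 0\<close> enter the weak formulation.\<close>

definition test_function :: "real \<Rightarrow> ((real^2) \<times> real \<Rightarrow> real) \<Rightarrow> bool" where
  "test_function T \<phi> \<longleftrightarrow>
     smooth \<phi> \<and> compact (support \<phi>) \<and> support \<phi> \<subseteq> UNIV \<times> {..<T}"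


section \<open>Velocity fields\<close>

text \<open>The fields considered are merely continuous, so the divergence is that of distributions.\<close>

definition divergence_free :: "(real^2 \<Rightarrow> real^2) \<Rightarrow> bool" where
  "divergence_free u \<longleftrightarrow>
     (\<forall>\<psi>. smooth \<psi> \<and> compact (support \<psi>) \<longrightarrow> (LINT x|lborel. u x \<bullet> gradient \<psi> x) = 0)"

definition uniformly_continuous_in_space :: "real \<Rightarrow> (real^2 \<Rightarrow> real \<Rightarrow> real^2) \<Rightarrow> bool" where
  "uniformly_continuous_in_space T v \<longleftrightarrow>
     (\<forall>\<epsilon>>0. \<exists>\<delta>>0. \<forall>t\<in>{0..T}. \<forall>x y. dist x y < \<delta> \<longrightarrow> dist (v x t) (v y t) < \<epsilon>)"


section \<open>Evolving domains\<close>

definition bounded_domain :: "(real^2) set \<Rightarrow> bool" where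
  "bounded_domain D \<longleftrightarrow> open D \<and> connected D \<and> bounded D \<and>
     (\<exists>\<gamma>. simple_path \<gamma> \<and> pathfinish \<gamma> = pathstart \<gamma> \<and> path_image \<gamma> = frontier D)"

text \<open>Near each boundary point the boundary is the graph of \<open>g\<close> over the line spanned by
  \<open>e\<close>, in the orthonormal frame \<open>e, n\<close>.\<close>

definition C1_domain :: "(real^2) set \<Rightarrow> bool" where
  "C1_domain D \<longleftrightarrow>
     (\<forall>p\<in>frontier D. \<exists>U e n g. open U \<and> p \<in> U \<and>
        norm e = 1 \<and> norm n = 1 \<and> e \<bullet> n = 0 \<and>
        (g :: real \<Rightarrow> real) C1_differentiable_on UNIV \<and>
        frontier D \<inter> U = {x \<in> U. x \<bullet> n = g (x \<bullet> e)})"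

text \<open>Used for nonempty bounded sets only, so that both suprema are finite.\<close>

definition hausdorff_dist :: "'a::metric_space set \<Rightarrow> 'a set \<Rightarrow> real" where
  "hausdorff_dist A B = max (SUP x\<in>A. infdist x B) (SUP y\<in>B. infdist y A)"

text \<open>``Evolving'' includes that the boundary varies continuously in time with respect to the
  Hausdorff distance, as is customary for patch solutions; no differentiability in time and no
  uniformity in time of the \<open>C\<^sup>1\<close> character is required. Without some continuity in time the two
  notions below are unrelated: being a weak solution is not affected by replacing
  \<open>\<Omega> t\<close> at a single time \<open>t > 0\<close>, whereas flowing with the velocity is a condition at every
  time.\<close>

definition evolving_domain :: "real \<Rightarrow> (real \<Rightarrow> (real^2) set) \<Rightarrow> bool" where
  "evolving_domain T \<Omega> \<longleftrightarrow>
     (\<forall>t\<in>{0..T}. bounded_domain (\<Omega> t)) \<and>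
     (\<forall>t\<in>{0..T}. ((\<lambda>s. hausdorff_dist (frontier (\<Omega> s)) (frontier (\<Omega> t))) \<longlongrightarrow> 0)
                      (at t within {0..T}))"


section \<open>Weak solutions and flowing with a velocity\<close>

definition weak_solution ::
  "real \<Rightarrow> (real^2 \<Rightarrow> real \<Rightarrow> real^2) \<Rightarrow> (real \<Rightarrow> (real^2) set) \<Rightarrow> bool" where
  "weak_solution T v \<Omega> \<longleftrightarrow>
     (\<forall>\<phi>. test_function T \<phi> \<longrightarrow>
        (LINT x:\<Omega> 0|lborel. \<phi> (x, 0)) =
        - (LINT t:{0..T}|lborel. (LINT x|lborel. indicator (\<Omega> t) x *
              (deriv (\<lambda>s. \<phi> (x, s)) t + v x t \<bullet> gradient (\<lambda>y. \<phi> (y, t)) x))))"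

text \<open>Restricting \<open>h\<close> to \<open>t + h \<in> {0..T}\<close> makes the limit one-sided at \<open>t = 0\<close> and \<open>t = T\<close>.\<close>

definition flows_with ::
  "real \<Rightarrow> (real^2 \<Rightarrow> real \<Rightarrow> real^2) \<Rightarrow> (real \<Rightarrow> (real^2) set) \<Rightarrow> bool" where
  "flows_with T v \<Omega> \<longleftrightarrow>
     (\<forall>t\<in>{0..T}. \<forall>x\<in>frontier (\<Omega> t).
        ((\<lambda>h. infdist (x + h *\<^sub>R v x t) (frontier (\<Omega> (t + h))) / h) \<longlongrightarrow> 0)
          (at 0 within {h. t + h \<in> {0..T}}))"

end

theory Submission
  imports Defs
begin

text \<open>Hausdorff continuity of the boundaries alone does not prevent collapse: thin C-shaped domains can
  have boundaries converging to a full circle. So in both directions one first shows that a point of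
  \<open>\<Omega> t\<close> stays in \<open>\<Omega> s\<close> for \<open>s\<close> near \<open>t\<close> (stability). Collapse means that the area drops to values near 0.
  For weak solutions, test functions depending only on time bound the area from below. For flows,
  the area is locally constant at stable times, and the Baire category theorem excludes unstable ones.

  If \<open>\<Omega>\<close> is a weak solution and the boundary at time \<open>t + h\<close> misses the ball of radius \<open>\<epsilon>\<bar>h\<bar>\<close> about
  \<open>x + h v(x,t)\<close>, consider a bump of this radius moving with the constant velocity \<open>v(x,t)\<close>. At time
  \<open>t + h\<close> the domain contains all or nothing of its mass, whereas at time \<open>t\<close> it contains a proper
  fraction, as the boundary is \<open>C\<^sup>1\<close>. But the mass in the domain changes only by \<open>o(h\<^sup>2)\<close>, since \<open>v\<close> is
  almost constant where the bump lives.

  If \<open>\<Omega>\<close> flows with \<open>v\<close> and \<open>v\<close> is within \<open>\<delta>\<close> of a constant \<open>w\<close> locally, a Dini derivative argument for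
  the distance from \<open>x + (s - t) w\<close> to the boundary shows that \<open>x \<in> \<Omega> t\<close> iff \<open>x + h w \<in> \<Omega> (t + h)\<close>, unless
  \<open>x\<close> is within \<open>2 \<delta> \<bar>h\<bar>\<close> of the boundary. Cut a test function into patches of size \<open>\<rho>\<close> and let \<open>w\<close> be
  the velocity at the centre of a patch. The patches away from the boundary contribute nothing since \<open>v\<close> is
  divergence free, and the \<open>O(1/\<rho>)\<close> patches meeting the boundary have total error \<open>O(\<delta> \<bar>h\<bar>)\<close>, since
  the \<open>r\<close>-neighbourhood of a \<open>C\<^sup>1\<close> curve has area \<open>O(r)\<close>. Only translations are involved, so \<open>v\<close> need
  not have a flow.\<close>

section \<open>Smooth functions\<close>

text \<open>No regularity of the boundary is uniform in time: the graphs, their Lipschitz constants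
  and the constant in the area of a boundary neighbourhood all belong to one fixed time. Hence both
  directions pass through a pointwise statement: the integral of a smooth function over the moving
  domain is differentiable at every \<open>t\<close>, and its derivative is the integral of the
  material derivative. In each difference quotient, quantitative information on the shape is used at
  the base time only. At the other time it is enough to know on which side of the boundary a small
  disc or a point lies. Stability is what makes this derivative continuous in time, so that the
  fundamental theorem of calculus connects it with the weak form. Before stability is known, the
  area need not even be a measurable function of time, so the arguments that establish stability use
  only one-sided limits of the area along sequences and averages that tolerate
  nonintegrability.\<close>

lemma CkI:
  assumes "\<And>x. (f has_derivative D x) (at x)" "\<And>b. b \<in> Basis \<Longrightarrow> Ck k (\<lambda>x. D x b)"
  shows "Ck (Suc k) f"
proof -
  have "frechet_derivative f (at x) = D x" for x
    using frechet_derivative_at[OF assms(1)] by simp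
  with assms show ?thesis by (auto simp: differentiable_def)
qed

lemma Ck_SucD: "Ck (Suc k) f \<Longrightarrow> Ck k f"
proof (induction k arbitrary: f)
  case 0
  then show ?case
    by (auto intro!: continuous_at_imp_continuous_on differentiable_imp_continuous_within)
qed auto

lemma Ck_has_derivative:
  "Ck (Suc k) f \<Longrightarrow> (f has_derivative frechet_derivative f (at x)) (at x)"
  by (simp add: frechet_derivative_works[symmetric])

lemma Ck_const: "Ck k (\<lambda>x. c)"
proof (induction k arbitrary: c)
  case (Suc k)
  show ?case by (rule CkI[where D="\<lambda>x d. 0"]) (auto intro: Suc)
qed auto

lemma Ck_add: "Ck k f \<Longrightarrow> Ck k g \<Longrightarrow> Ck k (\<lambda>x. f x + g x)"
proof (induction k arbitrary: f g)
  case (Suc k)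
  show ?case
    by (rule CkI[where D="\<lambda>x d. frechet_derivative f (at x) d + frechet_derivative g (at x) d"])
      (use Suc in \<open>auto intro!: has_derivative_add simp: frechet_derivative_works[symmetric]\<close>)
qed (auto intro: continuous_intros)

lemma Ck_mult: "Ck k f \<Longrightarrow> Ck k g \<Longrightarrow> Ck k (\<lambda>x. f x * g x)"
proof (induction k arbitrary: f g)
  case (Suc k)
  show ?case
  proof (rule CkI)
    show "((\<lambda>x. f x * g x) has_derivative
      (\<lambda>d. f x * frechet_derivative g (at x) d + frechet_derivative f (at x) d * g x)) (at x)" for x
      by (intro has_derivative_mult Ck_has_derivative[OF Suc.prems(1)] Ck_has_derivative[OF Suc.prems(2)])
    show "Ck k (\<lambda>x. f x * frechet_derivative g (at x) b + frechet_derivative f (at x) b * g x)"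
      if "b \<in> Basis" for b
      using Suc that Ck_SucD by (intro Ck_add Suc.IH) auto
  qed
qed (auto intro: continuous_intros)

lemma Ck_sum: "(\<And>i. i \<in> I \<Longrightarrow> Ck k (f i)) \<Longrightarrow> Ck k (\<lambda>x. \<Sum>i\<in>I. f i x)"
  by (induction I rule: infinite_finite_induct) (auto intro: Ck_const Ck_add)

lemma Ck_inverse: "Ck k f \<Longrightarrow> (\<And>x. f x \<noteq> 0) \<Longrightarrow> Ck k (\<lambda>x. inverse (f x))"
proof (induction k arbitrary: f)
  case (Suc k)
  show ?case
  proof (rule CkI)
    show "((\<lambda>x. inverse (f x)) has_derivative
      (\<lambda>d. - (inverse (f x) * frechet_derivative f (at x) d * inverse (f x)))) (at x)" for x
      by (rule Deriv.has_derivative_inverse[OF Suc.prems(2) Ck_has_derivative[OF Suc.prems(1)]])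
    have eq: "(\<lambda>x. - (inverse (f x) * frechet_derivative f (at x) b * inverse (f x))) =
      (\<lambda>x. (-1) * (inverse (f x) * frechet_derivative f (at x) b * inverse (f x)))" for b
      by simp
    show "Ck k (\<lambda>x. - (inverse (f x) * frechet_derivative f (at x) b * inverse (f x)))"
      if "b \<in> Basis" for b
      unfolding eq using Suc that Ck_SucD by (intro Ck_mult Ck_const Suc.IH) auto
  qed
qed (auto intro: continuous_intros)

lemma linear_eq_sum_Basis:
  fixes f :: "'a::euclidean_space \<Rightarrow> 'b::real_vector"
  assumes "linear f"
  shows "f x = (\<Sum>b\<in>Basis. (x \<bullet> b) *\<^sub>R f b)"
proof -
  have "f x = f (\<Sum>b\<in>Basis. (x \<bullet> b) *\<^sub>R b)" by (simp add: euclidean_representation)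
  also have "\<dots> = (\<Sum>b\<in>Basis. (x \<bullet> b) *\<^sub>R f b)" using assms by (simp add: linear_sum linear_scale)
  finally show ?thesis .
qed

lemma Ck_linear_frechet: 
  assumes "Ck (Suc k) f" shows "linear (frechet_derivative f (at x))"
  using Ck_has_derivative[OF assms] has_derivative_linear by blast

lemma Ck_compose_affine:
  fixes L :: "'a::euclidean_space \<Rightarrow> 'b::euclidean_space"
  assumes L: "bounded_linear L"
  shows "Ck k f \<Longrightarrow> Ck k (\<lambda>x. f (L x + c))"
proof (induction k arbitrary: f)
  case 0
  have "continuous_on UNIV (\<lambda>x. L x + c)"
    by (intro continuous_intros linear_continuous_on L)
  with 0 show ?case by (auto intro: continuous_on_compose2)
next
  case (Suc k)
  show ?case
  proof (rule CkI)
    show "((\<lambda>x. f (L x + c)) has_derivative (\<lambda>d. frechet_derivative f (at (L x + c)) (L d))) (at x)" for x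
    proof -
      have "((\<lambda>x. L x + c) has_derivative L) (at x)"
        by (auto intro!: derivative_eq_intros bounded_linear_imp_has_derivative L)
      from has_derivative_compose[OF this Ck_has_derivative[OF Suc.prems]]
      show ?thesis by simp
    qed
    \<comment> \<open>\<open>Ck\<close> only controls derivatives along basis vectors, and
      \<open>L b\<close> need not be one, so the derivative along it is expanded in
      \<open>Basis\<close>.\<close>
    have "frechet_derivative f (at (L x + c)) (L b) =
       (\<Sum>b'\<in>Basis. (L b \<bullet> b') * frechet_derivative f (at (L x + c)) b')" for x b
      using linear_eq_sum_Basis[OF Ck_linear_frechet[OF Suc.prems]] by (metis (no_types, lifting) real_scaleR_def sum.cong)
    then show "Ck k (\<lambda>x. frechet_derivative f (at (L x + c)) (L b))" for b
      using Suc.prems by (auto intro!: Ck_sum Ck_mult Ck_const Suc.IH[where f="\<lambda>y. frechet_derivative f (at y) _"])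
  qed
qed

lemma smooth_const: "smooth (\<lambda>x. c)" by (simp add: smooth_def Ck_const)
lemma smooth_add: "smooth f \<Longrightarrow> smooth g \<Longrightarrow> smooth (\<lambda>x. f x + g x)" by (simp add: smooth_def Ck_add)
lemma smooth_mult: "smooth f \<Longrightarrow> smooth g \<Longrightarrow> smooth (\<lambda>x. f x * g x)" by (simp add: smooth_def Ck_mult)
lemma smooth_diff: "smooth f \<Longrightarrow> smooth g \<Longrightarrow> smooth (\<lambda>x. f x - g x)"
  using smooth_add[OF _ smooth_mult[OF smooth_const], of f g "-1"] by simp
lemma smooth_compose_affine:
  "bounded_linear L \<Longrightarrow> smooth f \<Longrightarrow> smooth (\<lambda>x. f (L x + c))"
  by (simp add: smooth_def Ck_compose_affine)

lemma smooth_has_derivative: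
  "smooth f \<Longrightarrow> (f has_derivative frechet_derivative f (at x)) (at x)"
  using Ck_has_derivative smooth_def by blast

lemma smooth_linear_frechet: "smooth f \<Longrightarrow> linear (frechet_derivative f (at x))"
  using has_derivative_linear smooth_has_derivative by blast

lemma smooth_continuous_on: "smooth f \<Longrightarrow> continuous_on S f"
  by (metis Ck.simps(1) continuous_on_subset smooth_def top_greatest)

lemma smooth_continuous_on_frechet:
  assumes "smooth f"
  shows "continuous_on S (\<lambda>x. frechet_derivative f (at x) w)"
proof -
  have "continuous_on S (\<lambda>x. frechet_derivative f (at x) b)" if "b \<in> Basis" for b
    using assms that unfolding smooth_def by (metis Ck.simps continuous_on_subset top_greatest)
  then have "continuous_on S (\<lambda>x. \<Sum>b\<in>Basis. (w \<bullet> b) *\<^sub>R frechet_derivative f (at x) b)"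
    by (intro continuous_intros) auto
  then show ?thesis
    by (subst linear_eq_sum_Basis[OF smooth_linear_frechet[OF assms]])
qed

lemma inner_gradient:
  assumes "smooth f"
  shows "w \<bullet> gradient f x = frechet_derivative f (at x) w"
  by (subst linear_eq_sum_Basis[OF smooth_linear_frechet[OF assms], of x w])
     (simp add: gradient_def inner_sum_right mult.commute)

lemma continuous_on_gradient: "smooth f \<Longrightarrow> continuous_on S (gradient f)"
  unfolding gradient_def by (intro continuous_intros smooth_continuous_on_frechet)

lemma gradient_eqI:
  assumes "(f has_derivative D) (at x)" "\<And>w. D w = g \<bullet> w"
  shows "gradient f x = g"
  using frechet_derivative_at[OF assms(1)] assms(2)
  by (simp add: gradient_def euclidean_representation)

lemma smooth_has_derivative_gradient:
  "smooth f \<Longrightarrow> (f has_derivative (\<lambda>w. gradient f x \<bullet> w)) (at x)"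
  using smooth_has_derivative[of f x] inner_gradient[of f _ x] by (simp add: inner_commute)

text \<open>Mean value theorem on the segment from \<open>x\<close> to \<open>x + k\<close>,
  together with uniform continuity of the gradient. Increments are kept below 1 so that the segment
  stays in the compact ball of radius \<open>R + 1\<close>.\<close>

lemma smooth_uniform_taylor:
  fixes f :: "'a::euclidean_space \<Rightarrow> real"
  assumes f: "smooth f" and e: "e > 0"
  shows "\<exists>d>0. \<forall>x\<in>cball 0 R. \<forall>k. norm k < d \<longrightarrow> \<bar>f (x + k) - f x - gradient f x \<bullet> k\<bar> \<le> e * norm k"
proof -
  have "uniformly_continuous_on (cball 0 (R+1)) (gradient f)"
    by (intro compact_uniformly_continuous continuous_on_gradient f) auto
  then obtain d where d: "d > 0" and
    u: "\<And>x y. x \<in> cball 0 (R+1) \<Longrightarrow> y \<in> cball 0 (R+1) \<Longrightarrow> dist y x < d \<Longrightarrow> dist (gradient f y) (gradient f x) < e"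
    using e unfolding uniformly_continuous_on_def by blast
  show ?thesis
  proof (intro exI[of _ "min d 1"] conjI ballI allI impI)
    fix x k :: 'a assume x: "x \<in> cball 0 R" and k: "norm k < min d 1"
    define g where "g = (\<lambda>t::real. f (x + t *\<^sub>R k))"
    have g: "(g has_derivative (\<lambda>s. gradient f (x + t *\<^sub>R k) \<bullet> (s *\<^sub>R k))) (at t within {0..1})" for t
      unfolding g_def
      by (rule has_derivative_compose[OF _ smooth_has_derivative_gradient[OF f]])
        (auto intro!: derivative_eq_intros)
    obtain t where t: "t \<in> {0<..<1}" and "g 1 - g 0 = gradient f (x + t *\<^sub>R k) \<bullet> ((1 - 0) *\<^sub>R k)"
      using mvt_simple[of 0 1 g "\<lambda>t s. gradient f (x + t *\<^sub>R k) \<bullet> (s *\<^sub>R k)"] g by force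
    then have "f (x + k) - f x - gradient f x \<bullet> k = (gradient f (x + t *\<^sub>R k) - gradient f x) \<bullet> k"
      by (simp add: g_def inner_diff_left)
    moreover have "norm (gradient f (x + t *\<^sub>R k) - gradient f x) \<le> e"
    proof -
      have tk: "norm (t *\<^sub>R k) \<le> norm k" using t by (simp add: mult_left_le_one_le)
      have "norm (x + t *\<^sub>R k) \<le> R + 1"
        using norm_triangle_ineq[of x "t *\<^sub>R k"] tk k x by simp
      then have mem: "x + t *\<^sub>R k \<in> cball 0 (R+1)" "x \<in> cball 0 (R+1)" using x by auto
      have "dist (x + t *\<^sub>R k) x < d" using tk k by (simp add: dist_norm)
      then have "dist (gradient f (x + t *\<^sub>R k)) (gradient f x) < e"
        by (rule u[OF mem(2,1)])
      then show ?thesis by (simp add: dist_norm)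
    qed
    ultimately show "\<bar>f (x + k) - f x - gradient f x \<bullet> k\<bar> \<le> e * norm k"
      using Cauchy_Schwarz_ineq2[of "gradient f (x + t *\<^sub>R k) - gradient f x" k]
      by (smt (verit) mult_right_mono norm_ge_zero)
  qed (use d in auto)
qed

text \<open>This family is closed under differentiation.\<close>

definition flat :: "real poly \<Rightarrow> real \<Rightarrow> real" where
  "flat p x = (if x > 0 then poly p (1 / x) * exp (- 1 / x) else 0)"

lemma flat_tendsto_0: "((\<lambda>x::real. poly p (1 / x) * exp (- 1 / x)) \<longlongrightarrow> 0) (at_right 0)"
proof -
  have "((\<lambda>y. poly p y / exp y) \<longlongrightarrow> 0) at_top"
  proof -
    have "poly p y / exp y = (\<Sum>i\<le>degree p. coeff p i * (y ^ i / exp y))" for y :: real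
      by (simp add: poly_altdef sum_divide_distrib)
    moreover have "((\<lambda>y. \<Sum>i\<le>degree p. coeff p i * (y ^ i / exp y)) \<longlongrightarrow> (\<Sum>i\<le>degree p. coeff p i * 0)) at_top"
      by (intro tendsto_sum tendsto_mult tendsto_const tendsto_power_div_exp_0)
    ultimately show ?thesis by simp
  qed
  from filterlim_compose[OF this filterlim_inverse_at_top_right]
  show ?thesis by (simp add: exp_minus divide_inverse)
qed

text \<open>With \<open>y = 1/x\<close> the derivative of \<open>p(y) exp(-y)\<close> is
  \<open>y^2 (p(y) - p'(y)) exp(-y)\<close>, which explains the factor
  \<open>[:0, 0, 1:]\<close>.\<close>

lemma flat_has_derivative:
  "(flat p has_real_derivative flat ([:0, 0, 1:] * (p - pderiv p)) x) (at x)"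
proof -
  consider "x > 0" | "x < 0" | "x = 0" by linarith
  then show ?thesis
  proof cases
    case 1
    have "((\<lambda>x. poly p (1 / x) * exp (- 1 / x)) has_real_derivative flat ([:0, 0, 1:] * (p - pderiv p)) x) (at x)"
      using 1 by (auto intro!: derivative_eq_intros poly_DERIV simp: flat_def field_simps power2_eq_square)
    then show ?thesis
      by (rule has_field_derivative_transform_within_open[of _ _ _ "{0<..}"])
         (use 1 in \<open>auto simp: flat_def\<close>)
  next
    case 2
    have "((\<lambda>x. 0) has_real_derivative flat ([:0, 0, 1:] * (p - pderiv p)) x) (at x)"
      using 2 by (auto simp: flat_def)
    then show ?thesis
      by (rule has_field_derivative_transform_within_open[of _ _ _ "{..<0}"])
         (use 2 in \<open>auto simp: flat_def\<close>)
  next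
    case 3
    \<comment> \<open>Dividing by \<open>y\<close> multiplies \<open>p(1/y)\<close> by
      \<open>1/y\<close>, so for positive \<open>y\<close> the quotient is again a member of the
      family, with polynomial \<open>pCons 0 p\<close>.\<close>
    have "((\<lambda>y. (flat p y - flat p 0) / (y - 0)) \<longlongrightarrow> 0) (at_right 0)"
      by (rule Lim_transform_eventually[OF flat_tendsto_0[of "pCons 0 p"]])
         (auto simp: flat_def eventually_at_right_less intro!: eventually_at_rightI[of 0 1])
    moreover have "((\<lambda>y. (flat p y - flat p 0) / (y - 0)) \<longlongrightarrow> 0) (at_left 0)"
      by (rule Lim_transform_eventually[OF tendsto_const])
         (auto simp: flat_def intro!: eventually_at_leftI[of "-1"])
    ultimately show ?thesis
      using 3 by (auto simp: has_field_derivative_iff flat_def filterlim_split_at)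
  qed
qed

lemma Ck_Suc_real:
  assumes "\<And>x. (f has_real_derivative g x) (at x)" "Ck k g"
  shows "Ck (Suc k) f"
  by (rule CkI[where D="\<lambda>x d. g x * d"]) (use assms in \<open>auto simp: has_field_derivative_def\<close>)

lemma smooth_flat: "smooth (flat p)"
proof -
  have "Ck k (flat p)" for k
  proof (induction k arbitrary: p)
    case 0
    then show ?case using flat_has_derivative
      by (auto intro!: DERIV_continuous_on)
  next
    case (Suc k)
    show ?case by (rule Ck_Suc_real[OF flat_has_derivative Suc])
  qed
  then show ?thesis by (simp add: smooth_def)
qed

section \<open>Smooth steps, bumps and partitions of unity\<close>

definition smooth_step :: "real \<Rightarrow> real" where
  "smooth_step x = flat 1 x / (flat 1 x + flat 1 (1 - x))"

lemma flat1_nonneg: "flat 1 x \<ge> 0" and flat1_pos: "x > 0 \<Longrightarrow> flat 1 x > 0"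
  and flat1_zero: "x \<le> 0 \<Longrightarrow> flat 1 x = 0"
  by (auto simp: flat_def)

lemma flat1_mono: "x \<le> y \<Longrightarrow> flat 1 x \<le> flat 1 y"
  by (auto simp: flat_def field_simps)

lemma smooth_step_denom: "flat 1 x + flat 1 (1 - x) > 0"
  using flat1_nonneg[of x] flat1_nonneg[of "1-x"] flat1_pos[of x] flat1_pos[of "1-x"]
  by (cases "x > 0") (auto intro: add_nonneg_pos add_pos_nonneg)

lemma smooth_smooth_step: "smooth smooth_step"
proof -
  have "smooth (\<lambda>x. flat 1 (-x + 1))"
    by (intro smooth_compose_affine smooth_flat) (simp add: bounded_linear_minus)
  then have "smooth (\<lambda>x. flat 1 x + flat 1 (1 - x))"
    by (intro smooth_add smooth_flat) simp
  then have "smooth (\<lambda>x. inverse (flat 1 x + flat 1 (1 - x)))"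
    unfolding smooth_def using smooth_step_denom by (intro allI Ck_inverse) (auto simp: less_imp_neq dual_order.strict_implies_not_eq)
  then show ?thesis
    using smooth_mult[OF smooth_flat] unfolding smooth_step_def[abs_def] divide_inverse by blast
qed

lemma smooth_step_0: "x \<le> 0 \<Longrightarrow> smooth_step x = 0"
  and smooth_step_1: "x \<ge> 1 \<Longrightarrow> smooth_step x = 1"
  using smooth_step_denom[of x] by (auto simp: smooth_step_def flat1_zero)

lemma smooth_step_bounds: "0 \<le> smooth_step x" "smooth_step x \<le> 1"
  using smooth_step_denom[of x] flat1_nonneg[of x] flat1_nonneg[of "1-x"]
  by (auto simp: smooth_step_def)

lemma smooth_step_mono: "x \<le> y \<Longrightarrow> smooth_step x \<le> smooth_step y"
proof -
  assume "x \<le> y"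
  then have "flat 1 x \<le> flat 1 y" "flat 1 (1 - y) \<le> flat 1 (1 - x)" by (auto intro: flat1_mono)
  then have "flat 1 x * flat 1 (1 - y) \<le> flat 1 y * flat 1 (1 - x)"
    by (intro mult_mono) (auto intro: flat1_nonneg)
  then show ?thesis using smooth_step_denom[of x] smooth_step_denom[of y]
    by (simp add: smooth_step_def frac_le_eq divide_simps algebra_simps)
qed

lemma support_zero: "x \<notin> support f \<Longrightarrow> f x = 0"
  using closure_subset by (force simp: support_def)

lemma gradient_zero_outside_support:
  assumes "x \<notin> support f"
  shows "gradient f x = 0"
proof (rule gradient_eqI)
  have "((\<lambda>x. 0) has_derivative (\<lambda>w. 0)) (at x)" by simp
  then show "(f has_derivative (\<lambda>w. 0)) (at x)"
    by (rule has_derivative_transform_within_open[of _ _ _ _ "- support f"])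
      (use assms support_zero in \<open>auto simp: support_def\<close>)
qed simp

lemma compact_support_iff: "compact (support f) \<longleftrightarrow> bounded {x. f x \<noteq> 0}"
  for f :: "'a::euclidean_space \<Rightarrow> real"
  by (simp add: support_def compact_closure)

lemma compact_support_bounds:
  assumes f: "smooth f" "compact (support f)"
  shows "\<exists>M>0. \<forall>x. \<bar>f x\<bar> \<le> M \<and> norm (gradient f x) \<le> M"
proof -
  have "bounded (f ` support f)" "bounded (gradient f ` support f)"
    using f by (auto intro!: compact_imp_bounded compact_continuous_image smooth_continuous_on continuous_on_gradient)
  then obtain a b where a: "\<And>x. x \<in> support f \<Longrightarrow> \<bar>f x\<bar> \<le> a" and b: "\<And>x. x \<in> support f \<Longrightarrow> norm (gradient f x) \<le> b"
    unfolding bounded_iff by auto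
  show ?thesis
  proof (intro exI[of _ "max 1 (max a b)"] conjI allI)
    show "\<bar>f x\<bar> \<le> max 1 (max a b)" for x
      using a[of x] support_zero[of x f] by (cases "x \<in> support f") auto
    show "norm (gradient f x) \<le> max 1 (max a b)" for x
      using b[of x] gradient_zero_outside_support[of x f] by (cases "x \<in> support f") auto
  qed auto
qed

text \<open>Test with \<open>w\<close> equal to the gradient; if the gradient is zero, a basis
  vector shows that \<open>B\<close> is nonnegative.\<close>

lemma norm_gradient_le:
  assumes "\<And>w. \<bar>gradient f x \<bullet> w\<bar> \<le> B * norm w"
  shows "norm (gradient f x) \<le> B"
proof (cases "gradient f x = 0")
  case False
  from assms[of "gradient f x"] have "norm (gradient f x) * norm (gradient f x) \<le> B * norm (gradient f x)"
    by (simp add: dot_square_norm power2_eq_square)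
  with False show ?thesis by simp
next
  case True
  obtain b :: 'a where "b \<in> Basis" using nonempty_Basis by blast
  then show ?thesis using assms[of b] True by (simp add: norm_Basis)
qed

lemma smooth_component: 
  fixes u :: "real \<Rightarrow> real"
  assumes "smooth u" shows "smooth (\<lambda>x::real^2. u ((x $ i - c) / r + d))"
proof -
  have "bounded_linear (\<lambda>x::real^2. x $ i / r)"
    by (rule bounded_linear_compose[OF bounded_linear_divide bounded_linear_vec_nth])
  from smooth_compose_affine[OF this assms, of "d - c / r"] show ?thesis
    by (simp add: diff_divide_distrib algebra_simps)
qed

text \<open>A difference of two consecutive steps, so that sums of integer translates
  telescope.\<close>

definition smooth_bump :: "real \<Rightarrow> real" where
  "smooth_bump y = smooth_step (y + 1) - smooth_step y"

lemma smooth_smooth_bump: "smooth smooth_bump"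
  unfolding smooth_bump_def[abs_def]
  using smooth_compose_affine[OF bounded_linear_ident smooth_smooth_step, of 1]
  by (intro smooth_diff smooth_smooth_step) simp

lemma smooth_bump_bounds: "0 \<le> smooth_bump y" "smooth_bump y \<le> 1"
  using smooth_step_mono[of y "y+1"] smooth_step_bounds[of y] smooth_step_bounds[of "y+1"]
  by (auto simp: smooth_bump_def)

lemma smooth_bump_nonzero: "smooth_bump y \<noteq> 0 \<Longrightarrow> \<bar>y\<bar> \<le> 1"
  using smooth_step_0[of y] smooth_step_0[of "y+1"] smooth_step_1[of y] smooth_step_1[of "y+1"]
  by (force simp: smooth_bump_def)

lemma compact_support_smooth_bump: "compact (support smooth_bump)"
  unfolding compact_support_iff
  by (rule bounded_subset[of "cball 0 1"]) (auto dest: smooth_bump_nonzero)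

lemma smooth_has_derivative_real:
  fixes u :: "real \<Rightarrow> real"
  assumes "smooth u" "(f has_derivative D) (at x)"
  shows "((\<lambda>x. u (f x)) has_derivative (\<lambda>w. gradient u (f x) * D w)) (at x)"
  using has_derivative_compose[OF assms(2) smooth_has_derivative_gradient[OF assms(1)]] by simp

text \<open>A closed interval of length 6 contains at most 7 integers; in two coordinates this
  yields the overlap number 49 of \<open>patch_partition\<close>.\<close>

lemma card_nat_near: "card {i::nat. \<bar>real i - a\<bar> \<le> 3} \<le> 7" and finite_nat_near: "finite {i::nat. \<bar>real i - a\<bar> \<le> 3}"
proof -
  have s: "{i::nat. \<bar>real i - a\<bar> \<le> 3} \<subseteq> nat ` {\<lceil>a - 3\<rceil>..\<lfloor>a + 3\<rfloor>}"
  proof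
    fix i :: nat assume "i \<in> {i. \<bar>real i - a\<bar> \<le> 3}"
    then have "a - 3 \<le> real i" "real i \<le> a + 3" by auto
    then have "int i \<in> {\<lceil>a - 3\<rceil>..\<lfloor>a + 3\<rfloor>}" unfolding atLeastAtMost_iff ceiling_le_iff le_floor_iff by simp
    then show "i \<in> nat ` {\<lceil>a - 3\<rceil>..\<lfloor>a + 3\<rfloor>}" by force
  qed
  show "finite {i::nat. \<bar>real i - a\<bar> \<le> 3}" by (rule finite_subset[OF s]) auto
  have "card {i::nat. \<bar>real i - a\<bar> \<le> 3} \<le> card {\<lceil>a - 3\<rceil>..\<lfloor>a + 3\<rfloor>}"
    by (rule order_trans[OF card_mono[OF _ s] card_image_le]) auto
  also have "\<dots> \<le> 7" by simp linarith
  finally show "card {i::nat. \<bar>real i - a\<bar> \<le> 3} \<le> 7" .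
qed

text \<open>Neighbouring bumps share a step, so the sum telescopes to
  \<open>smooth_step (y + K) - smooth_step (y - K)\<close>. The hypotheses make the first argument
  at least 1 and the second at most 0.\<close>

lemma sum_smooth_bump:
  assumes "1 - real K \<le> y" "y \<le> real K"
  shows "(\<Sum>i<2*K. smooth_bump (y + real K - 1 - real i)) = 1"
proof -
  have "(\<Sum>i<2*K. smooth_bump (y + real K - 1 - real i)) =
    (\<Sum>i<2*K. smooth_step (y + real K - real i) - smooth_step (y + real K - real (Suc i)))"
    by (rule sum.cong) (auto simp: smooth_bump_def algebra_simps)
  also have "\<dots> = smooth_step (y + real K) - smooth_step (y - real K)"
    by (subst sum_lessThan_telescope') simp
  also have "\<dots> = 1" using assms by (simp add: smooth_step_0 smooth_step_1)
  finally show ?thesis .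
qed

text \<open>The function \<open>\<psi>\<close> itself is cut up, not the constant 1.
  \<open>C\<close> is meant to be independent of the scale \<open>\<rho>\<close>, so gradients have
  their natural size \<open>1 / \<rho>\<close>. Overlaps are counted at radius
  \<open>3 * \<rho>\<close>, one \<open>\<rho>\<close> more than the patches, to leave room for
  translating them.\<close>

definition patch_partition ::
  "(real^2 \<Rightarrow> real) \<Rightarrow> real \<Rightarrow> real \<Rightarrow> (real^2) set \<Rightarrow> (real^2 \<Rightarrow> real^2 \<Rightarrow> real) \<Rightarrow> bool" where
  "patch_partition \<psi> C \<rho> Z q \<longleftrightarrow> finite Z \<and>
       (\<forall>z\<in>Z. smooth (q z) \<and> (\<forall>x. q z x \<noteq> 0 \<longrightarrow> dist z x \<le> 2 * \<rho>) \<and>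
          (\<forall>x. \<bar>q z x\<bar> \<le> C) \<and> (\<forall>x. norm (gradient (q z) x) \<le> C / \<rho>)) \<and>
       (\<forall>x. \<psi> x = (\<Sum>z\<in>Z. q z x)) \<and> (\<forall>p. card {z\<in>Z. dist z p \<le> 3 * \<rho>} \<le> 49)"

lemma smooth_partition:
  fixes \<psi> :: "real^2 \<Rightarrow> real"
  assumes \<psi>: "smooth \<psi>" "compact (support \<psi>)"
  shows "\<exists>C>0. \<forall>\<rho>. 0 < \<rho> \<longrightarrow> \<rho> \<le> 1 \<longrightarrow> (\<exists>Z q. patch_partition \<psi> C \<rho> Z q)"
proof -
  obtain M where M: "M > 0" "\<And>x. \<bar>\<psi> x\<bar> \<le> M" "\<And>x. norm (gradient \<psi> x) \<le> M"
    using compact_support_bounds[OF \<psi>] by blast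
  obtain B where B: "B > 0" "\<And>y. norm (gradient smooth_bump y) \<le> B"
    using compact_support_bounds[OF smooth_smooth_bump compact_support_smooth_bump] by blast
  obtain R where R: "R > 0" "\<And>x. \<psi> x \<noteq> 0 \<Longrightarrow> norm x \<le> R"
    using \<psi>(2) unfolding compact_support_iff bounded_pos by blast
  \<comment> \<open>\<open>M\<close> bounds \<open>q\<close>, and also the term containing
    \<open>gradient \<psi>\<close>, as \<open>\<rho> \<le> 1\<close>; each of the two bump factors,
    when differentiated, contributes \<open>M * B / \<rho>\<close>.\<close>
  define C where "C = M + 2 * M * B"
  have C: "C > 0" "M \<le> C" using M(1) B(1) by (auto simp: C_def add_pos_nonneg)
  show ?thesis
  proof (intro exI[of _ C] conjI[OF C(1)] allI impI)
    fix \<rho> :: real assume \<rho>: "0 < \<rho>" "\<rho> \<le> 1"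
    \<comment> \<open>With this \<open>K\<close> the grid of mesh \<open>\<rho>\<close> is large
      enough for the telescoping sum to be 1 at all coordinates of absolute value at most
      \<open>R\<close>, hence wherever \<open>\<psi>\<close> is nonzero.\<close>
    obtain K :: nat where K: "R / \<rho> + 1 \<le> real K" using real_arch_simple by blast
    define pt where "pt = (\<lambda>(i::nat, j::nat). vector [\<rho> * (real i + 1 - real K), \<rho> * (real j + 1 - real K)] :: real^2)"
    \<comment> \<open>The summand \<open>+ 0\<close> brings the arguments into the shape of
      \<open>smooth_component\<close>.\<close>
    define q where "q = (\<lambda>(z::real^2) (x::real^2). \<psi> x * (smooth_bump ((x$1 - z$1) / \<rho> + 0) * smooth_bump ((x$2 - z$2) / \<rho> + 0)))"
    define Z where "Z = pt ` ({..<2*K} \<times> {..<2*K})"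
    have inj: "inj_on pt ({..<2*K} \<times> {..<2*K})"
      using \<rho> by (auto simp: inj_on_def pt_def vec_eq_iff forall_2)
    have near: "dist z x \<le> 2 * \<rho>" if "q z x \<noteq> 0" for z x
    proof -
      have "\<bar>(x$1 - z$1) / \<rho>\<bar> \<le> 1" "\<bar>(x$2 - z$2) / \<rho>\<bar> \<le> 1"
        by (rule smooth_bump_nonzero, use that in \<open>simp add: q_def\<close>)+
      then have "\<bar>x$1 - z$1\<bar> \<le> \<rho>" "\<bar>x$2 - z$2\<bar> \<le> \<rho>" using \<rho> by (simp_all add: abs_divide)
      then have "norm (x - z) \<le> 2 * \<rho>" using norm_le_l1_cart[of "x - z"] by (simp add: sum_2)
      then show ?thesis by (simp add: dist_norm norm_minus_commute)
    qed
    have bound: "\<bar>q z x\<bar> \<le> C" for z x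
    proof -
      have "\<bar>q z x\<bar> \<le> \<bar>\<psi> x\<bar> * (1 * 1)"
        unfolding q_def abs_mult
        by (intro mult_left_mono mult_mono) (use smooth_bump_bounds in auto)
      then show ?thesis using M(2)[of x] C by simp
    qed
    have grad: "norm (gradient (q z) x) \<le> C / \<rho>" for z x
    proof (rule norm_gradient_le)
      fix w :: "real^2"
      define a b where "a = (x$1 - z$1) / \<rho> + 0" and "b = (x$2 - z$2) / \<rho> + 0"
      have 1: "((\<lambda>x::real^2. (x$i - z$i) / \<rho> + 0) has_derivative (\<lambda>w. w$i / \<rho>)) (at x)" for i
        using \<rho> by (auto intro!: derivative_eq_intros bounded_linear_imp_has_derivative bounded_linear_vec_nth)
      have "(q z has_derivative (\<lambda>w. \<psi> x * (smooth_bump a * (gradient smooth_bump b * (w$2 / \<rho>)) +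
          gradient smooth_bump a * (w$1 / \<rho>) * smooth_bump b) + gradient \<psi> x \<bullet> w * (smooth_bump a * smooth_bump b))) (at x)"
        unfolding q_def a_def b_def
        by (intro has_derivative_mult smooth_has_derivative_real smooth_smooth_bump 1 smooth_has_derivative_gradient \<psi>)
      moreover have "(q z has_derivative (\<lambda>w. gradient (q z) x \<bullet> w)) (at x)"
        unfolding q_def by (intro smooth_has_derivative_gradient smooth_mult \<psi> smooth_component smooth_smooth_bump)
      ultimately have "gradient (q z) x \<bullet> w = \<psi> x * (smooth_bump a * (gradient smooth_bump b * (w$2 / \<rho>)) +
          gradient smooth_bump a * (w$1 / \<rho>) * smooth_bump b) + gradient \<psi> x \<bullet> w * (smooth_bump a * smooth_bump b)"
        by (metis (no_types, lifting) has_derivative_unique)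
      also have "\<bar>\<dots>\<bar> \<le> M * (1 * (B * (norm w / \<rho>)) + B * (norm w / \<rho>) * 1) + (M * norm w) * (1 * 1)"
      proof -
        have w: "\<bar>w $ i / \<rho>\<bar> \<le> norm w / \<rho>" for i
          using \<rho> component_le_norm_cart[of w i] by (simp add: divide_right_mono)
        have g: "\<bar>gradient smooth_bump y\<bar> \<le> B" for y using B(2) by simp
        have p: "\<bar>gradient \<psi> x \<bullet> w\<bar> \<le> M * norm w"
          using Cauchy_Schwarz_ineq2[of "gradient \<psi> x" w] M(3)[of x] by (meson mult_right_mono norm_ge_zero order_trans)
        have s: "\<bar>smooth_bump y\<bar> \<le> 1" for y using smooth_bump_bounds[of y] by simp
        have nn: "0 \<le> B" "0 \<le> M" "0 \<le> norm w / \<rho>" using B M \<rho> by auto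
        show ?thesis
          by (intro order_trans[OF abs_triangle_ineq] add_mono)
            (auto simp only: abs_mult intro!: mult_mono order_trans[OF abs_triangle_ineq] add_mono w g p s M(2) abs_ge_zero mult_nonneg_nonneg nn add_nonneg_nonneg norm_ge_zero zero_le_one)
      qed
      also have "\<dots> \<le> C / \<rho> * norm w"
      proof -
        have "M * norm w \<le> M * norm w / \<rho>" using \<rho> M by (simp add: field_simps mult_left_le_one_le)
        then show ?thesis by (simp add: C_def add_divide_distrib algebra_simps)
      qed
      finally show "\<bar>gradient (q z) x \<bullet> w\<bar> \<le> C / \<rho> * norm w" .
    qed
    have sum: "\<psi> x = (\<Sum>z\<in>Z. q z x)" for x
    proof (cases "\<psi> x = 0")
      case False
      have one: "(\<Sum>i<2*K. smooth_bump ((x$k - \<rho> * (real i + 1 - real K)) / \<rho> + 0)) = 1" for k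
      proof -
        have "\<bar>x$k\<bar> \<le> R" using R(2)[OF False] component_le_norm_cart[of x k] by simp
        then have "\<bar>x$k / \<rho>\<bar> \<le> R / \<rho>" using \<rho> by (simp add: divide_right_mono)
        then have "1 - real K \<le> x$k / \<rho>" "x$k / \<rho> \<le> real K" using K by linarith+
        moreover have "(x$k - \<rho> * (real i + 1 - real K)) / \<rho> + 0 = x$k / \<rho> + real K - 1 - real i" for i
          using \<rho> by (simp add: field_simps)
        ultimately show ?thesis using sum_smooth_bump by simp
      qed
      have "(\<Sum>z\<in>Z. q z x) = (\<Sum>ij\<in>{..<2*K} \<times> {..<2*K}. q (pt ij) x)"
        unfolding Z_def by (simp add: sum.reindex[OF inj])
      also have "\<dots> = (\<Sum>i<2*K. \<Sum>j<2*K. \<psi> x * (smooth_bump ((x$1 - \<rho> * (real i + 1 - real K)) / \<rho> + 0) * smooth_bump ((x$2 - \<rho> * (real j + 1 - real K)) / \<rho> + 0)))"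
        by (simp add: sum.cartesian_product q_def pt_def case_prod_beta)
      also have "\<dots> = \<psi> x * ((\<Sum>i<2*K. smooth_bump ((x$1 - \<rho> * (real i + 1 - real K)) / \<rho> + 0)) * (\<Sum>j<2*K. smooth_bump ((x$2 - \<rho> * (real j + 1 - real K)) / \<rho> + 0)))"
        unfolding sum_product by (simp only: sum_distrib_left)
      also have "\<dots> = \<psi> x" unfolding one by simp
      finally show ?thesis by simp
    qed (simp add: q_def)
    have card: "card {z\<in>Z. dist z p \<le> 3 * \<rho>} \<le> 49" for p
    proof -
      define A where "A = (\<lambda>k::2. {i::nat. \<bar>real i - (p$k / \<rho> - 1 + real K)\<bar> \<le> 3})"
      have "{z\<in>Z. dist z p \<le> 3 * \<rho>} \<subseteq> pt ` (A 1 \<times> A 2)"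
      proof
        fix z assume "z \<in> {z\<in>Z. dist z p \<le> 3 * \<rho>}"
        then obtain i j where z: "z = pt (i, j)" and d: "dist z p \<le> 3 * \<rho>" by (auto simp: Z_def)
        have "\<bar>(z - p) $ k\<bar> \<le> 3 * \<rho>" for k
          using component_le_norm_cart[of "z - p" k] d by (simp add: dist_norm)
        from this[of 1] this[of 2]
        have "\<bar>\<rho> * (real i + 1 - real K) - p$1\<bar> \<le> 3 * \<rho>" "\<bar>\<rho> * (real j + 1 - real K) - p$2\<bar> \<le> 3 * \<rho>"
          by (auto simp: z pt_def)
        moreover have "\<rho> * (real l + 1 - real K) - c = \<rho> * (real l - (c / \<rho> - 1 + real K))" for l c
          using \<rho> by (simp add: field_simps)
        ultimately have "i \<in> A 1" "j \<in> A 2" using \<rho> by (auto simp: A_def abs_mult)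
        then show "z \<in> pt ` (A 1 \<times> A 2)" using z by blast
      qed
      then have "card {z\<in>Z. dist z p \<le> 3 * \<rho>} \<le> card (pt ` (A 1 \<times> A 2))"
        by (rule card_mono[rotated]) (auto simp: A_def finite_nat_near)
      also have "\<dots> \<le> card (A 1 \<times> A 2)" by (rule card_image_le) (auto simp: A_def finite_nat_near)
      also have "\<dots> \<le> 7 * 7" unfolding card_cartesian_product by (intro mult_mono) (auto simp: A_def card_nat_near)
      finally show ?thesis by simp
    qed
    show "\<exists>Z q. patch_partition \<psi> C \<rho> Z q"
      unfolding patch_partition_def
    proof (intro exI[of _ Z] exI[of _ q] conjI ballI allI impI)
      show "finite Z" by (simp add: Z_def)
      show "smooth (q z)" for z unfolding q_def
        by (intro smooth_mult \<psi> smooth_component smooth_smooth_bump)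
    qed (use near bound grad sum card in auto)
  qed
qed

section \<open>Plane domains with \<open>C\<^sup>1\<close> boundary\<close>

lemma orthonormal_expansion:
  fixes e n x :: "real^2"
  assumes "norm e = 1" "norm n = 1" "e \<bullet> n = 0"
  shows "x = (x \<bullet> e) *\<^sub>R e + (x \<bullet> n) *\<^sub>R n"
proof -
  define y where "y = x - (x \<bullet> e) *\<^sub>R e - (x \<bullet> n) *\<^sub>R n"
  have ee: "e \<bullet> e = 1" "n \<bullet> n = 1" "n \<bullet> e = 0" using assms by (auto simp: dot_square_norm inner_commute)
  have "y \<bullet> e = 0" "y \<bullet> n = 0"
    using assms ee by (auto simp: y_def inner_diff_left)
  then have y: "y$1 * e$1 + y$2 * e$2 = 0" "y$1 * n$1 + y$2 * n$2 = 0"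
    by (auto simp: inner_vec_def sum_2)
  \<comment> \<open>\<open>d\<close> is the determinant of the frame and \<open>d * d\<close> its
    Gram determinant, which is 1; Cramer's rule then forces \<open>y = 0\<close>.\<close>
  define d where "d = e$1 * n$2 - e$2 * n$1"
  have "d * d = (e \<bullet> e) * (n \<bullet> n) - (e \<bullet> n) * (e \<bullet> n)"
    by (simp add: d_def inner_vec_def sum_2 algebra_simps)
  then have "d \<noteq> 0" using ee assms by auto
  have "d * y$1 = n$2 * (y$1 * e$1 + y$2 * e$2) - e$2 * (y$1 * n$1 + y$2 * n$2)"
    by (simp add: d_def algebra_simps)
  moreover have "d * y$2 = e$1 * (y$1 * n$1 + y$2 * n$2) - n$1 * (y$1 * e$1 + y$2 * e$2)"
    by (simp add: d_def algebra_simps)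
  ultimately have "y$1 = 0" "y$2 = 0" using y \<open>d \<noteq> 0\<close> by auto
  then have "y = 0" by (simp add: vec_eq_iff forall_2)
  then show ?thesis by (simp add: y_def algebra_simps)
qed

lemma orthonormal_norm_le:
  fixes e n x :: "real^2"
  assumes "norm e = 1" "norm n = 1" "e \<bullet> n = 0"
  shows "norm x \<le> \<bar>x \<bullet> e\<bar> + \<bar>x \<bullet> n\<bar>"
proof -
  have "norm x = norm ((x \<bullet> e) *\<^sub>R e + (x \<bullet> n) *\<^sub>R n)" using orthonormal_expansion[OF assms, of x] by simp
  also have "\<dots> \<le> \<bar>x \<bullet> e\<bar> + \<bar>x \<bullet> n\<bar>" using norm_triangle_ineq[of "(x \<bullet> e) *\<^sub>R e" "(x \<bullet> n) *\<^sub>R n"] assms by simp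
  finally show ?thesis .
qed

text \<open>A continuous derivative is bounded on a compact interval, so the graph is Lipschitz
  there. This is the form in which the geometry uses the regularity of the boundary.\<close>

lemma C1_domain_local_graph:
  assumes "C1_domain D" "p \<in> frontier D"
  shows "\<exists>e n g L r. norm e = 1 \<and> norm n = 1 \<and> e \<bullet> n = 0 \<and> L \<ge> 0 \<and> r > 0 \<and> continuous_on UNIV g \<and>
    (\<forall>s s'. \<bar>s - p \<bullet> e\<bar> \<le> r \<longrightarrow> \<bar>s' - p \<bullet> e\<bar> \<le> r \<longrightarrow> \<bar>g s - g s'\<bar> \<le> L * \<bar>s - s'\<bar>) \<and>
    (\<forall>x\<in>ball p r. x \<in> frontier D \<longleftrightarrow> x \<bullet> n = g (x \<bullet> e))"
proof -
  obtain U e n g where U: "open U" "p \<in> U" and en: "norm e = 1" "norm n = 1" "e \<bullet> n = 0"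
    and g: "(g :: real \<Rightarrow> real) C1_differentiable_on UNIV" and fr: "frontier D \<inter> U = {x \<in> U. x \<bullet> n = g (x \<bullet> e)}"
    using assms(1)[unfolded C1_domain_def, rule_format, OF assms(2)] by (elim exE conjE) (rule that)
  obtain r0 where r0: "r0 > 0" "ball p r0 \<subseteq> U" using U openE by blast
  obtain D' where D': "\<And>x. (g has_vector_derivative D' x) (at x)" "continuous_on UNIV D'"
    using g unfolding C1_differentiable_on_def by auto
  let ?I = "cball (p \<bullet> e) r0"
  have "bounded (D' ` ?I)" 
    by (intro compact_imp_bounded compact_continuous_image continuous_on_subset[OF D'(2)]) auto
  then obtain L where "L > 0" "\<forall>y\<in>D' ` ?I. norm y \<le> L" unfolding bounded_pos by blast
  then have L: "L > 0" "\<And>s. s \<in> ?I \<Longrightarrow> norm (D' s) \<le> L" by auto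
  have lip: "norm (g s - g s') \<le> L * norm (s - s')" if "s \<in> ?I" "s' \<in> ?I" for s s'
  proof (rule field_differentiable_bound[of ?I g D' L s s'])
    show "(g has_field_derivative D' z) (at z within ?I)" for z
      using has_vector_derivative_at_within[OF D'(1)] by (simp add: has_real_derivative_iff_has_vector_derivative)
  qed (use that L in auto)
  have "continuous_on UNIV g" using D'(1)
    by (meson continuous_at_imp_continuous_on has_vector_derivative_continuous)
  then show ?thesis
    using en L(1) r0 lip fr
    by (intro exI[of _ e] exI[of _ n] exI[of _ g] exI[of _ L] exI[of _ r0])
      (auto simp: dist_real_def abs_minus_commute)
qed

text \<open>\<open>P\<close> is the region between the graph and a lid at height
  \<open>(L + 1) * d\<close> over \<open>p\<close>. Over the interval of radius \<open>d\<close> the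
  graph does not exceed height \<open>L * d\<close>, so every vertical slice is a nonempty segment
  and the region is a continuous image of a rectangle. Applied to \<open>n\<close>, \<open>g\<close>
  and to \<open>- n\<close>, \<open>- g\<close> it gives the two sides of the curve.\<close>

lemma graph_side:
  fixes e n p :: "real^2" and g :: "real \<Rightarrow> real"
  assumes en: "norm e = 1" "norm n = 1" "e \<bullet> n = 0" and L: "L \<ge> 0" and d: "d > 0"
    and g: "continuous_on UNIV g"
    and lip: "\<And>s. \<bar>s - p \<bullet> e\<bar> < d \<Longrightarrow> \<bar>g s - p \<bullet> n\<bar> \<le> L * \<bar>s - p \<bullet> e\<bar>"
  defines "P \<equiv> {x. \<bar>(x - p) \<bullet> e\<bar> < d \<and> g (x \<bullet> e) < x \<bullet> n \<and> (x - p) \<bullet> n < (L + 1) * d}"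
  shows "connected P" "P \<subseteq> ball p ((L + 2) * d)"
    "\<And>\<rho>. 0 < \<rho> \<Longrightarrow> \<rho> \<le> d \<Longrightarrow> ball (p + (\<rho> / 2) *\<^sub>R n) (\<rho> / (2 * (1 + L))) \<subseteq> P \<inter> ball p \<rho>"
proof -
  have ee: "e \<bullet> e = 1" "n \<bullet> n = 1" "n \<bullet> e = 0" using en by (auto simp: dot_square_norm inner_commute)
  have gb: "g s < p \<bullet> n + (L + 1) * d" "p \<bullet> n - L * d \<le> g s" if "\<bar>s - p \<bullet> e\<bar> < d" for s
  proof -
    have "L * \<bar>s - p \<bullet> e\<bar> \<le> L * d" using that L by (intro mult_left_mono) auto
    with lip[OF that] have "\<bar>g s - p \<bullet> n\<bar> \<le> L * d" by linarith
    then show "g s < p \<bullet> n + (L + 1) * d" "p \<bullet> n - L * d \<le> g s" using d by (auto simp: algebra_simps)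
  qed
  \<comment> \<open>\<open>\<tau>\<close> interpolates from the graph (value 0) to the lid (value
    1).\<close>
  define h where "h = (\<lambda>(s, \<tau>). s *\<^sub>R e + ((1 - \<tau>) * g s + \<tau> * (p \<bullet> n + (L + 1) * d)) *\<^sub>R n)"
  have "P = h ` ({p \<bullet> e - d<..<p \<bullet> e + d} \<times> {0<..<1})"
  proof (intro equalityI subsetI)
    fix x assume x: "x \<in> P"
    define s where "s = x \<bullet> e"
    define \<tau> where "\<tau> = (x \<bullet> n - g s) / (p \<bullet> n + (L + 1) * d - g s)"
    have s: "\<bar>s - p \<bullet> e\<bar> < d" and x': "g s < x \<bullet> n" "x \<bullet> n < p \<bullet> n + (L + 1) * d"
      using x by (auto simp: P_def s_def inner_diff_left)
    have t: "0 < \<tau>" "\<tau> < 1" using x' gb(1)[OF s] by (auto simp: \<tau>_def)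
    have "(1 - \<tau>) * g s + \<tau> * (p \<bullet> n + (L + 1) * d) = g s + \<tau> * (p \<bullet> n + (L + 1) * d - g s)"
      by (simp add: algebra_simps)
    also have "\<dots> = x \<bullet> n" using gb(1)[OF s] by (simp add: \<tau>_def)
    finally have "h (s, \<tau>) = x"
      using orthonormal_expansion[OF en, of x] by (simp add: h_def s_def)
    then show "x \<in> h ` ({p \<bullet> e - d<..<p \<bullet> e + d} \<times> {0<..<1})"
      using s t by (intro image_eqI[of _ _ "(s, \<tau>)"]) auto
  next
    fix x assume "x \<in> h ` ({p \<bullet> e - d<..<p \<bullet> e + d} \<times> {0<..<1})"
    then obtain s \<tau> where s: "\<bar>s - p \<bullet> e\<bar> < d" and t: "0 < \<tau>" "\<tau> < 1" and x: "x = h (s, \<tau>)" by force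
    define G where "G = p \<bullet> n + (L + 1) * d"
    have xe: "x \<bullet> e = s" "x \<bullet> n = (1 - \<tau>) * g s + \<tau> * G"
      using ee en by (auto simp: x h_def inner_add_left G_def)
    have "0 < \<tau> * (G - g s)" "0 < (1 - \<tau>) * (G - g s)" using t gb(1)[OF s] by (auto simp: G_def)
    then have "g s < x \<bullet> n" "x \<bullet> n < G" unfolding xe by (auto simp: algebra_simps)
    then show "x \<in> P" using s by (auto simp: P_def inner_diff_left xe(1) G_def)
  qed
  moreover have "connected (h ` ({p \<bullet> e - d<..<p \<bullet> e + d} \<times> {0<..<1}))"
    unfolding h_def case_prod_beta
    by (intro connected_continuous_image convex_connected convex_Times continuous_intros
        continuous_on_compose2[OF g]) auto
  ultimately show "connected P" by simp
  show "P \<subseteq> ball p ((L + 2) * d)"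
  proof
    fix x assume x: "x \<in> P"
    then have "\<bar>x \<bullet> e - p \<bullet> e\<bar> < d" by (simp add: P_def inner_diff_left)
    then have "\<bar>(x - p) \<bullet> n\<bar> \<le> (L + 1) * d" using gb(2)[of "x \<bullet> e"] x d
      by (auto simp: P_def inner_diff_left algebra_simps)
    then have "norm (x - p) < d + (L + 1) * d"
      using orthonormal_norm_le[OF en, of "x - p"] x by (auto simp: P_def)
    then show "x \<in> ball p ((L + 2) * d)" by (simp add: dist_norm norm_minus_commute algebra_simps)
  qed
  fix \<rho> :: real assume \<rho>: "0 < \<rho>" "\<rho> \<le> d"
  \<comment> \<open>The ball is centred \<open>\<rho> / 2\<close> above \<open>p\<close>. Within
    radius \<open>k\<close> a point loses less than \<open>k\<close> of height while the graph
    climbs by at most \<open>L * k\<close>; \<open>k\<close> is chosen so that the two add up to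
    \<open>\<rho> / 2\<close>.\<close>
  define k where "k = \<rho> / (2 * (1 + L))"
  have nz: "2 * (1 + L) \<noteq> 0" using L by simp
  have "\<rho> = k * (2 * (1 + L))"
    by (rule nonzero_divide_eq_eq[OF nz, THEN iffD1]) (simp only: k_def)
  then have k: "k + L * k = \<rho> / 2" by (simp add: algebra_simps)
  have k0: "k > 0" using \<rho> L by (simp add: k_def)
  have Lk: "L * k \<ge> 0" using L k0 by simp
  show "ball (p + (\<rho> / 2) *\<^sub>R n) (\<rho> / (2 * (1 + L))) \<subseteq> P \<inter> ball p \<rho>"
  proof
    fix x assume "x \<in> ball (p + (\<rho> / 2) *\<^sub>R n) (\<rho> / (2 * (1 + L)))"
    then have x: "norm (x - p - (\<rho> / 2) *\<^sub>R n) < k"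
      by (simp add: k_def dist_norm norm_minus_commute algebra_simps)
    have "\<bar>(x - p - (\<rho> / 2) *\<^sub>R n) \<bullet> e\<bar> < k" "\<bar>(x - p - (\<rho> / 2) *\<^sub>R n) \<bullet> n\<bar> < k"
      using Cauchy_Schwarz_ineq2[of "x - p - (\<rho> / 2) *\<^sub>R n" e] Cauchy_Schwarz_ineq2[of "x - p - (\<rho> / 2) *\<^sub>R n" n] en x by auto
    then have xe: "\<bar>x \<bullet> e - p \<bullet> e\<bar> < k" and xn: "\<bar>x \<bullet> n - p \<bullet> n - \<rho> / 2\<bar> < k"
      using ee by (auto simp: inner_diff_left)
    have kd: "k < d" using k Lk \<rho> by linarith
    have "L * \<bar>x \<bullet> e - p \<bullet> e\<bar> \<le> L * k" using xe L by (intro mult_left_mono) auto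
    with lip[of "x \<bullet> e"] xe kd have "\<bar>g (x \<bullet> e) - p \<bullet> n\<bar> \<le> L * k" by linarith
    then have "g (x \<bullet> e) < x \<bullet> n" using xn k by linarith
    moreover have "x \<bullet> n - p \<bullet> n < (L + 1) * d"
    proof -
      have "0 \<le> L * d" using L d by simp
      then have "d \<le> (L + 1) * d" by (simp add: algebra_simps)
      then show ?thesis using xn k Lk \<rho> by linarith
    qed
    ultimately have "x \<in> P" using xe kd by (auto simp: P_def inner_diff_left)
    moreover have "norm (x - p) < \<rho>"
      using norm_triangle_ineq[of "x - p - (\<rho> / 2) *\<^sub>R n" "(\<rho> / 2) *\<^sub>R n"] x en \<rho> k Lk by simp
    ultimately show "x \<in> P \<inter> ball p \<rho>" by (simp add: dist_norm norm_minus_commute)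
  qed
qed

text \<open>The sides \<open>P\<close> and \<open>Q\<close> are not yet attributed to
  \<open>D\<close> or to its exterior, since that needs global information on components. The balls
  record that each side fills a fixed fraction of every small disc about \<open>p\<close>.\<close>

lemma domain_local_sides:
  assumes "C1_domain D" "p \<in> frontier D"
  shows "\<exists>d>0. \<exists>\<kappa>>0. \<exists>P Q. connected P \<and> connected Q \<and> P \<inter> frontier D = {} \<and> Q \<inter> frontier D = {} \<and>
    ball p d - frontier D \<subseteq> P \<union> Q \<and>
    (\<forall>\<rho>. 0 < \<rho> \<longrightarrow> \<rho> \<le> d \<longrightarrow> (\<exists>y. ball y (\<kappa> * \<rho>) \<subseteq> P \<inter> ball p \<rho>) \<and> (\<exists>y. ball y (\<kappa> * \<rho>) \<subseteq> Q \<inter> ball p \<rho>))"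
proof -
  obtain e n g L r where en: "norm e = 1" "norm n = 1" "e \<bullet> n = 0" and L: "L \<ge> 0" and r: "r > 0"
    and g: "continuous_on UNIV g"
    and lip: "\<And>s s'. \<bar>s - p \<bullet> e\<bar> \<le> r \<Longrightarrow> \<bar>s' - p \<bullet> e\<bar> \<le> r \<Longrightarrow> \<bar>g s - g s'\<bar> \<le> L * \<bar>s - s'\<bar>"
    and fr: "\<And>x. x \<in> ball p r \<Longrightarrow> x \<in> frontier D \<longleftrightarrow> x \<bullet> n = g (x \<bullet> e)"
    using C1_domain_local_graph[OF assms] by blast
  \<comment> \<open>Chosen so that both regions lie in \<open>ball p r\<close>, where the frontier
    is known to be the graph.\<close>
  define d where "d = r / (L + 2)"
  have d: "d > 0" "(L + 2) * d = r" "d \<le> r" using L r by (auto simp: d_def field_simps)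
  have gp: "g (p \<bullet> e) = p \<bullet> n" using fr[of p] r assms by auto
  have lip1: "\<bar>g s - p \<bullet> n\<bar> \<le> L * \<bar>s - p \<bullet> e\<bar>" if "\<bar>s - p \<bullet> e\<bar> < d" for s
    using lip[of s "p \<bullet> e"] that d gp r by auto
  define P where "P = {x. \<bar>(x - p) \<bullet> e\<bar> < d \<and> g (x \<bullet> e) < x \<bullet> n \<and> (x - p) \<bullet> n < (L + 1) * d}"
  define Q where "Q = {x. \<bar>(x - p) \<bullet> e\<bar> < d \<and> - g (x \<bullet> e) < x \<bullet> (-n) \<and> (x - p) \<bullet> (-n) < (L + 1) * d}"
  have SP: "connected P" "P \<subseteq> ball p ((L + 2) * d)"
    "\<And>\<rho>. 0 < \<rho> \<Longrightarrow> \<rho> \<le> d \<Longrightarrow> ball (p + (\<rho> / 2) *\<^sub>R n) (\<rho> / (2 * (1 + L))) \<subseteq> P \<inter> ball p \<rho>"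
    unfolding P_def using graph_side[of e n L d g p] en L d g lip1 by auto
  have SQ: "connected Q" "Q \<subseteq> ball p ((L + 2) * d)"
    "\<And>\<rho>. 0 < \<rho> \<Longrightarrow> \<rho> \<le> d \<Longrightarrow> ball (p + (\<rho> / 2) *\<^sub>R (-n)) (\<rho> / (2 * (1 + L))) \<subseteq> Q \<inter> ball p \<rho>"
    unfolding Q_def using graph_side[of e "-n" L d "\<lambda>s. - g s" p] en L d g lip1
    by (auto simp: continuous_on_minus abs_minus_commute)
  have PJ: "P \<inter> frontier D = {}" using SP(2) fr d by (force simp: P_def)
  have QJ: "Q \<inter> frontier D = {}" using SQ(2) fr d by (force simp: Q_def)
  have cov: "ball p d - frontier D \<subseteq> P \<union> Q"
  proof
    fix x assume x: "x \<in> ball p d - frontier D"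
    then have "x \<in> ball p r" "norm (x - p) < d" using d by (auto simp: dist_norm norm_minus_commute)
    then have "\<bar>(x - p) \<bullet> e\<bar> < d" "\<bar>(x - p) \<bullet> n\<bar> < d"
      using Cauchy_Schwarz_ineq2[of "x - p" e] Cauchy_Schwarz_ineq2[of "x - p" n] en by auto
    moreover have "d \<le> (L + 1) * d" using L d by (simp add: algebra_simps)
    moreover have "x \<bullet> n \<noteq> g (x \<bullet> e)" using fr[OF \<open>x \<in> ball p r\<close>] x by simp
    ultimately show "x \<in> P \<union> Q" by (auto simp: P_def Q_def)
  qed
  define \<kappa> where "\<kappa> = 1 / (2 * (1 + L))"
  have "\<kappa> > 0" using L by (simp add: \<kappa>_def)
  moreover have "(\<exists>y. ball y (\<kappa> * \<rho>) \<subseteq> P \<inter> ball p \<rho>) \<and> (\<exists>y. ball y (\<kappa> * \<rho>) \<subseteq> Q \<inter> ball p \<rho>)"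
    if "0 < \<rho>" "\<rho> \<le> d" for \<rho>
    using SP(3)[OF that] SQ(3)[OF that] unfolding \<kappa>_def by auto
  ultimately show ?thesis using d(1) PJ QJ cov SP(1) SQ(1) by blast
qed

section \<open>The two sides of the boundary curve\<close>

lemma bounded_domain_frontier:
  assumes "bounded_domain D"
  shows "compact (frontier D)" "frontier D \<noteq> {}" "D \<inter> frontier D = {}" "D \<noteq> {}"
proof -
  show c: "compact (frontier D)" using assms by (simp add: bounded_domain_def compact_frontier_bounded)
  obtain \<gamma> where "path_image \<gamma> = frontier D" using assms by (auto simp: bounded_domain_def)
  then show "frontier D \<noteq> {}" by (metis path_image_nonempty)
  then show "D \<noteq> {}" by auto
  show "D \<inter> frontier D = {}" using assms by (simp add: bounded_domain_def frontier_def interior_open)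
qed

lemma bounded_domain_component_frontier:
  assumes "bounded_domain D" "W \<in> components (- frontier D)"
  shows "frontier W = frontier D"
proof -
  obtain \<gamma> where \<gamma>: "simple_path \<gamma>" "pathfinish \<gamma> = pathstart \<gamma>" "path_image \<gamma> = frontier D"
    using assms by (auto simp: bounded_domain_def)
  have "frontier D homeomorphic sphere (0::complex) 1"
    using homeomorphic_simple_path_image_circle[OF \<gamma>(1,2), of 1 0] \<gamma>(3) by simp
  moreover have "sphere (0::complex) 1 homeomorphic sphere (0::real^2) 1"
    by (rule homeomorphic_spheres_gen) auto
  ultimately have "frontier D homeomorphic sphere (0::real^2) 1" by (rule homeomorphic_trans)
  then show ?thesis by (rule Jordan_Brouwer_frontier[OF _ assms(2)]) simp
qed

text \<open>A connected set that meets \<open>D\<close> and misses the frontier cannot leave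
  \<open>D\<close>, so \<open>D\<close> is maximal.\<close>

lemma bounded_domain_component:
  assumes "bounded_domain D"
  shows "D \<in> components (- frontier D)"
  unfolding in_components_maximal
proof (intro conjI allI impI)
  fix c assume c: "c \<noteq> {} \<and> D \<subseteq> c \<and> c \<subseteq> - frontier D \<and> connected c"
  then have "c \<inter> D \<noteq> {}" "c \<inter> frontier D = {}" using bounded_domain_frontier[OF assms] by auto
  then have "c - D = {}" using connected_Int_frontier[of c D] c by blast
  then show "c = D" using c by auto
qed (use assms bounded_domain_frontier[OF assms] in \<open>auto simp: bounded_domain_def\<close>)

text \<open>The library's Jordan curve theorem is about \<^typ>\<open>complex\<close>; here the exterior is connected because
  by Jordan--Brouwer every component of the complement has the whole curve as boundary, while near
  one boundary point there are only two sides.\<close>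

lemma C1_bounded_domain_sides:
  assumes D: "bounded_domain D" "C1_domain D"
  shows "connected (- closure D)"
    "\<And>p. p \<in> frontier D \<Longrightarrow> \<exists>d>0. \<exists>\<kappa>>0. \<forall>\<rho>. 0 < \<rho> \<longrightarrow> \<rho> \<le> d \<longrightarrow>
       (\<exists>y. ball y (\<kappa> * \<rho>) \<subseteq> D \<inter> ball p \<rho>) \<and> (\<exists>y. ball y (\<kappa> * \<rho>) \<subseteq> ball p \<rho> - closure D)"
proof -
  let ?J = "frontier D"
  note J = bounded_domain_frontier[OF D(1)]
  have DC: "D \<in> components (- ?J)" by (rule bounded_domain_component[OF D(1)])
  have "bounded D" using D by (simp add: bounded_domain_def)
  obtain W where W: "W \<in> components (- ?J)" "\<not> bounded W"
    using cobounded_unbounded_components[of "- ?J"] J(1) compact_imp_bounded by auto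
  then have WD: "W \<noteq> D" using \<open>bounded D\<close> by auto
  \<comment> \<open>Here \<open>P\<close> is whichever local side lies in \<open>D\<close>. The
    other side is contained in every other component simultaneously, and as components are disjoint
    this leaves room for only one of them.\<close>
  have sides: "\<exists>d>0. \<exists>\<kappa>>0. \<exists>P Q. (\<forall>\<rho>. 0 < \<rho> \<longrightarrow> \<rho> \<le> d \<longrightarrow> (\<exists>y. ball y (\<kappa> * \<rho>) \<subseteq> P \<inter> ball p \<rho>) \<and> (\<exists>y. ball y (\<kappa> * \<rho>) \<subseteq> Q \<inter> ball p \<rho>)) \<and>
     P \<subseteq> D \<and> (\<forall>V\<in>components (- ?J). V \<noteq> D \<longrightarrow> Q \<subseteq> V)" if p: "p \<in> ?J" for p
  proof -
    obtain d \<kappa> P Q where d: "d > 0" and k: "\<kappa> > 0" and P: "connected P" "P \<inter> ?J = {}" and Q: "connected Q" "Q \<inter> ?J = {}"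
      and cov: "ball p d - ?J \<subseteq> P \<union> Q"
      and b: "\<And>\<rho>. 0 < \<rho> \<Longrightarrow> \<rho> \<le> d \<Longrightarrow> (\<exists>y. ball y (\<kappa> * \<rho>) \<subseteq> P \<inter> ball p \<rho>) \<and> (\<exists>y. ball y (\<kappa> * \<rho>) \<subseteq> Q \<inter> ball p \<rho>)"
      using domain_local_sides[OF D(2) p] by blast
    have meet: "P \<subseteq> V \<or> Q \<subseteq> V" if V: "V \<in> components (- ?J)" for V
    proof -
      have "p \<in> closure V" using bounded_domain_component_frontier[OF D(1) V] p by (auto simp: frontier_def)
      then obtain x where x: "x \<in> V" "dist x p < d" using d closure_approachable by blast
      then have "x \<in> P \<or> x \<in> Q" using cov V in_components_subset[OF V] by (auto simp: dist_commute)
      then show ?thesis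
        using components_maximal[OF V P(1)] components_maximal[OF V Q(1)] P Q x by blast
    qed
    have "ball y (\<kappa> * d) \<noteq> {}" for y :: "real^2" using mult_pos_pos[OF k d] by (simp add: not_le)
    then have ne: "P \<noteq> {}" "Q \<noteq> {}" using b[OF d] by blast+
    have dis: "V = V'" if "V \<in> components (- ?J)" "V' \<in> components (- ?J)" "X \<subseteq> V" "X \<subseteq> V'" "X \<noteq> {}" for V V' and X :: "(real^2) set"
      using components_nonoverlap[OF that(1,2)] that(3-5) by blast
    show ?thesis
    proof (cases "P \<subseteq> D")
      case True
      have "Q \<subseteq> V" if "V \<in> components (- ?J)" "V \<noteq> D" for V
        using meet[OF that(1)] dis[OF that(1) DC _ True ne(1)] that by blast
      with True show ?thesis using b d k by blast
    next
      case False
      then have "Q \<subseteq> D" using meet[OF DC] by blast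
      moreover have "P \<subseteq> V" if "V \<in> components (- ?J)" "V \<noteq> D" for V
        using meet[OF that(1)] dis[OF that(1) DC _ \<open>Q \<subseteq> D\<close> ne(2)] that by blast
      ultimately show ?thesis using b d k by blast
    qed
  qed
  have eq: "V = W" if V: "V \<in> components (- ?J)" "V \<noteq> D" for V
  proof -
    obtain p where "p \<in> ?J" using J by blast
    from sides[OF this] obtain d \<kappa> P Q where "d > 0" "\<kappa> > 0" "Q \<subseteq> V" "Q \<subseteq> W" 
      and b: "\<exists>y. ball y (\<kappa> * d) \<subseteq> Q \<inter> ball p d"
      using V W WD by (metis order_refl)
    moreover have "ball y (\<kappa> * d) \<noteq> {}" for y :: "real^2" using mult_pos_pos[OF \<open>\<kappa> > 0\<close> \<open>d > 0\<close>] by (simp add: not_le)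
    then have "Q \<noteq> {}" using b by blast
    ultimately show ?thesis using components_nonoverlap[OF V(1) W(1)] by blast
  qed
  have cl: "closure D = D \<union> ?J" using closure_Un_frontier by blast
  have WC: "- closure D = W"
  proof (intro equalityI subsetI)
    fix x assume x: "x \<in> - closure D"
    then have "x \<in> \<Union>(components (- ?J))" unfolding Union_components cl by simp
    then obtain V where "V \<in> components (- ?J)" "x \<in> V" by blast
    then show "x \<in> W" using eq[of V] x cl by auto
  next
    fix x assume "x \<in> W"
    then show "x \<in> - closure D" using components_nonoverlap[OF W(1) DC] WD in_components_subset[OF W(1)] unfolding cl by auto
  qed
  show "connected (- closure D)" unfolding WC by (rule in_components_connected[OF W(1)])
  fix p assume "p \<in> ?J"
  from sides[OF this] obtain d \<kappa> P Q where d: "d > 0" "\<kappa> > 0" and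
    b: "\<forall>\<rho>. 0 < \<rho> \<longrightarrow> \<rho> \<le> d \<longrightarrow> (\<exists>y. ball y (\<kappa> * \<rho>) \<subseteq> P \<inter> ball p \<rho>) \<and> (\<exists>y. ball y (\<kappa> * \<rho>) \<subseteq> Q \<inter> ball p \<rho>)"
    and PQ: "P \<subseteq> D" "\<forall>V\<in>components (- ?J). V \<noteq> D \<longrightarrow> Q \<subseteq> V" by (elim exE conjE) (rule that)
  have PQ: "P \<subseteq> D" "Q \<subseteq> W" using PQ W WD by auto
  show "\<exists>d>0. \<exists>\<kappa>>0. \<forall>\<rho>. 0 < \<rho> \<longrightarrow> \<rho> \<le> d \<longrightarrow>
       (\<exists>y. ball y (\<kappa> * \<rho>) \<subseteq> D \<inter> ball p \<rho>) \<and> (\<exists>y. ball y (\<kappa> * \<rho>) \<subseteq> ball p \<rho> - closure D)"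
  proof (rule exI[of _ d], rule conjI[OF d(1)], rule exI[of _ \<kappa>], rule conjI[OF d(2)], intro allI impI)
    fix \<rho> assume \<rho>: "0 < \<rho>" "\<rho> \<le> d"
    obtain y y' where "ball y (\<kappa> * \<rho>) \<subseteq> P \<inter> ball p \<rho>" "ball y' (\<kappa> * \<rho>) \<subseteq> Q \<inter> ball p \<rho>" using b[rule_format, OF \<rho>] by blast
    then show "(\<exists>y. ball y (\<kappa> * \<rho>) \<subseteq> D \<inter> ball p \<rho>) \<and> (\<exists>y. ball y (\<kappa> * \<rho>) \<subseteq> ball p \<rho> - closure D)"
      using PQ WC by (intro conjI exI[of _ y] exI[of _ y']) auto
  qed
qed

section \<open>Area of neighbourhoods of the boundary\<close>

lemma frontier_cover_local:
  assumes "C1_domain D" "p \<in> frontier D"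
  shows "\<exists>\<epsilon>>0. \<exists>C. \<forall>r. 0 < r \<longrightarrow> r \<le> 1 \<longrightarrow> 
    (\<exists>F. finite F \<and> real (card F) \<le> C / r \<and> frontier D \<inter> ball p \<epsilon> \<subseteq> (\<Union>c\<in>F. cball c r))"
proof -
  obtain e n g L R where en: "norm e = 1" "norm n = 1" "e \<bullet> n = 0" and L: "L \<ge> 0" and R: "R > 0"
    and lip: "\<And>s s'. \<bar>s - p \<bullet> e\<bar> \<le> R \<Longrightarrow> \<bar>s' - p \<bullet> e\<bar> \<le> R \<Longrightarrow> \<bar>g s - g s'\<bar> \<le> L * \<bar>s - s'\<bar>"
    and fr: "\<And>x. x \<in> ball p R \<Longrightarrow> x \<in> frontier D \<longleftrightarrow> x \<bullet> n = g (x \<bullet> e)"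
    using C1_domain_local_graph[OF assms] by blast
  have ee: "e \<bullet> e = 1" "n \<bullet> n = 1" "n \<bullet> e = 0" using en by (auto simp: dot_square_norm inner_commute)
  show ?thesis
  proof (rule exI[of _ R], rule conjI[OF R], rule exI[of _ "2 * R * (L + 1) + 2"], intro allI impI)
    fix r :: real assume r: "0 < r" "r \<le> 1"
    \<comment> \<open>Spacing of the abscissae: a move by \<open>h\<close> along \<open>e\<close>
      changes the height of the graph by at most \<open>L * h\<close>, and the two add up to
      \<open>r\<close>. About \<open>2 * R / h\<close> graph points suffice, a number of order
      \<open>1 / r\<close>.\<close>
    define h where "h = r / (L + 1)"
    have h: "h > 0" "h + L * h = r"
    proof -
      show "h > 0" using r L by (simp add: h_def)
      have "(L + 1) * h = r" using L by (simp add: h_def)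
      then show "h + L * h = r" by (simp add: algebra_simps)
    qed
    define M where "M = nat \<lfloor>2 * R / h\<rfloor> + 1"
    define s where "s = (\<lambda>k::nat. p \<bullet> e - R + real k * h)"
    define F where "F = (\<lambda>k. s k *\<^sub>R e + g (s k) *\<^sub>R n) ` {..<M}"
    have "real (card F) \<le> real M" unfolding F_def using card_image_le[of "{..<M}"] by fastforce
    also have "\<dots> \<le> 2 * R / h + 1" using R h by (simp add: M_def)
    also have "\<dots> \<le> 2 * R * (L + 1) / r + 2 / r" using r by (simp add: h_def field_simps)
    finally have "real (card F) \<le> (2 * R * (L + 1) + 2) / r" by (simp add: add_divide_distrib)
    moreover have "frontier D \<inter> ball p R \<subseteq> (\<Union>c\<in>F. cball c r)"
    proof
      fix q assume q: "q \<in> frontier D \<inter> ball p R"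
      then have qn: "q \<bullet> n = g (q \<bullet> e)" using fr by auto
      have qe: "\<bar>q \<bullet> e - p \<bullet> e\<bar> < R"
        using Cauchy_Schwarz_ineq2[of "q - p" e] en q by (auto simp: dist_norm norm_minus_commute inner_diff_left)
      define k where "k = nat \<lfloor>(q \<bullet> e - p \<bullet> e + R) / h\<rfloor>"
      have nn: "0 \<le> (q \<bullet> e - p \<bullet> e + R) / h" using qe h by auto
      have k1: "real k \<le> (q \<bullet> e - p \<bullet> e + R) / h" "(q \<bullet> e - p \<bullet> e + R) / h < real k + 1"
        using nn by (auto simp: k_def)
      then have k2: "real k * h \<le> q \<bullet> e - p \<bullet> e + R" "q \<bullet> e - p \<bullet> e + R < real k * h + h"
        using h by (auto simp: field_simps)
      have "(q \<bullet> e - p \<bullet> e + R) / h \<le> 2 * R / h" using qe h by (intro divide_right_mono) auto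
      then have "k < M" using nn by (simp add: k_def M_def less_Suc_eq_le nat_mono floor_mono)
      have sk: "\<bar>s k - p \<bullet> e\<bar> \<le> R" "\<bar>q \<bullet> e - s k\<bar> \<le> h" using k2 qe h by (auto simp: s_def abs_le_iff)
      define c where "c = s k *\<^sub>R e + g (s k) *\<^sub>R n"
      have "\<bar>(q - c) \<bullet> n\<bar> \<le> L * \<bar>q \<bullet> e - s k\<bar>"
        using lip[of "q \<bullet> e" "s k"] sk qe en ee by (simp add: c_def inner_diff_left inner_add_left qn)
      also have "\<dots> \<le> L * h" using sk L by (intro mult_left_mono) auto
      finally have "norm (q - c) \<le> r"
        using orthonormal_norm_le[OF en, of "q - c"] sk h ee en by (simp add: c_def inner_diff_left inner_add_left)
      then have "q \<in> cball c r" by (simp add: dist_norm norm_minus_commute)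
      then show "q \<in> (\<Union>c\<in>F. cball c r)" using \<open>k < M\<close> by (auto simp: F_def c_def)
    qed
    moreover have "finite F" by (simp add: F_def)
    ultimately show "\<exists>F. finite F \<and> real (card F) \<le> (2 * R * (L + 1) + 2) / r \<and> frontier D \<inter> ball p R \<subseteq> (\<Union>c\<in>F. cball c r)"
      by blast
  qed
qed

lemma frontier_cover:
  assumes "bounded_domain D" "C1_domain D"
  shows "\<exists>C. \<forall>r. 0 < r \<longrightarrow> r \<le> 1 \<longrightarrow> 
    (\<exists>F. finite F \<and> real (card F) \<le> C / r \<and> frontier D \<subseteq> (\<Union>c\<in>F. cball c r))"
proof -
  let ?J = "frontier D"
  obtain \<epsilon> C where e: "\<And>p. p \<in> ?J \<Longrightarrow> \<epsilon> p > 0"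
    and C: "\<And>p r. p \<in> ?J \<Longrightarrow> 0 < r \<Longrightarrow> r \<le> 1 \<Longrightarrow> \<exists>F. finite F \<and> real (card F) \<le> C p / r \<and> ?J \<inter> ball p (\<epsilon> p) \<subseteq> (\<Union>c\<in>F. cball c r)"
    using frontier_cover_local[OF assms(2)] by metis
  obtain K where K: "K \<subseteq> ?J" "finite K" "?J \<subseteq> (\<Union>p\<in>K. ball p (\<epsilon> p))"
  proof (rule compactE_image[OF bounded_domain_frontier(1)[OF assms(1)], of ?J "\<lambda>p. ball p (\<epsilon> p)"])
    show "?J \<subseteq> (\<Union>p\<in>?J. ball p (\<epsilon> p))" using e by auto
  qed auto
  show ?thesis
  proof (intro exI[of _ "\<Sum>p\<in>K. C p"] allI impI)
    fix r :: real assume r: "0 < r" "r \<le> 1"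
    obtain F where F: "\<And>p. p \<in> K \<Longrightarrow> finite (F p) \<and> real (card (F p)) \<le> C p / r \<and> ?J \<inter> ball p (\<epsilon> p) \<subseteq> (\<Union>c\<in>F p. cball c r)"
      using C[OF _ r] K(1) by (metis subsetD)
    have "real (card (\<Union>p\<in>K. F p)) \<le> (\<Sum>p\<in>K. real (card (F p)))"
      using card_UN_le[OF K(2), of F] by (metis of_nat_le_iff of_nat_sum)
    also have "\<dots> \<le> (\<Sum>p\<in>K. C p / r)" using F by (intro sum_mono) auto
    finally have "real (card (\<Union>p\<in>K. F p)) \<le> (\<Sum>p\<in>K. C p) / r" by (simp add: sum_divide_distrib)
    moreover have "?J \<subseteq> (\<Union>c\<in>(\<Union>p\<in>K. F p). cball c r)" using K(3) F by fastforce
    ultimately show "\<exists>F. finite F \<and> real (card F) \<le> (\<Sum>p\<in>K. C p) / r \<and> ?J \<subseteq> (\<Union>c\<in>F. cball c r)"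
      using F K(2) by blast
  qed
qed

lemma measure_ball_plane: "r \<ge> 0 \<Longrightarrow> measure lborel (ball (c::real^2) r) = r\<^sup>2 * measure lborel (ball (0::real^2) 1)"
  using content_ball_conv_unit_ball[of r c] by (simp add: DIM_cart)

text \<open>The closed ball is put into the open one of double radius, whence the factor 4; only the
  order \<open>r\<^sup>2\<close> matters later.\<close>

lemma measure_cball_le: "r > 0 \<Longrightarrow> measure lborel (cball (c::real^2) r) \<le> 4 * r\<^sup>2 * measure lborel (ball (0::real^2) 1)"
proof -
  assume "r > 0"
  have "measure lborel (cball c r) \<le> measure lborel (ball c (2 * r))"
    by (rule measure_mono_fmeasurable) (use \<open>r > 0\<close> in \<open>auto intro!: fmeasurableI emeasure_lborel_ball_finite\<close>)
  also have "measure lborel (ball c (2 * r)) = (2 * r)\<^sup>2 * measure lborel (ball (0::real^2) 1)"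
    using \<open>r > 0\<close> by (intro measure_ball_plane) simp
  finally show ?thesis by (simp add: power_mult_distrib)
qed

text \<open>At most \<open>C / r\<close> balls of radius \<open>r\<close> cover the curve; doubling
  their radii covers the neighbourhood, at a cost of order \<open>r\<^sup>2\<close> each. The
  maximum with 1 only makes the constant positive.\<close>

lemma frontier_neighbourhood_measure:
  assumes D: "bounded_domain D" "C1_domain D"
  shows "\<exists>C>0. \<forall>r. 0 < r \<longrightarrow> r \<le> 1 \<longrightarrow> measure lborel {x. infdist x (frontier D) \<le> r} \<le> C * r"
proof -
  let ?V = "measure lborel (ball (0::real^2) 1)"
  obtain C where C: "\<And>r. 0 < r \<Longrightarrow> r \<le> 1 \<Longrightarrow> 
    \<exists>F. finite F \<and> real (card F) \<le> C / r \<and> frontier D \<subseteq> (\<Union>c\<in>F. cball c r)"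
    using frontier_cover[OF D] by blast
  have main: "measure lborel {x. infdist x (frontier D) \<le> r} \<le> (max 1 (16 * C * ?V)) * r" if r: "0 < r" "r \<le> 1" for r
  proof -
    obtain F where F: "finite F" "real (card F) \<le> C / r" "frontier D \<subseteq> (\<Union>c\<in>F. cball c r)"
      using C[OF r] by blast
    have sub: "{x. infdist x (frontier D) \<le> r} \<subseteq> (\<Union>c\<in>F. cball c (2 * r))"
    proof
      fix x assume x: "x \<in> {x. infdist x (frontier D) \<le> r}"
      obtain q where q: "q \<in> frontier D" "infdist x (frontier D) = dist x q"
        using infdist_attains_inf[OF frontier_closed bounded_domain_frontier(2)[OF D(1)], of x] by blast
      obtain c where "c \<in> F" "dist c q \<le> r" using F q by auto
      then have "dist c x \<le> 2 * r" using x q dist_triangle[of c x q] by (simp add: dist_commute)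
      then show "x \<in> (\<Union>c\<in>F. cball c (2 * r))" using \<open>c \<in> F\<close> by auto
    qed
    have cl: "closed {x. infdist x (frontier D) \<le> r}"
      by (intro closed_Collect_le continuous_intros)
    have "measure lborel {x. infdist x (frontier D) \<le> r} \<le> measure lborel (\<Union>c\<in>F. cball c (2 * r))"
      by (rule measure_mono_fmeasurable[OF sub])
        (use cl F(1) in \<open>auto intro!: fmeasurable_compact compact_UN\<close>)
    also have "\<dots> \<le> (\<Sum>c\<in>F. measure lborel (cball c (2 * r)))"
      by (rule measure_UNION_le[OF F(1)]) auto
    also have "\<dots> \<le> (\<Sum>c\<in>F. 16 * r\<^sup>2 * ?V)"
      using r measure_cball_le[of "2 * r"] by (intro sum_mono) (simp add: power_mult_distrib)
    also have "\<dots> = real (card F) * (16 * r\<^sup>2 * ?V)" by simp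
    also have "\<dots> \<le> C / r * (16 * r\<^sup>2 * ?V)" by (intro mult_right_mono F) auto
    also have "\<dots> = (16 * C * ?V) * r" using r by (simp add: power2_eq_square)
    also have "\<dots> \<le> (max 1 (16 * C * ?V)) * r" using r by (intro mult_right_mono) auto
    finally show ?thesis .
  qed
  show ?thesis by (rule exI[of _ "max 1 (16 * C * ?V)"]) (use main in auto)
qed

lemma frontier_null:
  assumes "bounded_domain D" "C1_domain D"
  shows "frontier D \<in> null_sets lborel"
proof -
  obtain C where C: "C > 0" "\<And>r. 0 < r \<Longrightarrow> r \<le> 1 \<Longrightarrow> measure lborel {x. infdist x (frontier D) \<le> r} \<le> C * r"
    using frontier_neighbourhood_measure[OF assms] by blast
  have cp: "compact {x. infdist x (frontier D) \<le> r}" if "r > 0" for r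
    by (rule compact_infdist_le[OF bounded_domain_frontier(2,1)[OF assms(1)] that])
  have "measure lborel (frontier D) \<le> 0 + e" if "e > 0" for e
  proof -
    define r where "r = min 1 (e / C)"
    have r: "0 < r" "r \<le> 1" "C * r \<le> e" using that C by (auto simp: r_def min_def field_simps)
    have "measure lborel (frontier D) \<le> measure lborel {x. infdist x (frontier D) \<le> r}"
      by (rule measure_mono_fmeasurable) (use cp r in \<open>auto intro!: fmeasurable_compact\<close>)
    with C(2)[OF r(1,2)] r show ?thesis by simp
  qed
  then have "measure lborel (frontier D) = 0" using field_le_epsilon[of "measure lborel (frontier D)" 0] by (simp add: antisym)
  moreover have "frontier D \<in> fmeasurable lborel"
    using bounded_domain_frontier[OF assms(1)] by (intro fmeasurable_compact)
  ultimately show ?thesis by (auto simp: null_sets_def measure_def enn2real_eq_0_iff fmeasurable_def)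
qed

section \<open>Hausdorff distance and distance functions\<close>

lemma hausdorff_dist_bounds:
  assumes "bounded A" "A \<noteq> {}" "bounded B" "B \<noteq> {}"
  shows "x \<in> A \<Longrightarrow> infdist x B \<le> hausdorff_dist A B" "y \<in> B \<Longrightarrow> infdist y A \<le> hausdorff_dist A B"
proof -
  have bdd: "bdd_above ((\<lambda>x. infdist x B) ` A)" if ab: "bounded A" "B \<noteq> {}" for A B :: "'a set"
  proof -
    obtain b where "b \<in> B" using ab by auto
    obtain R where "\<forall>x\<in>A. dist b x \<le> R" using ab(1) unfolding bounded_any_center[of _ b] by blast
    then show ?thesis
      using \<open>b \<in> B\<close> by (intro bdd_aboveI[of _ R]) (auto intro!: infdist_le2 simp: dist_commute)
  qed
  show "x \<in> A \<Longrightarrow> infdist x B \<le> hausdorff_dist A B"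
    unfolding hausdorff_dist_def using cSUP_upper[OF _ bdd[OF assms(1,4)], of x] by simp
  show "y \<in> B \<Longrightarrow> infdist y A \<le> hausdorff_dist A B"
    unfolding hausdorff_dist_def using cSUP_upper[OF _ bdd[OF assms(3,2)], of y] by simp
qed

text \<open>Each inequality follows by passing through a nearest point. In this form Hausdorff
  continuity of the boundaries says that their distance functions converge uniformly, which is how
  it is used later.\<close>

lemma infdist_hausdorff_dist:
  fixes A B :: "'a::heine_borel set"
  assumes "compact A" "A \<noteq> {}" "compact B" "B \<noteq> {}"
  shows "\<bar>infdist x A - infdist x B\<bar> \<le> hausdorff_dist A B"
proof -
  have *: "infdist x A \<le> infdist x B + h" if ab: "compact B" "B \<noteq> {}" "\<And>y. y \<in> B \<Longrightarrow> infdist y A \<le> h" for A B :: "'a set" and h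
  proof -
    obtain q where "q \<in> B" "infdist x B = dist x q"
      using infdist_attains_inf[OF compact_imp_closed[OF ab(1)] ab(2), of x] by blast
    then show ?thesis using infdist_triangle[of x A q] ab(3)[of q] by simp
  qed
  note h = hausdorff_dist_bounds[of A B]
  have "infdist x A \<le> infdist x B + hausdorff_dist A B" "infdist x B \<le> infdist x A + hausdorff_dist A B"
    using assms by (auto intro!: * h compact_imp_bounded)
  then show ?thesis by linarith
qed

section \<open>Stability of evolving domains\<close>

definition dint :: "(real^2) set \<Rightarrow> (real^2 \<Rightarrow> real) \<Rightarrow> real" where
  "dint D g = (LINT x|lborel. indicator D x * g x)"

lemma integrable_dint:
  fixes g :: "real^2 \<Rightarrow> real"
  assumes D: "bounded D" "D \<in> sets borel" and g: "continuous_on UNIV g"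
  shows "integrable lborel (\<lambda>x. indicator D x * g x)"
proof -
  obtain R where "\<forall>x\<in>D. norm x \<le> R" using D(1) unfolding bounded_iff by blast
  then have R: "D \<subseteq> cball 0 R" by auto
  have "integrable lborel (\<lambda>x. indicator (cball 0 R) x *\<^sub>R g x)"
    by (intro borel_integrable_compact continuous_on_subset[OF g]) auto
  then show ?thesis
  proof (rule Bochner_Integration.integrable_bound)
    show "(\<lambda>x. indicator D x * g x) \<in> borel_measurable lborel"
      using D(2) borel_measurable_continuous_onI[OF g] by (auto intro!: borel_measurable_times)
    show "AE x in lborel. norm (indicator D x * g x) \<le> norm (indicator (cball 0 R) x *\<^sub>R g x)"
      using R by (intro AE_I2) (auto simp: indicator_def)
  qed
qed

lemma dint_diff:
  assumes "bounded D" "D \<in> sets borel" "continuous_on UNIV f" "continuous_on UNIV g"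
  shows "dint D (\<lambda>x. f x - g x) = dint D f - dint D g"
  unfolding dint_def using integrable_dint[OF assms(1,2)] assms(3,4)
  by (simp add: right_diff_distrib)

lemma dint_add:
  assumes "bounded D" "D \<in> sets borel" "continuous_on UNIV f" "continuous_on UNIV g"
  shows "dint D (\<lambda>x. f x + g x) = dint D f + dint D g"
  unfolding dint_def using integrable_dint[OF assms(1,2)] assms(3,4)
  by (simp add: distrib_left)

lemma dint_cmult: "dint D (\<lambda>x. c * f x) = c * dint D f"
  unfolding dint_def by (simp add: mult.left_commute[of _ c])

lemma dint_sum:
  assumes "bounded D" "D \<in> sets borel" "\<And>i. i \<in> I \<Longrightarrow> continuous_on UNIV (f i)"
  shows "dint D (\<lambda>x. \<Sum>i\<in>I. f i x) = (\<Sum>i\<in>I. dint D (f i))"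
  unfolding dint_def using integrable_dint[OF assms(1,2)] assms(3)
  by (simp add: sum_distrib_left)

lemma abs_lborel_integral_le:
  fixes f :: "'a::euclidean_space \<Rightarrow> real"
  assumes "integrable lborel f" "A \<in> fmeasurable lborel" "\<And>x. x \<in> A \<Longrightarrow> \<bar>f x\<bar> \<le> B" "\<And>x. x \<notin> A \<Longrightarrow> f x = 0"
  shows "\<bar>LINT x|lborel. f x\<bar> \<le> B * measure lborel A"
proof -
  have A: "A \<in> sets borel" "emeasure lborel A < \<infinity>" using assms(2) by (auto simp: fmeasurable_def)
  have "\<bar>LINT x|lborel. f x\<bar> \<le> (LINT x|lborel. \<bar>f x\<bar>)" by (rule integral_abs_bound)
  also have "\<dots> \<le> (LINT x|lborel. B * indicator A x)"
  proof (rule integral_mono)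
    show "integrable lborel (\<lambda>x. B * indicator A x)" using A by simp
    show "\<bar>f x\<bar> \<le> B * indicator A x" for x using assms(3,4)[of x] by (auto simp: indicator_def)
  qed (use assms(1) in simp)
  also have "\<dots> = B * measure lborel A" using A by simp
  finally show ?thesis .
qed

lemma abs_dint_le:
  assumes "bounded D" "D \<in> sets borel" "continuous_on UNIV g" "A \<in> fmeasurable lborel" "B \<ge> 0"
    "\<And>x. x \<in> D \<Longrightarrow> x \<in> A \<Longrightarrow> \<bar>g x\<bar> \<le> B" "\<And>x. x \<in> D \<Longrightarrow> x \<notin> A \<Longrightarrow> g x = 0"
  shows "\<bar>dint D g\<bar> \<le> B * measure lborel A"
  unfolding dint_def
  by (rule abs_lborel_integral_le[OF integrable_dint[OF assms(1-3)] assms(4)])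
    (use assms in \<open>auto simp: indicator_def\<close>)

lemma compact_separated_frontier:
  fixes K S :: "'a::euclidean_space set"
  assumes "compact K" "closed S" "S \<noteq> {}" "K \<inter> S = {}"
  shows "\<exists>\<epsilon>>0. \<forall>x\<in>K. infdist x S \<ge> \<epsilon>"
proof (cases "K = {}")
  case False
  have "continuous_on K (\<lambda>x. infdist x S)" by (intro continuous_intros)
  from continuous_attains_inf[OF assms(1) False this] obtain x where x: "x \<in> K" "\<forall>y\<in>K. infdist x S \<le> infdist y S"
    by auto
  have "infdist x S > 0" using infdist_pos_not_in_closed[OF assms(2,3)] x assms(4) by auto
  then show ?thesis using x by auto
qed (auto intro: exI[of _ 1])

lemma LIMSEQ_if_dist_less_inverse:
  fixes X :: "nat \<Rightarrow> real"
  assumes "\<And>n. \<bar>X n - t\<bar> < 1 / (real n + 1)"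
  shows "X \<longlonglongrightarrow> t"
proof -
  have "(\<lambda>n. 1 / (real n + 1)) \<longlonglongrightarrow> 0" using LIMSEQ_inverse_real_of_nat by (simp add: inverse_eq_divide add.commute)
  then have "(\<lambda>n. X n - t) \<longlonglongrightarrow> 0"
    by (rule tendsto_0_le[where K=1]) (use assms in \<open>auto intro!: always_eventually less_imp_le\<close>)
  then show ?thesis by (simp add: LIM_zero_iff)
qed

lemma continuous_on_space_slice:
  assumes "continuous_on (UNIV \<times> I) (\<lambda>(x, t). f x t)" "t \<in> I"
  shows "continuous_on UNIV (\<lambda>x. f x t)"
proof -
  have "continuous_on UNIV ((\<lambda>(x, t). f x t) \<circ> (\<lambda>x. (x, t)))"
    by (intro continuous_on_compose continuous_on_subset[OF assms(1)] continuous_intros) (use assms(2) in auto)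
  then show ?thesis by (simp add: comp_def)
qed

locale evolving_C1_domain =
  fixes T :: real and v :: "real^2 \<Rightarrow> real \<Rightarrow> real^2" and \<Omega> :: "real \<Rightarrow> (real^2) set"
  assumes T_pos: "T > 0"
    and continuous_velocity: "continuous_on (UNIV \<times> {0..T}) (\<lambda>(x, t). v x t)"
    and evolving: "evolving_domain T \<Omega>"
    and C1_at: "\<And>t. t \<in> {0..T} \<Longrightarrow> C1_domain (\<Omega> t)"
begin

abbreviation J :: "real \<Rightarrow> (real^2) set" where
  "J t \<equiv> frontier (\<Omega> t)"

lemma bounded_domain_at: "t \<in> {0..T} \<Longrightarrow> bounded_domain (\<Omega> t)"
  using evolving by (simp add: evolving_domain_def)

lemma domain_facts:
  assumes "t \<in> {0..T}"
  shows "bounded (\<Omega> t)" "open (\<Omega> t)" "connected (\<Omega> t)" "\<Omega> t \<in> sets borel" "\<Omega> t \<noteq> {}"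
    "compact (J t)" "J t \<noteq> {}" "\<Omega> t \<inter> J t = {}"
    "J t \<in> null_sets lborel" "connected (- closure (\<Omega> t))"
  using bounded_domain_at[OF assms] bounded_domain_frontier[OF bounded_domain_at[OF assms]] frontier_null[OF bounded_domain_at[OF assms] C1_at[OF assms]]
    C1_bounded_domain_sides(1)[OF bounded_domain_at[OF assms] C1_at[OF assms]]
  by (auto simp: bounded_domain_def)

lemma infdist_frontier_near:
  assumes t: "t \<in> {0..T}" and e: "\<epsilon> > 0"
  shows "\<exists>\<tau>>0. \<forall>s\<in>{0..T}. \<bar>s - t\<bar> < \<tau> \<longrightarrow> (\<forall>x. \<bar>infdist x (J s) - infdist x (J t)\<bar> < \<epsilon>)"
proof -
  have "((\<lambda>s. hausdorff_dist (J s) (J t)) \<longlongrightarrow> 0) (at t within {0..T})"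
    using evolving t by (simp add: evolving_domain_def)
  then have "eventually (\<lambda>s. dist (hausdorff_dist (J s) (J t)) 0 < \<epsilon>) (at t within {0..T})"
    using e by (rule tendstoD)
  then obtain \<tau> where \<tau>: "\<tau> > 0" "\<forall>s\<in>{0..T}. s \<noteq> t \<and> dist s t < \<tau> \<longrightarrow> dist (hausdorff_dist (J s) (J t)) 0 < \<epsilon>"
    unfolding eventually_at by blast
  show ?thesis
  proof (intro exI[of _ \<tau>] conjI ballI impI allI)
    fix s x assume s: "s \<in> {0..T}" "\<bar>s - t\<bar> < \<tau>"
    show "\<bar>infdist x (J s) - infdist x (J t)\<bar> < \<epsilon>"
    proof (cases "s = t")
      case False
      have "hausdorff_dist (J s) (J t) < \<epsilon>"
        using \<tau>(2) s False by (force simp: dist_real_def)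
      then show ?thesis
        using infdist_hausdorff_dist[OF domain_facts(6,7)[OF s(1)] domain_facts(6,7)[OF t], of x] by linarith
    qed (use e in simp)
  qed (rule \<tau>(1))
qed

text \<open>On \<open>K\<close> the distance to \<open>J t\<close> has a positive lower bound, and
  for \<open>s\<close> near \<open>t\<close> the distance to \<open>J s\<close> differs by less than
  that.\<close>

lemma frontier_avoids_compact:
  assumes t: "t \<in> {0..T}" and K: "compact K" "K \<inter> J t = {}"
  shows "\<exists>\<tau>>0. \<forall>s\<in>{0..T}. \<bar>s - t\<bar> < \<tau> \<longrightarrow> K \<inter> J s = {}"
proof -
  obtain \<epsilon> where e: "\<epsilon> > 0" "\<forall>x\<in>K. infdist x (J t) \<ge> \<epsilon>"
    using compact_separated_frontier[OF K(1) frontier_closed domain_facts(7)[OF t] K(2)] by blast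
  obtain \<tau> where \<tau>: "\<tau> > 0" "\<forall>s\<in>{0..T}. \<bar>s - t\<bar> < \<tau> \<longrightarrow> (\<forall>x. \<bar>infdist x (J s) - infdist x (J t)\<bar> < \<epsilon>)"
    using infdist_frontier_near[OF t e(1)] by blast
  have "x \<notin> J s" if "s \<in> {0..T}" "\<bar>s - t\<bar> < \<tau>" "x \<in> K" for s x
    using \<tau>(2)[rule_format, OF that(1,2), of x] e(2)[rule_format, OF that(3)] by auto
  then show ?thesis using \<tau>(1) by blast
qed

lemma connected_same_side:
  assumes "connected S" "S \<inter> J t = {}" "x \<in> S" "y \<in> S"
  shows "x \<in> \<Omega> t \<longleftrightarrow> y \<in> \<Omega> t"
  using connected_Int_frontier[OF assms(1), of "\<Omega> t"] assms(2-4) by blast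

text \<open>The boundaries lie in one ball because \<open>[0, T]\<close> is compact. The domains
  follow: the complement of a disc in the plane is connected and misses \<open>J s\<close>, so it
  lies inside \<open>\<Omega> s\<close>, which is bounded, or is disjoint from it.\<close>

lemma uniformly_bounded: "\<exists>R>0. \<forall>t\<in>{0..T}. closure (\<Omega> t) \<subseteq> ball 0 R"
proof -
  have "\<exists>\<tau>>0. \<exists>R>0. \<forall>s\<in>{0..T}. \<bar>s - t\<bar> < \<tau> \<longrightarrow> J s \<subseteq> ball 0 R" if t: "t \<in> {0..T}" for t
  proof -
    obtain R0 where R0: "R0 > 0" "\<forall>x\<in>J t. norm x \<le> R0"
      using compact_imp_bounded[OF domain_facts(6)[OF t]] unfolding bounded_pos by blast
    obtain \<tau> where \<tau>: "\<tau> > 0" "\<forall>s\<in>{0..T}. \<bar>s - t\<bar> < \<tau> \<longrightarrow> (\<forall>x. \<bar>infdist x (J s) - infdist x (J t)\<bar> < 1)"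
      using infdist_frontier_near[OF t zero_less_one] by blast
    have "norm x < R0 + 1" if s: "s \<in> {0..T}" "\<bar>s - t\<bar> < \<tau>" "x \<in> J s" for s x
    proof -
      have "infdist x (J t) < 1" using \<tau>(2)[rule_format, OF s(1,2), of x] s(3) by simp
      moreover obtain q where "q \<in> J t" "infdist x (J t) = dist x q"
        using infdist_attains_inf[OF frontier_closed domain_facts(7)[OF t], of x] by blast
      ultimately show ?thesis using R0(2) norm_triangle_ineq2[of x q] by (force simp: dist_norm)
    qed
    then show ?thesis using \<tau>(1) R0(1) by (intro exI[of _ \<tau>] conjI exI[of _ "R0 + 1"]) auto
  qed
  then obtain \<tau> R where \<tau>: "\<And>t. t \<in> {0..T} \<Longrightarrow> \<tau> t > 0" and R: "\<And>t. t \<in> {0..T} \<Longrightarrow> R t > 0"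
    and fr: "\<And>t s. t \<in> {0..T} \<Longrightarrow> s \<in> {0..T} \<Longrightarrow> \<bar>s - t\<bar> < \<tau> t \<Longrightarrow> J s \<subseteq> ball 0 (R t)"
    by metis
  obtain K where K: "K \<subseteq> {0..T}" "finite K" "{0..T} \<subseteq> (\<Union>t\<in>K. ball t (\<tau> t))"
  proof (rule compactE_image[of "{0..T}" "{0..T}" "\<lambda>t. ball t (\<tau> t)"])
    show "{0..T} \<subseteq> (\<Union>t\<in>{0..T}. ball t (\<tau> t))" using \<tau> by auto
  qed auto
  define R' where "R' = (\<Sum>t\<in>K. R t) + 1"
  have RK: "0 \<le> R t" if "t \<in> K" for t using R K(1) that by (meson less_imp_le subsetD)
  then have "0 \<le> (\<Sum>t\<in>K. R t)" by (intro sum_nonneg)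
  then have "R' > 0" by (simp add: R'_def)
  have frR: "J s \<subseteq> cball 0 R'" if s: "s \<in> {0..T}" for s
  proof -
    obtain t where t: "t \<in> K" "\<bar>s - t\<bar> < \<tau> t" using K(3) s by (auto simp: dist_real_def abs_minus_commute)
    have "J s \<subseteq> ball 0 (R t)" using fr[of t s] t K(1) s by blast
    moreover have "R t \<le> (\<Sum>t\<in>K. R t)" by (rule member_le_sum[OF t(1) RK K(2)]) auto
    ultimately show ?thesis unfolding R'_def by (force simp: subset_eq)
  qed
  have "closure (\<Omega> s) \<subseteq> ball 0 (R' + 1)" if s: "s \<in> {0..T}" for s
  proof -
    have "connected (- cball (0::real^2) R')" by (rule connected_complement_bounded_convex) auto
    moreover have "- cball 0 R' \<inter> J s = {}" using frR[OF s] by blast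
    ultimately have "- cball 0 R' \<inter> \<Omega> s = {} \<or> - cball 0 R' \<subseteq> \<Omega> s"
      using connected_Int_frontier[of "- cball 0 R'" "\<Omega> s"] by blast
    moreover have "\<not> - cball 0 R' \<subseteq> \<Omega> s"
      using domain_facts(1)[OF s] bounded_subset cobounded_imp_unbounded[of "- cball (0::real^2) R'"] by auto
    ultimately have "\<Omega> s \<subseteq> cball 0 R'" by blast
    then have "closure (\<Omega> s) \<subseteq> cball 0 R'" by (rule closure_minimal) simp
    then show ?thesis by (force simp: subset_eq)
  qed
  then show ?thesis using \<open>R' > 0\<close> by (intro exI[of _ "R' + 1"]) auto
qed

lemma uniformly_bounded_cball: "\<exists>R>0. \<forall>t\<in>{0..T}. \<Omega> t \<subseteq> cball 0 R"
proof -
  obtain R where R: "R > 0" "\<forall>t\<in>{0..T}. closure (\<Omega> t) \<subseteq> ball 0 R" using uniformly_bounded by blast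
  have "\<Omega> t \<subseteq> cball 0 R" if "t \<in> {0..T}" for t
    using R(2)[rule_format, OF that] closure_subset[of "\<Omega> t"] ball_subset_cball[of 0 R] by blast
  then show ?thesis using R(1) by blast
qed

text \<open>Both sides of \<open>J t\<close> are open and connected, so \<open>x\<close> and
  \<open>y\<close> are joined by a path in their common side. This path is compact, hence also
  avoids \<open>J s\<close> for nearby \<open>s\<close>, and the two points stay together. On which
  side they end up is left open; this is the gap through which collapse could occur.\<close>

lemma pair_stable:
  assumes t: "t \<in> {0..T}" and xy: "x \<in> \<Omega> t \<and> y \<in> \<Omega> t \<or> x \<in> - closure (\<Omega> t) \<and> y \<in> - closure (\<Omega> t)"
  shows "\<exists>\<tau>>0. \<forall>s\<in>{0..T}. \<bar>s - t\<bar> < \<tau> \<longrightarrow> (x \<in> \<Omega> s \<longleftrightarrow> y \<in> \<Omega> s)"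
proof -
  obtain V where V: "open V" "connected V" "V \<inter> J t = {}" "x \<in> V" "y \<in> V"
  proof -
    have "- closure (\<Omega> t) \<inter> J t = {}" by (auto simp: frontier_def)
    with xy that[of "\<Omega> t"] that[of "- closure (\<Omega> t)"] domain_facts[OF t] show ?thesis by (auto simp: open_Compl)
  qed
  then obtain g where g: "path g" "path_image g \<subseteq> V" "pathstart g = x" "pathfinish g = y"
    using connected_open_path_connected[OF V(1,2)] unfolding path_connected_def by blast
  have "path_image g \<inter> J t = {}" using g V by blast
  from frontier_avoids_compact[OF t compact_path_image[OF g(1)] this]
  obtain \<tau> where \<tau>: "\<tau> > 0" "\<forall>s\<in>{0..T}. \<bar>s - t\<bar> < \<tau> \<longrightarrow> path_image g \<inter> J s = {}" by blast
  have "x \<in> path_image g" "y \<in> path_image g" using g by auto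
  then show ?thesis
    using \<tau> connected_same_side[OF connected_path_image[OF g(1)]] by blast
qed

text \<open>Compare \<open>x\<close> with a point \<open>y\<close> outside the common ball, which
  belongs to no domain at any time. Thus only the inside can be lost.\<close>

lemma outside_stable:
  assumes t: "t \<in> {0..T}" and x: "x \<notin> closure (\<Omega> t)"
  shows "\<exists>\<tau>>0. \<forall>s\<in>{0..T}. \<bar>s - t\<bar> < \<tau> \<longrightarrow> x \<notin> \<Omega> s"
proof -
  obtain R where R: "R > 0" "\<forall>t\<in>{0..T}. closure (\<Omega> t) \<subseteq> ball 0 R" using uniformly_bounded by blast
  obtain y :: "real^2" where y: "norm y = R" using vector_choose_size[of R] R by auto
  have no: "y \<notin> closure (\<Omega> s)" if "s \<in> {0..T}" for s using R(2) that y by (force simp: subset_eq)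
  then have "y \<notin> \<Omega> s" if "s \<in> {0..T}" for s using that closure_subset by blast
  moreover have "x \<in> - closure (\<Omega> t) \<and> y \<in> - closure (\<Omega> t)" using x no[OF t] by simp
  then obtain \<tau> where "\<tau> > 0" "\<forall>s\<in>{0..T}. \<bar>s - t\<bar> < \<tau> \<longrightarrow> (x \<in> \<Omega> s \<longleftrightarrow> y \<in> \<Omega> s)"
    using pair_stable[OF t] by blast
  ultimately show ?thesis by blast
qed

definition stable :: "real \<Rightarrow> bool" where
  "stable t \<longleftrightarrow> (\<forall>y\<in>\<Omega> t. \<exists>\<tau>>0. \<forall>s\<in>{0..T}. \<bar>s - t\<bar> < \<tau> \<longrightarrow> y \<in> \<Omega> s)"

text \<open>By \<open>pair_stable\<close> all points of \<open>\<Omega> t\<close> share the fate of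
  \<open>y\<close> for nearby times, so one point decides.\<close>

lemma stableI:
  assumes t: "t \<in> {0..T}" and y: "y \<in> \<Omega> t" and \<tau>: "\<tau> > 0" "\<And>s. s \<in> {0..T} \<Longrightarrow> \<bar>s - t\<bar> < \<tau> \<Longrightarrow> y \<in> \<Omega> s"
  shows "stable t"
  unfolding stable_def
proof
  fix x assume "x \<in> \<Omega> t"
  then obtain \<tau>' where "\<tau>' > 0" "\<forall>s\<in>{0..T}. \<bar>s - t\<bar> < \<tau>' \<longrightarrow> (x \<in> \<Omega> s \<longleftrightarrow> y \<in> \<Omega> s)"
    using pair_stable[OF t, of x y] y by blast
  then show "\<exists>\<tau>>0. \<forall>s\<in>{0..T}. \<bar>s - t\<bar> < \<tau> \<longrightarrow> x \<in> \<Omega> s"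
    using \<tau> by (intro exI[of _ "min \<tau> \<tau>'"]) auto
qed

text \<open>The ball is connected and misses nearby boundaries, so it stays on one side. Its centre
  keeps its side by stability if it is inside, and by \<open>outside_stable\<close> if it is
  outside.\<close>

lemma stable_ball:
  assumes t: "t \<in> {0..T}" and st: "stable t" and x: "cball x d \<inter> J t = {}" and d: "d \<ge> 0"
  shows "\<exists>\<tau>>0. \<forall>s\<in>{0..T}. \<bar>s - t\<bar> < \<tau> \<longrightarrow> (\<forall>y\<in>cball x d. y \<notin> J s \<and> (y \<in> \<Omega> s \<longleftrightarrow> x \<in> \<Omega> t))"
proof -
  obtain \<tau>1 where \<tau>1: "\<tau>1 > 0" "\<forall>s\<in>{0..T}. \<bar>s - t\<bar> < \<tau>1 \<longrightarrow> cball x d \<inter> J s = {}"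
    using frontier_avoids_compact[OF t compact_cball x] by blast
  have "x \<in> cball x d" using d by simp
  then have xJ: "x \<notin> J t" using x by blast
  obtain \<tau>2 where \<tau>2: "\<tau>2 > 0" "\<forall>s\<in>{0..T}. \<bar>s - t\<bar> < \<tau>2 \<longrightarrow> (x \<in> \<Omega> s \<longleftrightarrow> x \<in> \<Omega> t)"
  proof (cases "x \<in> \<Omega> t")
    case True
    with st that show ?thesis unfolding stable_def by meson
  next
    case False
    then have "x \<notin> closure (\<Omega> t)" using xJ closure_Un_frontier by blast
    then obtain \<tau> where "\<tau> > 0" "\<forall>s\<in>{0..T}. \<bar>s - t\<bar> < \<tau> \<longrightarrow> x \<notin> \<Omega> s" using outside_stable[OF t] by blast
    with False that show ?thesis by blast
  qed
  show ?thesis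
  proof (intro exI[of _ "min \<tau>1 \<tau>2"] conjI ballI impI)
    fix s y assume s: "s \<in> {0..T}" "\<bar>s - t\<bar> < min \<tau>1 \<tau>2" and y: "y \<in> cball x d"
    have e: "cball x d \<inter> J s = {}" using \<tau>1(2) s by auto
    then show "y \<notin> J s" using y by blast
    have "y \<in> \<Omega> s \<longleftrightarrow> x \<in> \<Omega> s"
      by (rule connected_same_side[OF convex_connected[OF convex_cball] e y]) (use d in simp)
    then show "y \<in> \<Omega> s \<longleftrightarrow> x \<in> \<Omega> t" using \<tau>2(2) s by auto
  qed (use \<tau>1 \<tau>2 in auto)
qed

text \<open>Whether the reference point \<open>y\<close> belongs to \<open>\<Omega> (X n)\<close> decides whether \<open>\<Omega> (X n)\<close> is close to
  \<open>\<Omega> t\<close> or to the empty set.\<close>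

lemma dint_tendsto:
  fixes f :: "real^2 \<Rightarrow> real \<Rightarrow> real"
  assumes t: "t \<in> {0..T}" and X: "\<And>n. X n \<in> {0..T}" "X \<longlonglongrightarrow> t" and y: "y \<in> \<Omega> t"
    and f: "continuous_on (UNIV \<times> {0..T}) (\<lambda>(x, t). f x t)"
  shows "(\<lambda>n. dint (\<Omega> (X n)) (\<lambda>x. f x (X n)) - of_bool (y \<in> \<Omega> (X n)) * dint (\<Omega> t) (\<lambda>x. f x t)) \<longlonglongrightarrow> 0"
proof -
  obtain R where R: "R > 0" "\<And>s. s \<in> {0..T} \<Longrightarrow> \<Omega> s \<subseteq> cball 0 R" using uniformly_bounded_cball by blast
  note fx = continuous_on_space_slice[OF f]
  have ft: "continuous_on {0..T} (f x)" for x
  proof -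
    have "continuous_on {0..T} ((\<lambda>(x, t). f x t) \<circ> (\<lambda>s. (x, s)))"
      by (intro continuous_on_compose continuous_on_subset[OF f] continuous_intros) auto
    then show ?thesis by (simp add: comp_def)
  qed
  have "bounded ((\<lambda>(x, t). f x t) ` (cball 0 R \<times> {0..T}))"
    by (intro compact_imp_bounded compact_continuous_image continuous_on_subset[OF f] compact_Times) auto
  then obtain M where M: "M > 0" "\<forall>y\<in>(\<lambda>(x, t). f x t) ` (cball 0 R \<times> {0..T}). norm y \<le> M"
    unfolding bounded_pos by blast
  have fM: "\<bar>f x s\<bar> \<le> M" if "x \<in> \<Omega> s'" "s' \<in> {0..T}" "s \<in> {0..T}" for x s s'
    using M(2) R(2)[OF that(2)] that(1,3) by force
  let ?s = "\<lambda>n x. indicator (\<Omega> (X n)) x * f x (X n) - of_bool (y \<in> \<Omega> (X n)) * (indicator (\<Omega> t) x * f x t)"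
  have "(\<lambda>n. LINT x|lborel. ?s n x) \<longlonglongrightarrow> (LINT x|(lborel::(real^2) measure). (0::real))"
  \<comment> \<open>The common ball gives the dominating function. Off the null set
    \<open>J t\<close> the integrand tends to 0: a point of \<open>\<Omega> t\<close> eventually
    shares the fate of \<open>y\<close>, and a point outside eventually lies in no
    \<open>\<Omega> (X n)\<close>.\<close>
  proof (rule integral_dominated_convergence[where w = "\<lambda>x. indicator (cball (0::real^2) R) x *\<^sub>R (2 * M)"])
    show "(\<lambda>x. 0) \<in> borel_measurable lborel" by simp
    show "?s n \<in> borel_measurable lborel" for n
      using integrable_dint[OF domain_facts(1,4)[OF X(1)[of n]] fx[OF X(1)[of n]]] integrable_dint[OF domain_facts(1,4)[OF t] fx[OF t]]
      by (intro borel_measurable_integrable Bochner_Integration.integrable_diff integrable_mult_right)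
    show "integrable lborel (\<lambda>x. indicator (cball (0::real^2) R) x *\<^sub>R (2 * M))"
      by (intro borel_integrable_compact continuous_intros) auto
    show "AE x in lborel. norm (?s n x) \<le> indicator (cball 0 R) x *\<^sub>R (2 * M)" for n
    proof (rule AE_I2)
      fix x
      have a: "\<bar>indicator (\<Omega> s) x * f x s\<bar> \<le> indicator (cball 0 R) x * M" if "s \<in> {0..T}" for s
        using fM[of x s s] that R(2)[OF that] M(1) by (auto simp: indicator_def subset_eq less_imp_le)
      have "\<bar>of_bool (y \<in> \<Omega> (X n)) * (indicator (\<Omega> t) x * f x t)\<bar> \<le> \<bar>indicator (\<Omega> t) x * f x t\<bar>"
        by (auto simp: abs_mult)
      then show "norm (?s n x) \<le> indicator (cball 0 R) x *\<^sub>R (2 * M)"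
        using a[OF t] a[OF X(1)[of n]] by simp
    qed
    have "AE x in lborel. x \<notin> J t" using domain_facts(9)[OF t] by (rule AE_not_in)
    then show "AE x in lborel. (\<lambda>n. ?s n x) \<longlonglongrightarrow> 0"
    proof (rule AE_mp, intro AE_I2 impI)
      fix x assume x: "x \<notin> J t"
      show "(\<lambda>n. ?s n x) \<longlonglongrightarrow> 0"
      proof (cases "x \<in> \<Omega> t")
        case True
        then obtain \<tau> where \<tau>: "\<tau> > 0" "\<forall>s\<in>{0..T}. \<bar>s - t\<bar> < \<tau> \<longrightarrow> (x \<in> \<Omega> s \<longleftrightarrow> y \<in> \<Omega> s)"
          using pair_stable[OF t, of x y] y by blast
        have "eventually (\<lambda>n. dist (X n) t < \<tau>) sequentially" using X(2) \<tau>(1) by (rule tendstoD)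
        then have ev: "eventually (\<lambda>n. ?s n x = of_bool (y \<in> \<Omega> (X n)) * (f x (X n) - f x t)) sequentially"
        proof eventually_elim
          case (elim n)
          then have "x \<in> \<Omega> (X n) \<longleftrightarrow> y \<in> \<Omega> (X n)" using \<tau>(2) X(1) by (auto simp: dist_real_def)
          then show ?case using True by (auto simp: indicator_def)
        qed
        have "(\<lambda>n. f x (X n)) \<longlonglongrightarrow> f x t"
          using continuous_on_tendsto_compose[OF ft X(2) t] X(1) by simp
        then have "(\<lambda>n. f x (X n) - f x t) \<longlonglongrightarrow> 0" by (simp add: LIM_zero)
        then have "(\<lambda>n. of_bool (y \<in> \<Omega> (X n)) * (f x (X n) - f x t)) \<longlonglongrightarrow> 0"
          by (rule tendsto_0_le[where K=1]) (auto simp: abs_mult)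
        then show ?thesis using tendsto_cong[OF ev] by blast
      next
        case False
        then have "x \<notin> closure (\<Omega> t)" using x closure_Un_frontier by blast
        then obtain \<tau> where \<tau>: "\<tau> > 0" "\<forall>s\<in>{0..T}. \<bar>s - t\<bar> < \<tau> \<longrightarrow> x \<notin> \<Omega> s"
          using outside_stable[OF t] by blast
        have "eventually (\<lambda>n. dist (X n) t < \<tau>) sequentially" using X(2) \<tau>(1) by (rule tendstoD)
        then have "eventually (\<lambda>n. ?s n x = 0) sequentially"
          by eventually_elim (use \<tau>(2) X(1) False in \<open>auto simp: dist_real_def\<close>)
        then show ?thesis by (rule tendsto_eventually)
      qed
    qed
  qed
  moreover have "(LINT x|lborel. ?s n x) = dint (\<Omega> (X n)) (\<lambda>x. f x (X n)) - of_bool (y \<in> \<Omega> (X n)) * dint (\<Omega> t) (\<lambda>x. f x t)" for n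
    unfolding dint_def
    by (subst Bochner_Integration.integral_diff)
      (auto intro!: integrable_dint domain_facts X t fx integrable_mult_right)
  ultimately show ?thesis by simp
qed

lemma stable_dint_tendsto:
  fixes f :: "real^2 \<Rightarrow> real \<Rightarrow> real"
  assumes t: "t \<in> {0..T}" and st: "stable t" and f: "continuous_on (UNIV \<times> {0..T}) (\<lambda>(x, t). f x t)"
  shows "((\<lambda>s. dint (\<Omega> s) (\<lambda>x. f x s)) \<longlongrightarrow> dint (\<Omega> t) (\<lambda>x. f x t)) (at t within {0..T})"
  unfolding tendsto_at_iff_sequentially
proof (intro allI impI)
  fix X assume X: "\<forall>i. X i \<in> {0..T} - {t}" "X \<longlonglongrightarrow> t"
  obtain y where y: "y \<in> \<Omega> t" using domain_facts(5)[OF t] by blast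
  obtain \<tau> where \<tau>: "\<tau> > 0" "\<forall>s\<in>{0..T}. \<bar>s - t\<bar> < \<tau> \<longrightarrow> y \<in> \<Omega> s"
    using st y unfolding stable_def by blast
  have X0: "X n \<in> {0..T}" for n using X(1) by blast
  have "eventually (\<lambda>n. dist (X n) t < \<tau>) sequentially" using X(2) \<tau>(1) by (rule tendstoD)
  then have ev: "eventually (\<lambda>n. dint (\<Omega> (X n)) (\<lambda>x. f x (X n)) - of_bool (y \<in> \<Omega> (X n)) * dint (\<Omega> t) (\<lambda>x. f x t) = dint (\<Omega> (X n)) (\<lambda>x. f x (X n)) - dint (\<Omega> t) (\<lambda>x. f x t)) sequentially"
    by eventually_elim (use \<tau>(2) X0 in \<open>auto simp: dist_real_def\<close>)
  have "(\<lambda>n. dint (\<Omega> (X n)) (\<lambda>x. f x (X n)) - dint (\<Omega> t) (\<lambda>x. f x t)) \<longlonglongrightarrow> 0"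
    using dint_tendsto[OF t X0 X(2) y f] tendsto_cong[OF ev] by blast
  then show "((\<lambda>s. dint (\<Omega> s) (\<lambda>x. f x s)) \<circ> X) \<longlonglongrightarrow> dint (\<Omega> t) (\<lambda>x. f x t)"
    by (simp add: LIM_zero_iff comp_def)
qed

section \<open>Area as a function of time\<close>

definition area :: "real \<Rightarrow> real" where "area t = dint (\<Omega> t) (\<lambda>x. 1)"

lemma area_pos: "t \<in> {0..T} \<Longrightarrow> area t > 0"
proof -
  assume t: "t \<in> {0..T}"
  have fm: "\<Omega> t \<in> fmeasurable lborel"
    using domain_facts(1,4)[OF t] by (auto intro!: fmeasurableI emeasure_bounded_finite)
  obtain x r where "r > 0" "ball x r \<subseteq> \<Omega> t" using domain_facts(2,5)[OF t] openE by blast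
  then have "0 < measure lborel (ball x r)" "measure lborel (ball x r) \<le> measure lborel (\<Omega> t)"
    by (auto intro!: content_ball_pos measure_mono_fmeasurable fm)
  moreover have "area t = measure lborel (\<Omega> t)" using fm by (simp add: area_def dint_def fmeasurable_def)
  ultimately show ?thesis by linarith
qed

lemma area_tendsto:
  assumes "t \<in> {0..T}" "\<And>n. X n \<in> {0..T}" "X \<longlonglongrightarrow> t" "y \<in> \<Omega> t"
  shows "(\<lambda>n. area (X n) - of_bool (y \<in> \<Omega> (X n)) * area t) \<longlonglongrightarrow> 0"
  unfolding area_def using dint_tendsto[OF assms, of "\<lambda>x s. 1"] by (simp add: case_prod_beta)

text \<open>Upper semicontinuity of the area: up to a vanishing error the area along
  \<open>X\<close> is either \<open>area t\<close> or 0, and both are at most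
  \<open>area t\<close>.\<close>

lemma area_limit:
  assumes t: "t \<in> {0..T}" and X: "\<And>n. X n \<in> {0..T}" "X \<longlonglongrightarrow> t" and c: "\<And>n. area (X n) \<ge> c"
  shows "area t \<ge> c"
proof (rule field_le_epsilon)
  fix e :: real assume e: "e > 0"
  obtain y where y: "y \<in> \<Omega> t" using domain_facts(5)[OF t] by blast
  have "eventually (\<lambda>n. dist (area (X n) - of_bool (y \<in> \<Omega> (X n)) * area t) 0 < e) sequentially"
    by (rule tendstoD[OF area_tendsto[OF t X y] e])
  then obtain n where "\<bar>area (X n) - of_bool (y \<in> \<Omega> (X n)) * area t\<bar> < e"
    unfolding eventually_sequentially by auto
  then show "c \<le> area t + e" using c[of n] area_pos[OF t] e by (cases "y \<in> \<Omega> (X n)") auto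
qed

text \<open>Instability would give times tending to \<open>t\<close> at which a point
  \<open>y\<close> of \<open>\<Omega> t\<close> is missing, and along them the area tends to
  0.\<close>

lemma stable_if_area_bounded_below:
  assumes t: "t \<in> {0..T}" and c: "c > 0" and \<tau>: "\<tau> > 0" "\<And>s. s \<in> {0..T} \<Longrightarrow> \<bar>s - t\<bar> < \<tau> \<Longrightarrow> area s \<ge> c"
  shows "stable t"
proof (rule ccontr)
  assume ns: "\<not> stable t"
  obtain y where y: "y \<in> \<Omega> t" using domain_facts(5)[OF t] by blast
  have "\<exists>s\<in>{0..T}. \<bar>s - t\<bar> < min \<tau> (1 / (real n + 1)) \<and> y \<notin> \<Omega> s" for n
    using stableI[OF t y, of "min \<tau> (1 / (real n + 1))"] ns \<tau>(1) by force
  then obtain X where X: "\<And>n. X n \<in> {0..T}" "\<And>n. \<bar>X n - t\<bar> < min \<tau> (1 / (real n + 1))" "\<And>n. y \<notin> \<Omega> (X n)"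
    by metis
  have "X \<longlonglongrightarrow> t"
    by (rule LIMSEQ_if_dist_less_inverse) (use X(2) in simp)
  from area_tendsto[OF t X(1) this y] have "(\<lambda>n. area (X n)) \<longlonglongrightarrow> 0" using X(3) by simp
  then have "c \<le> 0" by (rule tendsto_lowerbound) (use X \<tau> in auto)
  with c show False by simp
qed

end

section \<open>From weak solutions to flows\<close>

lemma integral_set_FTC:
  fixes f F :: "real \<Rightarrow> real"
  assumes "a \<le> b" "\<And>x. x \<in> {a..b} \<Longrightarrow> (F has_real_derivative f x) (at x within {a..b})" "continuous_on {a..b} f"
  shows "(LINT x:{a..b}|lborel. f x) = F b - F a"
  unfolding set_lebesgue_integral_def
  by (rule integral_FTC_atLeastAtMost)
    (use assms in \<open>auto simp: has_real_derivative_iff_has_vector_derivative\<close>)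

text \<open>For positive \<open>r\<close> the value is 1 up to time \<open>b - r\<close> and 0 from
  time \<open>b\<close> on, so the negated derivative is a probability density on
  \<open>[b - r, b]\<close>: testing with it averages over this interval.\<close>

definition cutoff :: "real \<Rightarrow> real \<Rightarrow> real \<Rightarrow> real" where
  "cutoff b r s = smooth_step ((b - s) / r)"

lemma smooth_cutoff: "smooth (cutoff b r)"
proof -
  have "bounded_linear (\<lambda>s::real. s * (- 1 / r))" by (rule bounded_linear_mult_left)
  from smooth_compose_affine[OF this smooth_smooth_step, of "b / r"] show ?thesis
    by (simp add: cutoff_def[abs_def] diff_divide_distrib add.commute)
qed

lemma cutoff_1: "r > 0 \<Longrightarrow> s \<le> b - r \<Longrightarrow> cutoff b r s = 1"
  and cutoff_0: "r > 0 \<Longrightarrow> s \<ge> b \<Longrightarrow> cutoff b r s = 0"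
  unfolding cutoff_def by (auto intro!: smooth_step_1 smooth_step_0 simp: field_simps)

lemma smooth_real_deriv:
  fixes u :: "real \<Rightarrow> real"
  assumes "smooth u" shows "(u has_real_derivative gradient u x) (at x)"
proof -
  have "(\<lambda>w. gradient u x \<bullet> w) = (*) (gradient u x)" by auto
  with smooth_has_derivative_gradient[OF assms, of x] show ?thesis
    by (simp only: has_field_derivative_def)
qed

lemma cutoff_deriv_outside:
  assumes r: "r > 0" and s: "s < b - r \<or> s > b"
  shows "gradient (cutoff b r) s = 0"
proof -
  have "((\<lambda>_. cutoff b r s) has_real_derivative 0) (at s)" by simp
  then have "(cutoff b r has_real_derivative 0) (at s)"
  proof (rule has_field_derivative_transform_within_open)
    show "open (if s < b - r then {..<b-r} else {b<..})" by auto
    show "s \<in> (if s < b - r then {..<b-r} else {b<..})" using s by auto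
    show "cutoff b r s = cutoff b r x" if "x \<in> (if s < b - r then {..<b-r} else {b<..})" for x
      using that s r by (auto simp: cutoff_1 cutoff_0 split: if_splits)
  qed
  then show ?thesis using smooth_real_deriv[OF smooth_cutoff] DERIV_unique by blast
qed

lemma cutoff_deriv_nonpos:
  assumes r: "r > 0"
  shows "gradient (cutoff b r) s \<le> 0"
proof (rule ccontr)
  assume "\<not> gradient (cutoff b r) s \<le> 0"
  then have "gradient (cutoff b r) s > 0" by simp
  from DERIV_pos_inc_right[OF smooth_real_deriv[OF smooth_cutoff] this]
  obtain d where d: "d > 0" "\<forall>h>0. h < d \<longrightarrow> cutoff b r s < cutoff b r (s + h)" by blast
  have "cutoff b r (s + d / 2) \<le> cutoff b r s"
    unfolding cutoff_def by (rule smooth_step_mono) (use r d in \<open>auto simp: divide_right_mono\<close>)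
  with d(2)[rule_format, of "d / 2"] d(1) show False by auto
qed

text \<open>A nonintegrable integrand has integral 0. This case must be covered since the area is not known
  to be a measurable function of time when the lemma is applied to it.\<close>

lemma cutoff_average_le:
  assumes r: "r > 0" and ab: "0 \<le> b - r" "b \<le> T"
    and Q: "\<And>s. s \<in> {b - r..b} \<Longrightarrow> Q s \<le> c"
    and int: "c \<ge> 0 \<or> set_integrable lborel {0..T} (\<lambda>s. Q s * - gradient (cutoff b r) s)"
  shows "(LINT s:{0..T}|lborel. Q s * - gradient (cutoff b r) s) \<le> c"
proof -
  let ?g = "\<lambda>s. - gradient (cutoff b r) s"
  have cg: "continuous_on {0..T} ?g" by (intro continuous_intros continuous_on_gradient smooth_cutoff)
  have "(LINT s:{0..T}|lborel. c * ?g s) = c * - cutoff b r T - c * - cutoff b r 0"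
  proof (rule integral_set_FTC)
    show "((\<lambda>s. c * - cutoff b r s) has_real_derivative c * ?g x) (at x within {0..T})" for x
      by (intro DERIV_cmult DERIV_minus has_field_derivative_at_within[OF smooth_real_deriv[OF smooth_cutoff]])
    show "continuous_on {0..T} (\<lambda>s. c * ?g s)" by (intro continuous_on_mult continuous_on_const cg)
  qed (use r ab in auto)
  also have "\<dots> = c" using cutoff_1[OF r, of 0 b] cutoff_0[OF r, of b T] ab by simp
  finally have c: "(LINT s:{0..T}|lborel. c * ?g s) = c" .
  show ?thesis
  proof (cases "set_integrable lborel {0..T} (\<lambda>s. Q s * ?g s)")
    case True
    have "(LINT s:{0..T}|lborel. Q s * ?g s) \<le> (LINT s:{0..T}|lborel. c * ?g s)"
    proof (rule set_integral_mono[OF True])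
      show "set_integrable lborel {0..T} (\<lambda>s. c * ?g s)"
        by (intro borel_integrable_atLeastAtMost' continuous_intros continuous_on_gradient smooth_cutoff)
      show "Q s * ?g s \<le> c * ?g s" if "s \<in> {0..T}" for s
      proof (cases "s \<in> {b - r..b}")
        case True
        then show ?thesis using Q[OF True] cutoff_deriv_nonpos[OF r, of b s] by (intro mult_right_mono) auto
      next
        case False
        then show ?thesis using cutoff_deriv_outside[OF r, of s b] by auto
      qed
    qed
    then show ?thesis using c by simp
  next
    case False
    then have "(LINT s:{0..T}|lborel. Q s * ?g s) = 0"
      unfolding set_lebesgue_integral_def set_integrable_def by (rule not_integrable_integral_eq)
    then show ?thesis using int False by simp
  qed
qed

definition plateau :: "real \<Rightarrow> real \<Rightarrow> real" where
  "plateau M y = cutoff (M + 1) 1 y * cutoff (M + 1) 1 (- y)"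

lemma smooth_plateau: "smooth (plateau M)"
  unfolding plateau_def[abs_def]
  using smooth_compose_affine[OF bounded_linear_minus[OF bounded_linear_ident] smooth_cutoff, of "M+1" 1 0]
  by (intro smooth_mult smooth_cutoff) simp

lemma plateau_1: "\<bar>y\<bar> \<le> M \<Longrightarrow> plateau M y = 1"
  by (auto simp: plateau_def cutoff_1)

lemma plateau_nonzero: "plateau M y \<noteq> 0 \<Longrightarrow> \<bar>y\<bar> \<le> M + 1"
  using cutoff_0[of 1 "M+1" y] cutoff_0[of 1 "M+1" "-y"] by (force simp: plateau_def)

lemma smooth_slice:
  fixes \<phi> :: "(real^2) \<times> real \<Rightarrow> real"
  assumes "smooth \<phi>" shows "smooth (\<lambda>y. \<phi> (y, t))"
proof -
  have "bounded_linear (\<lambda>y::real^2. (y, 0::real))"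
    by (intro bounded_linear_Pair bounded_linear_ident bounded_linear_zero)
  from smooth_compose_affine[OF this assms, of "(0, t)"] show ?thesis by simp
qed

lemma time_derivative:
  fixes \<phi> :: "(real^2) \<times> real \<Rightarrow> real"
  assumes "smooth \<phi>"
  shows "deriv (\<lambda>s. \<phi> (x, s)) t = frechet_derivative \<phi> (at (x, t)) (0, 1)"
proof (rule DERIV_imp_deriv)
  have "((\<lambda>s. (x, s)) has_derivative (\<lambda>h. (0, h))) (at t)"
    by (auto intro!: derivative_eq_intros)
  from has_derivative_compose[OF this smooth_has_derivative[OF assms]]
  have "((\<lambda>s. \<phi> (x, s)) has_derivative (\<lambda>h. frechet_derivative \<phi> (at (x, t)) (0, h))) (at t)" .
  moreover have "(\<lambda>h. frechet_derivative \<phi> (at (x, t)) (0, h)) = (*) (frechet_derivative \<phi> (at (x, t)) (0, 1))"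
  proof
    fix h :: real
    have "(0::real^2, h) = h *\<^sub>R (0, 1)" by simp
    then show "frechet_derivative \<phi> (at (x, t)) (0, h) = frechet_derivative \<phi> (at (x, t)) (0, 1) * h"
      using linear_scale[OF smooth_linear_frechet[OF assms, of "(x,t)"], of h "(0, 1)"]
      by (simp only: real_scaleR_def mult.commute)
  qed
  ultimately show "((\<lambda>s. \<phi> (x, s)) has_real_derivative frechet_derivative \<phi> (at (x, t)) (0, 1)) (at t)"
    by (simp only: has_field_derivative_def)
qed

lemma space_gradient:
  fixes \<phi> :: "(real^2) \<times> real \<Rightarrow> real"
  assumes "smooth \<phi>"
  shows "w \<bullet> gradient (\<lambda>y. \<phi> (y, t)) x = frechet_derivative \<phi> (at (x, t)) (w, 0)"
proof -
  have "((\<lambda>y. (y, t)) has_derivative (\<lambda>h. (h, 0))) (at x)"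
    by (auto intro!: derivative_eq_intros)
  from has_derivative_compose[OF this smooth_has_derivative[OF assms]]
  have "((\<lambda>y. \<phi> (y, t)) has_derivative (\<lambda>h. frechet_derivative \<phi> (at (x, t)) (h, 0))) (at x)" .
  note fun_cong[OF frechet_derivative_at[OF this], of w]
  moreover have "w \<bullet> gradient (\<lambda>y. \<phi> (y, t)) x = frechet_derivative (\<lambda>y. \<phi> (y, t)) (at x) w"
    by (rule inner_gradient) (rule smooth_slice[OF assms])
  ultimately show ?thesis by simp
qed

section \<open>Material derivative, mass and flux\<close>

context evolving_C1_domain
begin

text \<open>The operator of the transport equation, written as one derivative in the space-time
  direction \<open>(v, 1)\<close>, so that product and chain rules apply directly.\<close>

definition transport :: "((real^2) \<times> real \<Rightarrow> real) \<Rightarrow> real^2 \<Rightarrow> real \<Rightarrow> real" where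
  "transport \<phi> x t = frechet_derivative \<phi> (at (x, t)) (v x t, 1)"

lemma transport_eq:
  assumes "smooth \<phi>"
  shows "deriv (\<lambda>s. \<phi> (x, s)) t + v x t \<bullet> gradient (\<lambda>y. \<phi> (y, t)) x = transport \<phi> x t"
  using linear_add[OF smooth_linear_frechet[OF assms, of "(x, t)"], of "(0, 1)" "(v x t, 0)"]
  by (simp add: transport_def time_derivative[OF assms] space_gradient[OF assms])

lemma continuous_on_transport:
  assumes "smooth \<phi>"
  shows "continuous_on (UNIV \<times> {0..T}) (\<lambda>(x, t). transport \<phi> x t)"
proof -
  have eq: "transport \<phi> x t = (\<Sum>b\<in>Basis. ((v x t, 1) \<bullet> b) *\<^sub>R frechet_derivative \<phi> (at (x, t)) b)" for x t
    unfolding transport_def by (rule linear_eq_sum_Basis[OF smooth_linear_frechet[OF assms]])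
  have "continuous_on (UNIV \<times> {0..T}) (\<lambda>p. (v (fst p) (snd p), 1::real))"
    using continuous_velocity by (intro continuous_intros) (simp add: case_prod_beta)
  from continuous_on_inner[OF this continuous_on_const]
  have "continuous_on (UNIV \<times> {0..T}) (\<lambda>p. \<Sum>b\<in>Basis. ((v (fst p) (snd p), 1) \<bullet> b) *\<^sub>R frechet_derivative \<phi> (at p) b)"
    by (intro continuous_on_sum continuous_on_scaleR smooth_continuous_on_frechet assms)
  then show ?thesis by (simp add: case_prod_beta eq)
qed

lemma continuous_transport_slice:
  "smooth \<phi> \<Longrightarrow> t \<in> {0..T} \<Longrightarrow> continuous_on UNIV (\<lambda>x. transport \<phi> x t)"
  by (rule continuous_on_space_slice[OF continuous_on_transport])

definition mass :: "((real^2) \<times> real \<Rightarrow> real) \<Rightarrow> real \<Rightarrow> real" where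
  "mass \<phi> t = dint (\<Omega> t) (\<lambda>x. \<phi> (x, t))"

definition flux :: "((real^2) \<times> real \<Rightarrow> real) \<Rightarrow> real \<Rightarrow> real" where
  "flux \<phi> t = dint (\<Omega> t) (\<lambda>x. transport \<phi> x t)"

lemma weak_solution_iff:
  "weak_solution T v \<Omega> \<longleftrightarrow> (\<forall>\<phi>. test_function T \<phi> \<longrightarrow> mass \<phi> 0 = - (LINT t:{0..T}|lborel. flux \<phi> t))"
proof -
  have "(LINT x:\<Omega> 0|lborel. \<phi> (x, 0)) = mass \<phi> 0" for \<phi>
    by (simp add: set_lebesgue_integral_def mass_def dint_def)
  moreover have "(LINT x|lborel. indicator (\<Omega> t) x * (deriv (\<lambda>s. \<phi> (x, s)) t + v x t \<bullet> gradient (\<lambda>y. \<phi> (y, t)) x)) = flux \<phi> t"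
    if "test_function T \<phi>" for \<phi> t
    using that by (simp add: test_function_def transport_eq flux_def dint_def)
  ultimately show ?thesis unfolding weak_solution_def by simp
qed

lemma smooth_time:
  fixes \<eta> :: "real \<Rightarrow> real"
  assumes "smooth \<eta>" shows "smooth (\<lambda>p::(real^2) \<times> real. \<eta> (snd p))"
  using smooth_compose_affine[OF bounded_linear_snd assms, of 0] by simp

lemma smooth_space:
  fixes u :: "real \<Rightarrow> real"
  assumes "smooth u" shows "smooth (\<lambda>p::(real^2) \<times> real. u (fst p $ i))"
  using smooth_compose_affine[OF bounded_linear_compose[OF bounded_linear_vec_nth[of i] bounded_linear_fst] assms, of 0] by simp

lemma flux_times_cutoff:
  fixes \<eta> :: "real \<Rightarrow> real"
  assumes \<phi>: "smooth \<phi>" and \<eta>: "smooth \<eta>" and t: "t \<in> {0..T}"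
  shows "flux (\<lambda>p. \<phi> p * \<eta> (snd p)) t = \<eta> t * flux \<phi> t + gradient \<eta> t * mass \<phi> t"
proof -
  have eq: "transport (\<lambda>p. \<phi> p * \<eta> (snd p)) x t = \<eta> t * transport \<phi> x t + gradient \<eta> t * \<phi> (x, t)" for x
  proof -
    have "((\<lambda>p. \<phi> p * \<eta> (snd p)) has_derivative
       (\<lambda>w. \<phi> (x, t) * (gradient \<eta> (snd (x, t)) * snd w) + frechet_derivative \<phi> (at (x, t)) w * \<eta> (snd (x, t)))) (at (x, t))"
      by (intro has_derivative_mult smooth_has_derivative \<phi> smooth_has_derivative_real \<eta> has_derivative_snd has_derivative_ident)
    from fun_cong[OF frechet_derivative_at[OF this], of "(v x t, 1)"] show ?thesis
      unfolding transport_def by (simp add: algebra_simps)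
  qed
  have c: "continuous_on UNIV (\<lambda>x. \<phi> (x, t))" by (rule smooth_continuous_on[OF smooth_slice[OF \<phi>]])
  show ?thesis
    unfolding flux_def mass_def eq
    by (subst dint_add) (auto intro!: domain_facts(1,4)[OF t] continuous_intros c continuous_transport_slice[OF \<phi> t] simp: dint_cmult)
qed

text \<open>A smooth function that does not vanish near time \<open>T\<close> becomes admissible
  after multiplication by a cutoff ending at \<open>b < T\<close>. The condition
  \<open>0 \<le> b - r\<close> makes the cutoff 1 at time 0, so the initial term is
  unchanged.\<close>

lemma weak_solution_cutoff:
  assumes w: "weak_solution T v \<Omega>" and \<phi>: "smooth \<phi>" "compact (support \<phi>)"
    and b: "0 \<le> b - r" "r > 0" "b < T"
  shows "mass \<phi> 0 = - (LINT t:{0..T}|lborel. cutoff b r t * flux \<phi> t + gradient (cutoff b r) t * mass \<phi> t)"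
proof -
  let ?f = "\<lambda>p. \<phi> p * cutoff b r (snd p)"
  have sub: "{p. ?f p \<noteq> 0} \<subseteq> support \<phi> \<inter> (UNIV \<times> {..b})"
  proof
    fix p assume "p \<in> {p. ?f p \<noteq> 0}"
    then have "\<phi> p \<noteq> 0" "cutoff b r (snd p) \<noteq> 0" by auto
    then have "p \<in> support \<phi>" "snd p \<le> b"
      using support_zero[of p \<phi>] cutoff_0[OF b(2), of b "snd p"] by force+
    then show "p \<in> support \<phi> \<inter> (UNIV \<times> {..b})" by (cases p) auto
  qed
  have "closed (support \<phi> \<inter> (UNIV \<times> {..b}))" by (auto simp: support_def intro!: closed_Int closed_Times)
  then have s: "support ?f \<subseteq> support \<phi> \<inter> (UNIV \<times> {..b})"
    unfolding support_def[of ?f] by (rule closure_minimal[OF sub])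
  have "test_function T ?f"
    unfolding test_function_def
  proof (intro conjI)
    show "smooth ?f" by (intro smooth_mult \<phi> smooth_time smooth_cutoff)
    have "bounded (support \<phi>)" using \<phi>(2) by (rule compact_imp_bounded)
    then have "bounded {p. ?f p \<noteq> 0}" using sub bounded_subset by blast
    then show "compact (support ?f)" by (simp add: compact_support_iff)
    show "support ?f \<subseteq> UNIV \<times> {..<T}" using s b by auto
  qed
  then have "mass ?f 0 = - (LINT t:{0..T}|lborel. flux ?f t)" using w weak_solution_iff by blast
  also have "(LINT t:{0..T}|lborel. flux ?f t) = (LINT t:{0..T}|lborel. cutoff b r t * flux \<phi> t + gradient (cutoff b r) t * mass \<phi> t)"
    by (rule set_lebesgue_integral_cong) (auto simp: flux_times_cutoff[OF \<phi>(1) smooth_cutoff])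
  also have "mass ?f 0 = mass \<phi> 0" using cutoff_1[OF b(2), of 0 b] b(1) by (simp add: mass_def)
  finally show ?thesis .
qed

text \<open>A compactly supported substitute for the constant 1: for large \<open>M\<close> it
  equals 1 on a neighbourhood of the whole space-time region swept by the domains.\<close>

definition cylinder :: "real \<Rightarrow> (real^2) \<times> real \<Rightarrow> real" where
  "cylinder M p = plateau M (fst p $ 1) * plateau M (fst p $ 2) * plateau M (snd p)"

lemma smooth_cylinder: "smooth (cylinder M)"
  unfolding cylinder_def[abs_def] by (intro smooth_mult smooth_space smooth_time smooth_plateau)

lemma compact_support_cylinder: "compact (support (cylinder M))"
  unfolding compact_support_iff
proof (rule bounded_subset[of "cball 0 (2 * (M + 1)) \<times> cball 0 (M + 1)"])
  show "bounded (cball 0 (2 * (M + 1)) \<times> cball 0 (M + 1))" by (intro bounded_Times) auto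
  show "{p. cylinder M p \<noteq> 0} \<subseteq> cball 0 (2 * (M + 1)) \<times> cball 0 (M + 1)"
  proof
    fix p :: "(real^2) \<times> real" assume "p \<in> {p. cylinder M p \<noteq> 0}"
    then have "\<bar>fst p $ 1\<bar> \<le> M + 1" "\<bar>fst p $ 2\<bar> \<le> M + 1" "\<bar>snd p\<bar> \<le> M + 1"
      by (auto simp: cylinder_def dest!: plateau_nonzero)
    moreover have "norm (fst p) \<le> \<bar>fst p $ 1\<bar> + \<bar>fst p $ 2\<bar>" using norm_le_l1_cart[of "fst p"] by (simp add: sum_2)
    ultimately show "p \<in> cball 0 (2 * (M + 1)) \<times> cball 0 (M + 1)" by (cases p) auto
  qed
qed

lemma cylinder_1: "norm x < M \<Longrightarrow> \<bar>t\<bar> < M \<Longrightarrow> cylinder M (x, t) = 1"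
  using component_le_norm_cart[of x 1] component_le_norm_cart[of x 2]
  by (simp add: cylinder_def plateau_1)

lemma transport_local:
  assumes "smooth \<phi>" "open U" "(x, t) \<in> U" "\<And>p. p \<in> U \<Longrightarrow> \<phi> p = \<psi> p"
  shows "transport \<phi> x t = transport \<psi> x t"
  unfolding transport_def
  using frechet_derivative_transform_within_open[of \<phi> "(x,t)" U \<psi>] assms smooth_has_derivative[OF assms(1)]
  by (metis differentiableI)

lemma exists_cylinder: "\<exists>M. \<forall>t\<in>{0..T}. \<forall>x\<in>\<Omega> t. (x, t) \<in> ball 0 M \<times> {-M<..<M}"
proof -
  obtain R where R: "R > 0" "\<forall>t\<in>{0..T}. \<Omega> t \<subseteq> cball 0 R" using uniformly_bounded_cball by blast
  have "x \<in> ball 0 (R + T + 1) \<and> t \<in> {-(R+T+1)<..<R+T+1}" if "t \<in> {0..T}" "x \<in> \<Omega> t" for t x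
    using R that T_pos by (force simp: subset_eq)
  then show ?thesis by (intro exI[of _ "R + T + 1"]) auto
qed

lemma unit_test_function:
  "\<exists>\<phi>. smooth \<phi> \<and> compact (support \<phi>) \<and> (\<forall>t\<in>{0..T}. mass \<phi> t = area t \<and> flux \<phi> t = 0)"
proof -
  obtain M where M: "\<And>t x. t \<in> {0..T} \<Longrightarrow> x \<in> \<Omega> t \<Longrightarrow> (x, t) \<in> ball 0 M \<times> {-M<..<M}"
    using exists_cylinder by blast
  have c1: "cylinder M p = 1" if "p \<in> ball 0 M \<times> {-M<..<M}" for p using that cylinder_1[of "fst p" M "snd p"] by auto
  have op: "open (ball (0::real^2) M \<times> {-M<..<M})" by (intro open_Times) auto
  have mass: "mass (cylinder M) s = area s" if "s \<in> {0..T}" for s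
    unfolding mass_def area_def dint_def
    by (rule Bochner_Integration.integral_cong) (use M[OF that] c1 in \<open>auto simp: indicator_def\<close>)
  have tr: "transport (cylinder M) x s = 0" if "s \<in> {0..T}" "x \<in> \<Omega> s" for x s
  proof -
    have "transport (cylinder M) x s = transport (\<lambda>p. 1) x s"
      by (rule transport_local[OF smooth_cylinder op M[OF that]]) (use c1 in auto)
    then show ?thesis by (simp add: transport_def)
  qed
  have flux: "flux (cylinder M) s = 0" if "s \<in> {0..T}" for s
    unfolding flux_def dint_def using tr[OF that]
    by (intro integral_eq_zero_AE AE_I2) (auto simp: indicator_def)
  show ?thesis using smooth_cylinder compact_support_cylinder mass flux by blast
qed

text \<open>Tested with the substitute for the constant 1, the weak form says that the average of
  the area over any window \<open>[b - r, b]\<close> is \<open>area 0\<close>. So the area cannot be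
  at most \<open>area 0 / 2\<close> on a whole window; the factor 1/2 is arbitrary but must be below
  1 to give a contradiction. The times found in this way are dense, and \<open>area_limit\<close>
  reaches the remaining ones.\<close>

lemma weak_solution_area:
  assumes w: "weak_solution T v \<Omega>" and t: "t \<in> {0..T}"
  shows "area t \<ge> area 0 / 2"
proof -
  obtain \<phi> where \<phi>: "smooth \<phi>" "compact (support \<phi>)" and unit: "\<forall>t\<in>{0..T}. mass \<phi> t = area t \<and> flux \<phi> t = 0"
    using unit_test_function by blast
  have big: "\<exists>s\<in>{b - r..b}. area s \<ge> area 0 / 2" if b: "0 \<le> b - r" "r > 0" "b < T" for b r
  proof (rule ccontr)
    assume "\<not> ?thesis"
    then have le: "area s \<le> area 0 / 2" if "s \<in> {b - r..b}" for s using that by force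
    have "area 0 = mass \<phi> 0" using unit T_pos by simp
    also have "\<dots> = - (LINT s:{0..T}|lborel. cutoff b r s * flux \<phi> s + gradient (cutoff b r) s * mass \<phi> s)"
      by (rule weak_solution_cutoff[OF w \<phi> b])
    also have "(LINT s:{0..T}|lborel. cutoff b r s * flux \<phi> s + gradient (cutoff b r) s * mass \<phi> s) =
      (LINT s:{0..T}|lborel. - (area s * - gradient (cutoff b r) s))"
      by (rule set_lebesgue_integral_cong) (use unit in auto)
    also have "- \<dots> = (LINT s:{0..T}|lborel. area s * - gradient (cutoff b r) s)"
      unfolding set_lebesgue_integral_def by simp
    also have "\<dots> \<le> area 0 / 2"
      by (rule cutoff_average_le[OF b(2,1) _ le]) (use b area_pos[of 0] T_pos in auto)
    finally show False using area_pos[of 0] T_pos by simp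
  qed
  have "\<exists>s\<in>{0..T}. \<bar>s - t\<bar> < e \<and> area s \<ge> area 0 / 2" if e: "e > 0" for e
  proof (cases "t < T")
    case True
    define h where "h = min e (T - t) / 3"
    have h: "h > 0" "2 * h < e" "t + 2 * h < T" using e True by (auto simp: h_def min_def field_simps)
    obtain s where "s \<in> {t + 2 * h - h..t + 2 * h}" "area s \<ge> area 0 / 2"
      using big[of "t + 2 * h" h] h t by auto
    then show ?thesis using h t by (intro bexI[of _ s]) auto
  next
    case False
    \<comment> \<open>At \<open>t = T\<close> the window has to end before \<open>T\<close>, since
      the cutoff requires \<open>b < T\<close>.\<close>
    define h where "h = min e T / 3"
    have h: "h > 0" "2 * h < e" "2 * h < T" using e T_pos by (auto simp: h_def min_def)
    obtain s where "s \<in> {T - h - h..T - h}" "area s \<ge> area 0 / 2"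
      using big[of "T - h" h] h by auto
    then show ?thesis using h t False by (intro bexI[of _ s]) auto
  qed
  then have "\<exists>s\<in>{0..T}. \<bar>s - t\<bar> < 1 / (real n + 1) \<and> area s \<ge> area 0 / 2" for n by simp
  then obtain X where X: "\<And>n. X n \<in> {0..T}" "\<And>n. \<bar>X n - t\<bar> < 1 / (real n + 1)" "\<And>n. area (X n) \<ge> area 0 / 2"
    by metis
  have "X \<longlonglongrightarrow> t" by (rule LIMSEQ_if_dist_less_inverse[OF X(2)])
  from area_limit[OF t X(1) this X(3)] show ?thesis .
qed

lemma weak_solution_stable:
  assumes w: "weak_solution T v \<Omega>" and t: "t \<in> {0..T}"
  shows "stable t"
  using stable_if_area_bounded_below[OF t, of "area 0 / 2" 1] weak_solution_area[OF w] area_pos[of 0] T_pos by auto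

lemma continuous_on_mass:
  assumes st: "\<And>t. t \<in> {0..T} \<Longrightarrow> stable t" and \<phi>: "smooth \<phi>"
  shows "continuous_on {0..T} (mass \<phi>)"
  unfolding continuous_on_def mass_def[abs_def]
  using smooth_continuous_on[OF \<phi>] by (intro ballI stable_dint_tendsto st) auto

lemma continuous_on_flux:
  assumes st: "\<And>t. t \<in> {0..T} \<Longrightarrow> stable t" and \<phi>: "smooth \<phi>"
  shows "continuous_on {0..T} (flux \<phi>)"
  unfolding continuous_on_def flux_def[abs_def]
  by (intro ballI stable_dint_tendsto st continuous_on_transport \<phi>) auto

text \<open>Let \<open>P\<close> be the antiderivative of the flux with the initial value of the
  mass. The weak form says that \<open>Q\<close>, the mass minus \<open>P\<close>, has average zero
  against every cutoff density. As \<open>Q\<close> is continuous, a nonzero value at an interior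
  time would contradict this on a short window ending there.\<close>

lemma mass_derivative_compact:
  assumes w: "weak_solution T v \<Omega>" and \<phi>: "smooth \<phi>" "compact (support \<phi>)" and t: "t \<in> {0..T}"
  shows "(mass \<phi> has_real_derivative flux \<phi> t) (at t within {0..T})"
proof -
  note st = weak_solution_stable[OF w]
  note cF = continuous_on_mass[OF st \<phi>(1)] and cG = continuous_on_flux[OF st \<phi>(1)]
  obtain P0 where P0: "\<And>x. x \<in> {0..T} \<Longrightarrow> (P0 has_vector_derivative flux \<phi> x) (at x within {0..T})"
    using antiderivative_continuous[OF cG] by blast
  define P where "P = (\<lambda>x. P0 x - P0 0 + mass \<phi> 0)"
  have P: "(P has_real_derivative flux \<phi> x) (at x within {0..T})" if "x \<in> {0..T}" for x
    unfolding P_def using P0[OF that]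
    by (auto intro!: derivative_eq_intros simp: has_real_derivative_iff_has_vector_derivative[symmetric])
  have cP: "continuous_on {0..T} P" by (rule DERIV_continuous_on[OF P])
  define Q where "Q = (\<lambda>x. mass \<phi> x - P x)"
  have cQ: "continuous_on {0..T} Q" unfolding Q_def by (intro continuous_intros cF cP)
  have zero: "(LINT s:{0..T}|lborel. Q s * - gradient (cutoff b r) s) = 0" if b: "0 \<le> b - r" "r > 0" "b < T" for b r
  proof -
    let ?c = "cutoff b r" and ?g = "gradient (cutoff b r)"
    have cc: "continuous_on {0..T} ?c" "continuous_on {0..T} ?g"
      by (intro smooth_continuous_on continuous_on_gradient smooth_cutoff)+
    have "(LINT s:{0..T}|lborel. ?c s * flux \<phi> s + ?g s * P s) = ?c T * P T - ?c 0 * P 0"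
    proof (rule integral_set_FTC)
      show "((\<lambda>s. ?c s * P s) has_real_derivative ?c s * flux \<phi> s + ?g s * P s) (at s within {0..T})" if "s \<in> {0..T}" for s
        using DERIV_mult[OF has_field_derivative_at_within[OF smooth_real_deriv[OF smooth_cutoff[of b r]]] P[OF that]]
        by (simp add: algebra_simps)
      show "continuous_on {0..T} (\<lambda>s. ?c s * flux \<phi> s + ?g s * P s)" by (intro continuous_intros cc cG cP)
    qed (use T_pos in simp)
    also have "\<dots> = - mass \<phi> 0" using cutoff_1[OF b(2), of 0 b] cutoff_0[OF b(2), of b T] b by (simp add: P_def)
    also have "\<dots> = (LINT s:{0..T}|lborel. ?c s * flux \<phi> s + ?g s * mass \<phi> s)"
      using weak_solution_cutoff[OF w \<phi> b] by simp
    finally have eq: "(LINT s:{0..T}|lborel. ?c s * flux \<phi> s + ?g s * P s) = (LINT s:{0..T}|lborel. ?c s * flux \<phi> s + ?g s * mass \<phi> s)" .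
    have "(LINT s:{0..T}|lborel. Q s * - ?g s) = (LINT s:{0..T}|lborel. (?c s * flux \<phi> s + ?g s * P s) - (?c s * flux \<phi> s + ?g s * mass \<phi> s))"
      by (rule set_lebesgue_integral_cong) (auto simp: Q_def algebra_simps)
    also have "\<dots> = (LINT s:{0..T}|lborel. ?c s * flux \<phi> s + ?g s * P s) - (LINT s:{0..T}|lborel. ?c s * flux \<phi> s + ?g s * mass \<phi> s)"
      by (rule set_integral_diff; intro borel_integrable_atLeastAtMost' continuous_intros cc cG cP cF)
    finally show ?thesis using eq by simp
  qed
  have nonpos: "Q' x \<le> 0" if Q': "continuous_on {0..T} Q'" "\<And>b r. 0 \<le> b - r \<Longrightarrow> r > 0 \<Longrightarrow> b < T \<Longrightarrow> (LINT s:{0..T}|lborel. - Q' s * - gradient (cutoff b r) s) = 0"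
    and x: "x \<in> {0<..<T}" for Q' x
  proof (rule ccontr)
    assume "\<not> Q' x \<le> 0"
    then have q: "Q' x > 0" by simp
    have "x \<in> {0..T}" using x by auto
    then obtain d where d: "d > 0" "\<forall>y\<in>{0..T}. dist y x < d \<longrightarrow> dist (Q' y) (Q' x) < Q' x / 2"
      using Q'(1) q unfolding continuous_on_iff by (meson half_gt_zero)
    define r where "r = min d x / 2"
    have r: "r > 0" "r < d" "x - r \<ge> 0" using d x by (auto simp: r_def)
    have "- Q' s \<le> - (Q' x / 2)" if "s \<in> {x - r..x}" for s
    proof -
      have "s \<in> {0..T}" "dist s x < d" using that r x by (auto simp: dist_real_def)
      with d(2) have "\<bar>Q' s - Q' x\<bar> < Q' x / 2" by (simp add: dist_real_def)
      then show ?thesis by linarith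
    qed
    moreover have "set_integrable lborel {0..T} (\<lambda>s. - Q' s * - gradient (cutoff x r) s)"
      by (intro borel_integrable_atLeastAtMost' continuous_intros continuous_on_gradient smooth_cutoff Q')
    ultimately have "(LINT s:{0..T}|lborel. - Q' s * - gradient (cutoff x r) s) \<le> - (Q' x / 2)"
      using r x by (intro cutoff_average_le) auto
    moreover have "(LINT s:{0..T}|lborel. - Q' s * - gradient (cutoff x r) s) = 0" using Q'(2)[of x r] r x by auto
    ultimately show False using q by simp
  qed
  have z2: "(LINT s:{0..T}|lborel. - Q s * - gradient (cutoff b r) s) = 0" if "0 \<le> b - r" "r > 0" "b < T" for b r
    using zero[OF that] by (simp add: set_lebesgue_integral_def)
  have "Q x = 0" if x: "x \<in> {0<..<T}" for x
  proof -
    have "Q x \<le> 0" by (rule nonpos[OF cQ z2 x])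
    moreover have "- Q x \<le> 0" by (rule nonpos[OF _ _ x]) (use zero cQ in \<open>auto intro!: continuous_intros\<close>)
    ultimately show ?thesis by simp
  qed
  \<comment> \<open>The windows give the interior times only; the two endpoints follow by
    continuity.\<close>
  then have Q0: "Q x = 0" if "x \<in> {0..T}" for x
  proof -
    have cl: "closure {0<..<T} = {0..T}" using T_pos by simp
    show ?thesis
      by (rule continuous_constant_on_closure[of "{0<..<T}"]) (use \<open>\<And>x. x \<in> {0<..<T} \<Longrightarrow> Q x = 0\<close> cQ that in \<open>simp_all only: cl\<close>)
  qed
  show ?thesis
    by (rule has_field_derivative_transform_within[OF P[OF t] zero_less_one t])
      (use Q0 in \<open>auto simp: Q_def\<close>)
qed

text \<open>The moving bumps introduced below are not compactly supported in time. Multiplying by a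
  cylinder restores compact support and changes nothing near the domains.\<close>

lemma mass_derivative:
  assumes w: "weak_solution T v \<Omega>" and \<phi>: "smooth \<phi>" and t: "t \<in> {0..T}"
  shows "(mass \<phi> has_real_derivative flux \<phi> t) (at t within {0..T})"
proof -
  obtain M where M: "\<And>t x. t \<in> {0..T} \<Longrightarrow> x \<in> \<Omega> t \<Longrightarrow> (x, t) \<in> ball 0 M \<times> {-M<..<M}"
    using exists_cylinder by blast
  have c1: "cylinder M p = 1" if "p \<in> ball 0 M \<times> {-M<..<M}" for p using that cylinder_1[of "fst p" M "snd p"] by auto
  have op: "open (ball (0::real^2) M \<times> {-M<..<M})" by (intro open_Times) auto
  let ?f = "\<lambda>p. \<phi> p * cylinder M p"
  have sm: "smooth ?f" by (intro smooth_mult \<phi> smooth_cylinder)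
  have "bounded {p. cylinder M p \<noteq> 0}" using compact_support_cylinder by (simp add: compact_support_iff)
  then have "bounded {p. ?f p \<noteq> 0}" by (rule bounded_subset) auto
  then have cs: "compact (support ?f)" by (simp add: compact_support_iff)
  have m: "mass ?f s = mass \<phi> s" if "s \<in> {0..T}" for s
    unfolding mass_def dint_def
    by (rule Bochner_Integration.integral_cong) (use M[OF that] c1 in \<open>auto simp: indicator_def\<close>)
  have "transport ?f x s = transport \<phi> x s" if "s \<in> {0..T}" "x \<in> \<Omega> s" for x s
    by (rule transport_local[OF sm op M[OF that]]) (use c1 in auto)
  then have f: "flux ?f s = flux \<phi> s" if "s \<in> {0..T}" for s
    unfolding flux_def dint_def
    by (intro Bochner_Integration.integral_cong) (use that in \<open>auto simp: indicator_def\<close>)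
  from mass_derivative_compact[OF w sm cs t] show ?thesis
    unfolding f[OF t] by (rule has_field_derivative_transform_within[OF _ zero_less_one t]) (simp add: m)
qed

end

section \<open>Bumps carried by a constant velocity\<close>

lemma lborel_integral_translate:
  fixes f :: "'a::euclidean_space \<Rightarrow> real"
  assumes "f \<in> borel_measurable borel"
  shows "(LINT x|lborel. f (c + x)) = (LINT x|lborel. f x)"
proof -
  have "(LINT x|lborel. f x) = (LINT x|distr lborel borel ((+) c). f x)" by (simp add: lborel_distr_plus)
  also have "\<dots> = (LINT x|lborel. f (c + x))" by (rule integral_distr) (use assms in auto)
  finally show ?thesis by simp
qed

lemma integral_ge_ball:
  fixes f :: "real^2 \<Rightarrow> real"
  assumes "integrable lborel f" "\<And>x. f x \<ge> 0" "\<And>x. x \<in> ball y r \<Longrightarrow> f x \<ge> c"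
  shows "c * measure lborel (ball y r) \<le> (LINT x|lborel. f x)"
proof -
  have e: "emeasure lborel (ball y r) < \<infinity>" by (rule emeasure_lborel_ball_finite)
  have i: "integrable lborel (\<lambda>x. c * indicator (ball y r) x :: real)"
    using e by (intro integrable_mult_right integrable_real_indicator) auto
  have "(LINT x|lborel. c * indicator (ball y r) x) \<le> (LINT x|lborel. f x)"
  proof (rule integral_mono[OF i assms(1)])
    show "c * indicator (ball y r) x \<le> f x" for x using assms(2,3)[of x] by (cases "x \<in> ball y r") auto
  qed
  then show ?thesis by simp
qed

text \<open>Constant along the lines \<open>x = x0 + (t - t0) w\<close>, so \<open>transport\<close>
  sees only the difference \<open>v - w\<close>; with a bump at rest it would be of the larger order
  \<open>v / \<rho>\<close>.\<close>

definition moving_bump :: "real^2 \<Rightarrow> real \<Rightarrow> real^2 \<Rightarrow> real \<Rightarrow> (real^2) \<times> real \<Rightarrow> real" where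
  "moving_bump x0 t0 w \<rho> p =
     smooth_bump ((fst p $ 1 - x0 $ 1 - (snd p - t0) * w $ 1) / \<rho>) * smooth_bump ((fst p $ 2 - x0 $ 2 - (snd p - t0) * w $ 2) / \<rho>)"

lemma smooth_moving_bump: "smooth (moving_bump x0 t0 w \<rho>)"
proof -
  have "smooth (\<lambda>p::(real^2) \<times> real. smooth_bump ((fst p $ i - x0 $ i - (snd p - t0) * w $ i) / \<rho>))" for i
  proof -
    have "bounded_linear (\<lambda>p::(real^2) \<times> real. (fst p $ i - snd p * w $ i) / \<rho>)"
      by (intro bounded_linear_compose[OF bounded_linear_divide] bounded_linear_sub
          bounded_linear_compose[OF bounded_linear_vec_nth bounded_linear_fst]
          bounded_linear_compose[OF bounded_linear_mult_left bounded_linear_snd])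
    from smooth_compose_affine[OF this smooth_smooth_bump, of "(t0 * w $ i - x0 $ i) / \<rho>"]
    show ?thesis by (simp add: add_divide_distrib[symmetric] algebra_simps)
  qed
  then show ?thesis unfolding moving_bump_def[abs_def] by (intro smooth_mult)
qed

lemma moving_bump_nonneg: "0 \<le> moving_bump x0 t0 w \<rho> p"
  unfolding moving_bump_def using smooth_bump_bounds by auto

lemma moving_bump_far:
  fixes x x0 w :: "real^2"
  assumes "norm (x - x0 - (t - t0) *\<^sub>R w) > 2 * \<rho>" "\<rho> > 0"
  shows "\<bar>(x $ 1 - x0 $ 1 - (t - t0) * w $ 1) / \<rho>\<bar> > 1 \<or> \<bar>(x $ 2 - x0 $ 2 - (t - t0) * w $ 2) / \<rho>\<bar> > 1"
proof (rule ccontr)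
  assume "\<not> ?thesis"
  then have "\<bar>x $ 1 - x0 $ 1 - (t - t0) * w $ 1\<bar> \<le> \<rho>" "\<bar>x $ 2 - x0 $ 2 - (t - t0) * w $ 2\<bar> \<le> \<rho>"
    using assms(2) by (auto simp: field_simps)
  then have "norm (x - x0 - (t - t0) *\<^sub>R w) \<le> 2 * \<rho>"
    using norm_le_l1_cart[of "x - x0 - (t - t0) *\<^sub>R w"] by (simp add: sum_2)
  with assms show False by simp
qed

lemma smooth_bump_far: "\<bar>y\<bar> > 1 \<Longrightarrow> smooth_bump y = 0" "\<bar>y\<bar> > 1 \<Longrightarrow> gradient smooth_bump y = 0"
proof -
  show "\<bar>y\<bar> > 1 \<Longrightarrow> smooth_bump y = 0" using smooth_bump_nonzero[of y] by force
  have "support smooth_bump \<subseteq> cball 0 1"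
    unfolding support_def by (rule closure_minimal) (auto dest: smooth_bump_nonzero)
  then show "\<bar>y\<bar> > 1 \<Longrightarrow> gradient smooth_bump y = 0"
    by (intro gradient_zero_outside_support) auto
qed

lemma moving_bump_zero: "norm (x - x0 - (t - t0) *\<^sub>R w) > 2 * \<rho> \<Longrightarrow> \<rho> > 0 \<Longrightarrow> moving_bump x0 t0 w \<rho> (x, t) = 0"
  using moving_bump_far[of \<rho> x x0 t t0 w] smooth_bump_far by (auto simp: moving_bump_def)

lemma smooth_bump_lower: "\<exists>\<kappa>>0. \<forall>y. \<bar>y\<bar> < \<kappa> \<longrightarrow> smooth_bump y \<ge> 1 / 2"
proof -
  have "isCont smooth_bump 0" using smooth_has_derivative[OF smooth_smooth_bump] has_derivative_continuous by blast
  moreover have "smooth_bump 0 = 1" by (simp add: smooth_bump_def smooth_step_0 smooth_step_1)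
  ultimately obtain d where "d > 0" "\<forall>y. dist y 0 < d \<longrightarrow> dist (smooth_bump y) 1 < 1 / 2"
    unfolding continuous_at_eps_delta by (metis half_gt_zero zero_less_one)
  then have "smooth_bump y \<ge> 1 / 2" if "\<bar>y\<bar> < d" for y
  proof -
    have "\<bar>smooth_bump y - 1\<bar> < 1 / 2"
      using that \<open>\<forall>y. dist y 0 < d \<longrightarrow> dist (smooth_bump y) 1 < 1 / 2\<close> by (simp add: dist_real_def)
    then show ?thesis by linarith
  qed
  then show ?thesis using \<open>d > 0\<close> by blast
qed

context evolving_C1_domain
begin

lemma transport_moving_bump:
  "transport (moving_bump x0 t0 w \<rho>) x t =
    smooth_bump ((x $ 1 - x0 $ 1 - (t - t0) * w $ 1) / \<rho>) * (gradient smooth_bump ((x $ 2 - x0 $ 2 - (t - t0) * w $ 2) / \<rho>) * ((v x t $ 2 - w $ 2) / \<rho>)) +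
    gradient smooth_bump ((x $ 1 - x0 $ 1 - (t - t0) * w $ 1) / \<rho>) * ((v x t $ 1 - w $ 1) / \<rho>) * smooth_bump ((x $ 2 - x0 $ 2 - (t - t0) * w $ 2) / \<rho>)"
proof -
  let ?\<xi> = "\<lambda>i (p::(real^2) \<times> real). (fst p $ i - x0 $ i - (snd p - t0) * w $ i) / \<rho>"
  have \<xi>: "(?\<xi> i has_derivative (\<lambda>d. (fst d $ i - snd d * w $ i) / \<rho>)) (at p)" for i p
  proof -
    have L: "bounded_linear (\<lambda>p::(real^2) \<times> real. (fst p $ i - snd p * w $ i) / \<rho>)"
      by (intro bounded_linear_compose[OF bounded_linear_divide] bounded_linear_sub
          bounded_linear_compose[OF bounded_linear_vec_nth bounded_linear_fst]
          bounded_linear_compose[OF bounded_linear_mult_left bounded_linear_snd])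
    have "((\<lambda>p. (fst p $ i - snd p * w $ i) / \<rho> + (t0 * w $ i - x0 $ i) / \<rho>) has_derivative (\<lambda>d. (fst d $ i - snd d * w $ i) / \<rho>)) (at p)"
      using has_derivative_add[OF bounded_linear_imp_has_derivative[OF L] has_derivative_const] by simp
    moreover have "(\<lambda>p. (fst p $ i - snd p * w $ i) / \<rho> + (t0 * w $ i - x0 $ i) / \<rho>) = ?\<xi> i"
      by (auto simp: add_divide_distrib[symmetric] algebra_simps)
    ultimately show ?thesis by simp
  qed
  have "(moving_bump x0 t0 w \<rho> has_derivative (\<lambda>d. smooth_bump (?\<xi> 1 (x, t)) * (gradient smooth_bump (?\<xi> 2 (x, t)) * ((fst d $ 2 - snd d * w $ 2) / \<rho>)) +
       gradient smooth_bump (?\<xi> 1 (x, t)) * ((fst d $ 1 - snd d * w $ 1) / \<rho>) * smooth_bump (?\<xi> 2 (x, t)))) (at (x, t))"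
    unfolding moving_bump_def[abs_def]
    by (intro has_derivative_mult smooth_has_derivative_real smooth_smooth_bump \<xi>)
  from fun_cong[OF frechet_derivative_at[OF this], of "(v x t, 1)"] show ?thesis
    unfolding transport_def by simp
qed

lemma transport_moving_bump_bound:
  assumes B: "\<And>y. \<bar>gradient smooth_bump y\<bar> \<le> B" and \<rho>: "\<rho> > 0" and \<delta>: "norm (v x t - w) \<le> \<delta>"
  shows "\<bar>transport (moving_bump x0 t0 w \<rho>) x t\<bar> \<le> 2 * B * \<delta> / \<rho>"
proof -
  have c: "\<bar>(v x t $ i - w $ i) / \<rho>\<bar> \<le> \<delta> / \<rho>" for i
    using component_le_norm_cart[of "v x t - w" i] \<delta> \<rho> by (simp add: divide_right_mono)
  have s: "\<bar>smooth_bump y\<bar> \<le> 1" for y using smooth_bump_bounds[of y] by simp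
  have B0: "0 \<le> B" using B[of 0] by simp
  have d0: "0 \<le> \<delta>" using \<delta> norm_ge_zero order_trans by blast
  have "\<bar>transport (moving_bump x0 t0 w \<rho>) x t\<bar> \<le> 1 * (B * (\<delta> / \<rho>)) + B * (\<delta> / \<rho>) * 1"
    unfolding transport_moving_bump
    by (rule order_trans[OF abs_triangle_ineq], intro add_mono; simp only: abs_mult)
      (intro mult_mono s B c mult_nonneg_nonneg abs_ge_zero B0 zero_le_one divide_nonneg_pos d0 \<rho>)+
  then show ?thesis by simp
qed

lemma transport_moving_bump_zero:
  assumes "norm (x - x0 - (t - t0) *\<^sub>R w) > 2 * \<rho>" "\<rho> > 0"
  shows "transport (moving_bump x0 t0 w \<rho>) x t = 0"
  using moving_bump_far[OF assms] smooth_bump_far unfolding transport_moving_bump by auto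

text \<open>A matter of scaling. At time \<open>t\<close> the mass differs from 0 and from the full
  mass by a constant times \<open>\<rho>\<^sup>2\<close>. The transport has size
  \<open>\<delta> / \<rho>\<close> on a disc of area of order \<open>\<rho>\<^sup>2\<close>, so up
  to time \<open>t + h\<close> the mass changes by at most the order of
  \<open>\<delta> * \<rho> * \<bar>h\<bar>\<close>. With
  \<open>2 * \<rho> = \<epsilon> * \<bar>h\<bar>\<close> these are incompatible once
  \<open>\<delta>\<close> is small compared with \<open>\<epsilon>\<close>.\<close>

lemma weak_imp_frontier_close:
  assumes w: "weak_solution T v \<Omega>" and t: "t \<in> {0..T}" and x: "x \<in> J t" and \<epsilon>: "\<epsilon> > 0"
  shows "\<exists>\<tau>>0. \<forall>h. h \<noteq> 0 \<longrightarrow> \<bar>h\<bar> < \<tau> \<longrightarrow> t + h \<in> {0..T} \<longrightarrow> infdist (x + h *\<^sub>R v x t) (J (t + h)) \<le> \<epsilon> * \<bar>h\<bar>"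
proof -
  let ?V = "measure lborel (ball (0::real^2) 1)"
  have V: "?V > 0" by (rule content_ball_pos) simp
  obtain B where "B > 0" "\<forall>y. \<bar>smooth_bump y\<bar> \<le> B \<and> norm (gradient smooth_bump y) \<le> B"
    using compact_support_bounds[OF smooth_smooth_bump compact_support_smooth_bump] by blast
  then have B: "B > 0" "\<And>y. \<bar>gradient smooth_bump y\<bar> \<le> B" by auto
  obtain k where k: "k > 0" "\<And>y. \<bar>y\<bar> < k \<Longrightarrow> smooth_bump y \<ge> 1 / 2" using smooth_bump_lower by blast
  obtain d \<kappa> where d: "d > 0" "\<kappa> > 0" and
    sides: "\<And>s. 0 < s \<Longrightarrow> s \<le> d \<Longrightarrow> (\<exists>y. ball y (\<kappa> * s) \<subseteq> \<Omega> t \<inter> ball x s) \<and> (\<exists>y. ball y (\<kappa> * s) \<subseteq> ball x s - closure (\<Omega> t))"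
    using C1_bounded_domain_sides(2)[OF bounded_domain_at[OF t] C1_at[OF t] x] by blast
  define w0 where "w0 = v x t"
  \<comment> \<open>Half of what the final comparison allows: there the lower bound is
    \<open>\<kappa>\<^sup>2 * k\<^sup>2 * \<epsilon> / 8\<close>, while the upper bound
    \<open>32 * B * \<delta>\<close> equals
    \<open>\<kappa>\<^sup>2 * k\<^sup>2 * \<epsilon> / 16\<close>.\<close>
  define \<delta> where "\<delta> = \<kappa>\<^sup>2 * k\<^sup>2 * \<epsilon> / (512 * B)"
  have \<delta>: "\<delta> > 0" using d k \<epsilon> B by (simp add: \<delta>_def)
  obtain d1 where d1: "d1 > 0" "\<forall>p\<in>UNIV \<times> {0..T}. dist p (x, t) < d1 \<longrightarrow> dist (case p of (x, t) \<Rightarrow> v x t) (case (x, t) of (x, t) \<Rightarrow> v x t) < \<delta>"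
    using continuous_velocity[unfolded continuous_on_iff, rule_format, of "(x, t)" \<delta>] t \<delta> by auto
  \<comment> \<open>The first entry keeps the track of the bump within \<open>d1\<close> of
    \<open>(x, t)\<close>, where the velocity is within \<open>\<delta>\<close> of
    \<open>w0\<close>. The second keeps \<open>r = k * \<rho>\<close> at most \<open>d\<close>, the
    range in which both sides are known to contain balls.\<close>
  define \<tau> where "\<tau> = min (d1 / (\<epsilon> + norm w0 + 1)) (2 * d / (k * \<epsilon>))"
  have pos: "\<epsilon> + norm w0 + 1 > 0" "k * \<epsilon> > 0" using \<epsilon> k by (auto simp: add_pos_nonneg)
  show ?thesis
  proof (intro exI[of _ \<tau>] conjI allI impI)
    show "\<tau> > 0" using pos d1 d by (simp add: \<tau>_def)
    fix h :: real assume h: "h \<noteq> 0" "\<bar>h\<bar> < \<tau>" "t + h \<in> {0..T}"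
    show "infdist (x + h *\<^sub>R v x t) (J (t + h)) \<le> \<epsilon> * \<bar>h\<bar>"
    proof (rule ccontr)
      assume "\<not> ?thesis"
      then have far: "infdist (x + h *\<^sub>R w0) (J (t + h)) > \<epsilon> * \<bar>h\<bar>" by (simp add: w0_def)
      \<comment> \<open>The bump lives in a disc of radius \<open>2 * \<rho>\<close>, which is made
        equal to the radius of the disc that the boundary misses.\<close>
      define \<rho> where "\<rho> = \<epsilon> * \<bar>h\<bar> / 2"
      have \<rho>: "\<rho> > 0" "2 * \<rho> = \<epsilon> * \<bar>h\<bar>" using h \<epsilon> by (auto simp: \<rho>_def)
      define \<phi> where "\<phi> = moving_bump x t w0 \<rho>"
      have sm: "smooth \<phi>" unfolding \<phi>_def by (rule smooth_moving_bump)
      have \<phi>0: "\<phi> p \<ge> 0" for p unfolding \<phi>_def by (rule moving_bump_nonneg)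
      define Y where "Y = x + h *\<^sub>R w0"
      define S where "S = closed_segment t (t + h)"
      have S: "S \<subseteq> {0..T}" using t h(3) unfolding S_def by (intro closed_segment_subset) auto
      have Sh: "\<bar>s - t\<bar> \<le> \<bar>h\<bar>" if "s \<in> S" for s
        using that by (auto simp: S_def closed_segment_eq_real_ivl split: if_splits)
      have near: "norm (v y s - w0) \<le> \<delta>" if s: "s \<in> S" and y: "norm (y - x - (s - t) *\<^sub>R w0) \<le> 2 * \<rho>" for y s
      proof -
        have "norm (y - x) \<le> norm (y - x - (s - t) *\<^sub>R w0) + norm ((s - t) *\<^sub>R w0)"
          using norm_triangle_ineq[of "y - x - (s - t) *\<^sub>R w0" "(s - t) *\<^sub>R w0"] by simp
        also have "\<dots> \<le> \<epsilon> * \<bar>h\<bar> + \<bar>h\<bar> * norm w0" using y \<rho> Sh[OF s] by (simp add: add_mono mult_right_mono)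
        finally have "norm (y - x) + \<bar>s - t\<bar> \<le> \<bar>h\<bar> * (\<epsilon> + norm w0 + 1)" using Sh[OF s] by (simp add: algebra_simps)
        also have "\<dots> < d1" using h(2) pos(1) by (simp add: \<tau>_def pos_less_divide_eq)
        finally have "norm (y - x) + \<bar>s - t\<bar> < d1" .
        moreover have "dist (y, s) (x, t) \<le> norm (y - x) + \<bar>s - t\<bar>"
          using norm_Pair_le[of "y - x" "s - t"] by (simp add: dist_norm)
        ultimately have "dist (y, s) (x, t) < d1" by simp
        then show ?thesis using d1(2)[rule_format, of "(y, s)"] s S by (auto simp: dist_norm w0_def less_imp_le)
      qed
      have fluxb: "norm (flux \<phi> s) \<le> 2 * B * \<delta> / \<rho> * (4 * (2 * \<rho>)\<^sup>2 * ?V)" if s: "s \<in> S" for s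
      proof -
        have s': "s \<in> {0..T}" using s S by blast
        let ?A = "cball (x + (s - t) *\<^sub>R w0) (2 * \<rho>)"
        have A: "y \<in> ?A \<longleftrightarrow> norm (y - x - (s - t) *\<^sub>R w0) \<le> 2 * \<rho>" for y
          by (simp add: dist_norm norm_minus_commute algebra_simps)
        have "\<bar>flux \<phi> s\<bar> \<le> 2 * B * \<delta> / \<rho> * measure lborel ?A"
          unfolding flux_def
        proof (rule abs_dint_le[OF domain_facts(1,4)[OF s'] continuous_transport_slice[OF sm s']])
          show "?A \<in> fmeasurable lborel" by (intro fmeasurable_compact compact_cball)
          show "0 \<le> 2 * B * \<delta> / \<rho>" using B \<delta> \<rho> by simp
          show "\<bar>transport \<phi> y s\<bar> \<le> 2 * B * \<delta> / \<rho>" if "y \<in> ?A" for y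
            unfolding \<phi>_def by (rule transport_moving_bump_bound[OF B(2) \<rho>(1) near[OF s]]) (use that A in simp)
          show "transport \<phi> y s = 0" if "y \<notin> ?A" for y
            unfolding \<phi>_def by (rule transport_moving_bump_zero[OF _ \<rho>(1)]) (use that A in simp)
        qed
        also have "\<dots> \<le> 2 * B * \<delta> / \<rho> * (4 * (2 * \<rho>)\<^sup>2 * ?V)"
          using B \<delta> \<rho> by (intro mult_left_mono measure_cball_le) auto
        finally show ?thesis by simp
      qed
      have "norm (mass \<phi> (t + h) - mass \<phi> t) \<le> 2 * B * \<delta> / \<rho> * (4 * (2 * \<rho>)\<^sup>2 * ?V) * norm (t + h - t)"
      proof (rule field_differentiable_bound[of S "mass \<phi>" "flux \<phi>"])
        show "(mass \<phi> has_field_derivative flux \<phi> s) (at s within S)" if "s \<in> S" for s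
          using mass_derivative[OF w sm, of s] that S by (meson DERIV_subset subsetD)
      qed (use fluxb in \<open>auto simp: S_def\<close>)
      also have "\<dots> = 32 * B * \<delta> * \<rho> * ?V * \<bar>h\<bar>" using \<rho>(1) by (simp add: power2_eq_square)
      finally have up: "\<bar>mass \<phi> (t + h) - mass \<phi> t\<bar> \<le> 32 * B * \<delta> * \<rho> * ?V * \<bar>h\<bar>" by simp
      \<comment> \<open>On the disc of radius \<open>r\<close> about \<open>x\<close> both factors
        of the bump are at least 1/2. So the two balls found in it, one in the domain and one
        outside, each carry mass of order \<open>\<rho>\<^sup>2\<close>.\<close>
      define r where "r = k * \<rho>"
      have r: "0 < r" "r \<le> d"
      proof -
        show "0 < r" using k \<rho> by (simp add: r_def)
        have "\<bar>h\<bar> * (k * \<epsilon>) < 2 * d" using h(2) pos(2) by (simp add: \<tau>_def pos_less_divide_eq)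
        then show "r \<le> d" by (simp add: r_def \<rho>_def algebra_simps)
      qed
      have lower: "\<phi> (y, t) \<ge> 1 / 4" if "y \<in> ball x r" for y
      proof -
        have "\<bar>(y $ i - x $ i) / \<rho>\<bar> < k" for i
          using that component_le_norm_cart[of "y - x" i] \<rho> by (simp add: r_def dist_norm norm_minus_commute pos_divide_less_eq)
        then have "smooth_bump ((y $ i - x $ i) / \<rho>) \<ge> 1 / 2" for i using k(2) by blast
        then have "1 / 2 * (1 / 2) \<le> smooth_bump ((y $ 1 - x $ 1) / \<rho>) * smooth_bump ((y $ 2 - x $ 2) / \<rho>)"
          by (intro mult_mono) (auto intro: smooth_bump_bounds)
        then show ?thesis by (simp add: \<phi>_def moving_bump_def)
      qed
      obtain y1 y2 where y1: "ball y1 (\<kappa> * r) \<subseteq> \<Omega> t \<inter> ball x r" and y2: "ball y2 (\<kappa> * r) \<subseteq> ball x r - closure (\<Omega> t)"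
        using sides[OF r] by blast
      have mb: "measure lborel (ball y (\<kappa> * r)) = (\<kappa> * r)\<^sup>2 * ?V" for y :: "real^2"
        using d r by (intro measure_ball_plane) simp
      have c\<phi>: "continuous_on UNIV (\<lambda>x. \<phi> (x, s))" for s by (rule smooth_continuous_on[OF smooth_slice[OF sm]])
      have supp: "\<phi> (y, s) = 0" if "y \<notin> cball (x + (s - t) *\<^sub>R w0) (2 * \<rho>)" for y s
        unfolding \<phi>_def by (rule moving_bump_zero[OF _ \<rho>(1)])
          (use that in \<open>simp add: dist_norm norm_minus_commute algebra_simps\<close>)
      have int: "integrable lborel (\<lambda>y. \<phi> (y, s))" for s
      proof -
        have "integrable lborel (\<lambda>y. indicator (cball (x + (s - t) *\<^sub>R w0) (2 * \<rho>)) y *\<^sub>R \<phi> (y, s))"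
          by (intro borel_integrable_compact continuous_on_subset[OF c\<phi>]) auto
        also have "(\<lambda>y. indicator (cball (x + (s - t) *\<^sub>R w0) (2 * \<rho>)) y *\<^sub>R \<phi> (y, s)) = (\<lambda>y. \<phi> (y, s))"
        proof
          fix y
          show "indicator (cball (x + (s - t) *\<^sub>R w0) (2 * \<rho>)) y *\<^sub>R \<phi> (y, s) = \<phi> (y, s)"
            using supp[of y s] by (cases "y \<in> cball (x + (s - t) *\<^sub>R w0) (2 * \<rho>)") simp_all
        qed
        finally show ?thesis .
      qed
      have it: "integrable lborel (\<lambda>y. indicator (\<Omega> t) y * \<phi> (y, t))"
        by (rule integrable_dint[OF domain_facts(1,4)[OF t] c\<phi>])
      have low1: "1 / 4 * ((\<kappa> * r)\<^sup>2 * ?V) \<le> mass \<phi> t"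
        unfolding mass_def dint_def mb[of y1, symmetric]
      proof (rule integral_ge_ball[OF it])
        show "0 \<le> indicator (\<Omega> t) y * \<phi> (y, t)" for y using \<phi>0 by simp
        show "1 / 4 \<le> indicator (\<Omega> t) y * \<phi> (y, t)" if "y \<in> ball y1 (\<kappa> * r)" for y
        proof -
          have "y \<in> \<Omega> t" "y \<in> ball x r" using that y1 by blast+
          then show ?thesis using lower[of y] by simp
        qed
      qed
      have low2: "1 / 4 * ((\<kappa> * r)\<^sup>2 * ?V) \<le> (LINT y|lborel. \<phi> (y, t)) - mass \<phi> t"
      proof -
        have "1 / 4 * measure lborel (ball y2 (\<kappa> * r)) \<le> (LINT y|lborel. \<phi> (y, t) - indicator (\<Omega> t) y * \<phi> (y, t))"
        proof (rule integral_ge_ball[OF Bochner_Integration.integrable_diff[OF int it]])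
          show "0 \<le> \<phi> (y, t) - indicator (\<Omega> t) y * \<phi> (y, t)" for y using \<phi>0[of "(y, t)"] by (simp add: indicator_def)
          show "1 / 4 \<le> \<phi> (y, t) - indicator (\<Omega> t) y * \<phi> (y, t)" if "y \<in> ball y2 (\<kappa> * r)" for y
          proof -
            have "y \<notin> \<Omega> t" "y \<in> ball x r" using that y2 closure_subset[of "\<Omega> t"] by auto
            then show ?thesis using lower[of y] by simp
          qed
        qed
        then show ?thesis unfolding mb by (simp add: Bochner_Integration.integral_diff[OF int it] mass_def dint_def)
      qed
      have trans: "(LINT y|lborel. \<phi> (y, t + h)) = (LINT y|lborel. \<phi> (y, t))"
      proof -
        have "\<phi> (y, t) = \<phi> (h *\<^sub>R w0 + y, t + h)" for y by (simp add: \<phi>_def moving_bump_def algebra_simps)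
        then have "(LINT y|lborel. \<phi> (y, t)) = (LINT y|lborel. \<phi> (h *\<^sub>R w0 + y, t + h))" by simp
        also have "\<dots> = (LINT y|lborel. \<phi> (y, t + h))"
          by (rule lborel_integral_translate[of "\<lambda>y. \<phi> (y, t + h)"]) (intro borel_measurable_continuous_onI c\<phi>)
        finally show ?thesis by simp
      qed
      have miss: "cball Y (2 * \<rho>) \<inter> J (t + h) = {}"
        using far \<rho> infdist_le[of _ "J (t + h)" Y] unfolding Y_def[symmetric] by force
      have same: "y \<in> \<Omega> (t + h) \<longleftrightarrow> Y \<in> \<Omega> (t + h)" if "y \<in> cball Y (2 * \<rho>)" for y
        by (rule connected_same_side[OF convex_connected[OF convex_cball] miss that]) (use \<rho> in simp)
      have suppY: "\<phi> (y, t + h) = 0" if "y \<notin> cball Y (2 * \<rho>)" for y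
        using supp[of y "t + h"] that by (simp add: Y_def)
      have "mass \<phi> (t + h) = 0 \<or> mass \<phi> (t + h) = (LINT y|lborel. \<phi> (y, t))"
      proof (cases "Y \<in> \<Omega> (t + h)")
        case True
        have "mass \<phi> (t + h) = (LINT y|lborel. \<phi> (y, t + h))"
          unfolding mass_def dint_def
          by (rule Bochner_Integration.integral_cong) (use same suppY True in \<open>auto simp: indicator_def\<close>)
        then show ?thesis by (simp add: trans)
      next
        case False
        have "mass \<phi> (t + h) = (LINT (y::real^2)|lborel. 0)"
          unfolding mass_def dint_def
          by (rule Bochner_Integration.integral_cong) (use same suppY False in \<open>auto simp: indicator_def\<close>)
        then show ?thesis by simp
      qed
      then have "1 / 4 * ((\<kappa> * r)\<^sup>2 * ?V) \<le> 32 * B * \<delta> * \<rho> * ?V * \<bar>h\<bar>"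
        using low1 low2 up by (elim disjE) linarith+
      then have "1 / 4 * (\<kappa> * (k * \<rho>))\<^sup>2 * ?V \<le> 32 * B * \<delta> * \<rho> * \<bar>h\<bar> * ?V" by (simp add: r_def mult_ac)
      then have "1 / 4 * (\<kappa> * (k * \<rho>))\<^sup>2 \<le> 32 * B * \<delta> * \<rho> * \<bar>h\<bar>" using V by simp
      then have "1 / 4 * (\<kappa>\<^sup>2 * k\<^sup>2 * \<rho>) * \<rho> \<le> 32 * B * \<delta> * \<bar>h\<bar> * \<rho>" by (simp add: power2_eq_square mult_ac)
      then have "1 / 4 * (\<kappa>\<^sup>2 * k\<^sup>2 * \<rho>) \<le> 32 * B * \<delta> * \<bar>h\<bar>" using \<rho>(1) by simp
      then have "\<kappa>\<^sup>2 * k\<^sup>2 * \<epsilon> / 8 * \<bar>h\<bar> \<le> 32 * B * \<delta> * \<bar>h\<bar>" by (simp add: \<rho>_def mult_ac)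
      then have "\<kappa>\<^sup>2 * k\<^sup>2 * \<epsilon> / 8 \<le> 32 * B * \<delta>" using h(1) by simp
      also have "32 * B * \<delta> = \<kappa>\<^sup>2 * k\<^sup>2 * \<epsilon> / 16" using B by (simp add: \<delta>_def)
      finally show False using d k \<epsilon> by simp
    qed
  qed
qed

lemma weak_imp_flows:
  assumes w: "weak_solution T v \<Omega>"
  shows "flows_with T v \<Omega>"
  unfolding flows_with_def
proof (intro ballI tendstoI)
  fix t x and e :: real assume t: "t \<in> {0..T}" and x: "x \<in> J t" and e: "e > 0"
  obtain \<tau> where \<tau>: "\<tau> > 0" "\<And>h. h \<noteq> 0 \<Longrightarrow> \<bar>h\<bar> < \<tau> \<Longrightarrow> t + h \<in> {0..T} \<Longrightarrow> infdist (x + h *\<^sub>R v x t) (J (t + h)) \<le> e / 2 * \<bar>h\<bar>"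
    using weak_imp_frontier_close[OF w t x, of "e / 2"] e by (metis half_gt_zero)
  have "dist (infdist (x + h *\<^sub>R v x t) (J (t + h)) / h) 0 < e" if h: "t + h \<in> {0..T}" "h \<noteq> 0" "\<bar>h\<bar> < \<tau>" for h
  proof -
    have "infdist (x + h *\<^sub>R v x t) (J (t + h)) / \<bar>h\<bar> \<le> e / 2"
      using \<tau>(2)[OF h(2,3,1)] h(2) by (simp add: pos_divide_le_eq)
    moreover have "dist (infdist (x + h *\<^sub>R v x t) (J (t + h)) / h) 0 = infdist (x + h *\<^sub>R v x t) (J (t + h)) / \<bar>h\<bar>"
      using infdist_nonneg[of "x + h *\<^sub>R v x t" "J (t + h)"] by (simp add: dist_real_def abs_divide)
    ultimately show ?thesis using e by linarith
  qed
  then show "\<forall>\<^sub>F h in at 0 within {h. t + h \<in> {0..T}}. dist (infdist (x + h *\<^sub>R v x t) (J (t + h)) / h) 0 < e"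
    unfolding eventually_at using \<tau>(1) by (intro exI[of _ \<tau>]) (auto simp: dist_real_def)
qed

end

section \<open>From flows to weak solutions\<close>

text \<open>Tilting by the slope \<open>c + \<epsilon>\<close> reduces the claim to
  \<open>g a \<le> g b\<close>. The set where \<open>g \<le> g b\<close> is compact and contains
  \<open>b\<close>; at its least element the hypothesis would permit a further step to the left,
  unless that element is \<open>a\<close>.\<close>

lemma backward_dini:
  fixes f :: "real \<Rightarrow> real"
  assumes ab: "a \<le> b" and f: "continuous_on {a..b} f"
    and D: "\<And>s \<epsilon>. s \<in> {a..b} \<Longrightarrow> \<epsilon> > 0 \<Longrightarrow> \<exists>\<eta>>0. \<forall>s'\<in>{a..b}. \<bar>s' - s\<bar> < \<eta> \<longrightarrow> f s' \<le> f s + (c + \<epsilon>) * \<bar>s' - s\<bar>"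
  shows "f a \<le> f b + c * (b - a)"
proof (rule field_le_epsilon)
  fix e :: real assume e: "e > 0"
  define \<epsilon> where "\<epsilon> = e / (b - a + 1)"
  have \<epsilon>: "\<epsilon> > 0" "\<epsilon> * (b - a) \<le> e"
  proof -
    show "\<epsilon> > 0" using e ab by (simp add: \<epsilon>_def)
    moreover have "\<epsilon> * (b - a + 1) = e" using ab by (simp add: \<epsilon>_def)
    ultimately show "\<epsilon> * (b - a) \<le> e" by (simp add: distrib_left)
  qed
  define g where "g = (\<lambda>s. f s + (c + \<epsilon>) * s)"
  have g: "continuous_on {a..b} g" unfolding g_def by (intro continuous_intros f)
  define S where "S = {a..b} \<inter> g -` {..g b}"
  have "closed S" unfolding S_def by (rule continuous_closed_preimage[OF g]) auto
  then have "compact S" by (metis S_def bounded_Int bounded_closed_interval compact_eq_bounded_closed)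
  moreover have "b \<in> S" using ab by (simp add: S_def)
  ultimately obtain m where m: "m \<in> S" "\<forall>s\<in>S. m \<le> s" using compact_attains_inf[of S] by blast
  have mab: "m \<in> {a..b}" "g m \<le> g b" using m(1) by (auto simp: S_def)
  have "m = a"
  proof (rule ccontr)
    assume "m \<noteq> a"
    then have ma: "a < m" using mab by simp
    obtain \<eta> where \<eta>: "\<eta> > 0" "\<forall>s'\<in>{a..b}. \<bar>s' - m\<bar> < \<eta> \<longrightarrow> f s' \<le> f m + (c + \<epsilon>) * \<bar>s' - m\<bar>"
      using D[OF mab(1) \<epsilon>(1)] by blast
    define k where "k = min (\<eta> / 2) (m - a)"
    have k: "k > 0" "k < \<eta>" "a \<le> m - k" using \<eta>(1) ma by (auto simp: k_def)
    have "f (m - k) \<le> f m + (c + \<epsilon>) * k" using \<eta>(2)[rule_format, of "m - k"] k mab by auto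
    then have "g (m - k) \<le> g m" by (simp add: g_def algebra_simps)
    then have "m - k \<in> S" using mab k by (auto simp: S_def)
    with m(2) k(1) show False by force
  qed
  then show "f a \<le> f b + c * (b - a) + e" using mab(2) \<epsilon>(2) by (simp add: g_def algebra_simps)
qed

lemma dini_bound:
  fixes f :: "real \<Rightarrow> real"
  assumes f: "continuous_on (closed_segment t u) f"
    and D: "\<And>s \<epsilon>. s \<in> closed_segment t u \<Longrightarrow> \<epsilon> > 0 \<Longrightarrow>
      \<exists>\<eta>>0. \<forall>s'\<in>closed_segment t u. \<bar>s' - s\<bar> < \<eta> \<longrightarrow> f s' \<le> f s + (c + \<epsilon>) * \<bar>s' - s\<bar>"
  shows "f t \<le> f u + c * \<bar>u - t\<bar>"
proof (cases "t \<le> u")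
  case True
  then have seg: "closed_segment t u = {t..u}" by (simp add: closed_segment_eq_real_ivl)
  have "f t \<le> f u + c * (u - t)"
    by (rule backward_dini[OF True]) (use f D in \<open>simp_all only: seg\<close>)
  then show ?thesis using True by simp
next
  case False
  then have seg: "closed_segment t u = {u..t}" by (simp add: closed_segment_eq_real_ivl)
  \<comment> \<open>Time reversal reduces this case to \<open>backward_dini\<close>; the hypothesis
    is two-sided in time and survives the reflection.\<close>
  have "f (- (- t)) \<le> f (- (- u)) + c * (- u - (- t))"
  proof (rule backward_dini[of "- t" "- u" "\<lambda>s. f (- s)"])
    have "continuous_on {- t..- u} (f \<circ> uminus)"
      by (intro continuous_on_compose continuous_intros) (use f seg in simp)
    then show "continuous_on {- t..- u} (\<lambda>s. f (- s))" by (simp add: comp_def)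
    fix s \<epsilon> :: real assume s: "s \<in> {- t..- u}" "\<epsilon> > 0"
    then have "- s \<in> closed_segment t u" using seg by auto
    from D[OF this s(2)] obtain \<eta> where \<eta>: "\<eta> > 0" "\<forall>s'\<in>{u..t}. \<bar>s' - (- s)\<bar> < \<eta> \<longrightarrow> f s' \<le> f (- s) + (c + \<epsilon>) * \<bar>s' - (- s)\<bar>"
      unfolding seg by blast
    have "f (- s') \<le> f (- s) + (c + \<epsilon>) * \<bar>s' - s\<bar>" if "s' \<in> {- t..- u}" "\<bar>s' - s\<bar> < \<eta>" for s'
      using \<eta>(2)[rule_format, of "- s'"] that by (auto simp: abs_minus_commute)
    then show "\<exists>\<eta>>0. \<forall>s'\<in>{- t..- u}. \<bar>s' - s\<bar> < \<eta> \<longrightarrow> f (- s') \<le> f (- s) + (c + \<epsilon>) * \<bar>s' - s\<bar>"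
      using \<eta>(1) by blast
  qed (use False in simp)
  then show ?thesis using False by simp
qed

text \<open>Integrate the sum of the indicators, which at each point counts at most \<open>N\<close>
  balls.\<close>

lemma sum_measure_overlap:
  fixes A :: "(real^2) set"
  assumes Z: "finite Z" "\<And>p. card {z\<in>Z. dist z p \<le> r} \<le> N" and A: "A \<in> fmeasurable lborel"
  shows "(\<Sum>z\<in>Z. measure lborel (A \<inter> cball z r)) \<le> real N * measure lborel A"
proof -
  have Ac: "A \<inter> cball z r \<in> fmeasurable lborel" for z by (rule fmeasurable.Int[OF A]) (intro fmeasurable_compact compact_cball)
  have ind: "integrable lborel (indicator B :: real^2 \<Rightarrow> real)" if "B \<in> fmeasurable lborel" for B
    using that by (intro integrable_real_indicator) (auto simp: fmeasurable_def)
  have "(\<Sum>z\<in>Z. measure lborel (A \<inter> cball z r)) = (\<Sum>z\<in>Z. LINT x|lborel. indicator (A \<inter> cball z r) x)"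
    by simp
  also have "\<dots> = (LINT x|lborel. (\<Sum>z\<in>Z. indicator (A \<inter> cball z r) x))"
    by (rule Bochner_Integration.integral_sum[symmetric]) (rule ind[OF Ac])
  also have "\<dots> \<le> (LINT x|lborel. real N * indicator A x)"
  proof (rule integral_mono)
    show "integrable lborel (\<lambda>x. \<Sum>z\<in>Z. indicator (A \<inter> cball z r) x :: real)"
      by (intro Bochner_Integration.integrable_sum ind Ac)
    show "integrable lborel (\<lambda>x. real N * indicator A x)" by (intro integrable_mult_right ind A)
    show "(\<Sum>z\<in>Z. indicator (A \<inter> cball z r) x) \<le> real N * indicator A x" for x
    proof (cases "x \<in> A")
      case True
      have "(\<Sum>z\<in>Z. indicator (A \<inter> cball z r) x :: real) = (\<Sum>z\<in>Z. if dist z x \<le> r then 1 else 0)"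
        by (rule sum.cong) (use True in \<open>auto simp: indicator_def\<close>)
      also have "\<dots> = real (card {z\<in>Z. dist z x \<le> r})" by (subst sum.inter_filter[symmetric, OF Z(1)]) simp
      finally show ?thesis using Z(2)[of x] True by simp
    qed simp
  qed
  also have "\<dots> = real N * measure lborel A" by simp
  finally show ?thesis .
qed

section \<open>Distance to the boundary along straight paths\<close>

context evolving_C1_domain
begin

lemma flows_withD:
  assumes fl: "flows_with T v \<Omega>" and s: "s \<in> {0..T}" "y \<in> J s" and \<epsilon>: "\<epsilon> > 0"
  shows "\<exists>\<eta>>0. \<forall>s'\<in>{0..T}. \<bar>s' - s\<bar> < \<eta> \<longrightarrow> infdist (y + (s' - s) *\<^sub>R v y s) (J s') \<le> \<epsilon> * \<bar>s' - s\<bar>"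
proof -
  have "((\<lambda>h. infdist (y + h *\<^sub>R v y s) (frontier (\<Omega> (s + h))) / h) \<longlongrightarrow> 0) (at 0 within {h. s + h \<in> {0..T}})"
    using fl s unfolding flows_with_def by blast
  from tendstoD[OF this \<epsilon>] obtain \<eta> where \<eta>: "\<eta> > 0"
    "\<forall>h\<in>{h. s + h \<in> {0..T}}. h \<noteq> 0 \<and> dist h 0 < \<eta> \<longrightarrow> dist (infdist (y + h *\<^sub>R v y s) (frontier (\<Omega> (s + h))) / h) 0 < \<epsilon>"
    unfolding eventually_at by blast
  have "infdist (y + (s' - s) *\<^sub>R v y s) (J s') \<le> \<epsilon> * \<bar>s' - s\<bar>" if s': "s' \<in> {0..T}" "\<bar>s' - s\<bar> < \<eta>" for s'
  proof (cases "s' = s")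
    case True
    then show ?thesis using s(2) by simp
  next
    case False
    then have "dist (infdist (y + (s' - s) *\<^sub>R v y s) (J s') / (s' - s)) 0 < \<epsilon>"
      using \<eta>(2)[rule_format, of "s' - s"] s' by simp
    then have "infdist (y + (s' - s) *\<^sub>R v y s) (J s') / \<bar>s' - s\<bar> < \<epsilon>"
      by (simp add: dist_real_def abs_divide infdist_nonneg abs_of_nonneg)
    then show ?thesis using False by (simp add: pos_divide_less_eq)
  qed
  then show ?thesis using \<eta>(1) by blast
qed

lemma continuous_on_infdist_path:
  "continuous_on {0..T} (\<lambda>s. infdist (x + (s - t) *\<^sub>R w) (J s))"
  unfolding continuous_on_iff
proof (intro ballI allI impI)
  fix s e :: real assume s: "s \<in> {0..T}" and e: "e > 0"
  obtain \<tau> where \<tau>: "\<tau> > 0" "\<forall>s'\<in>{0..T}. \<bar>s' - s\<bar> < \<tau> \<longrightarrow> (\<forall>x. \<bar>infdist x (J s') - infdist x (J s)\<bar> < e / 2)"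
    using infdist_frontier_near[OF s, of "e / 2"] e by auto
  define d where "d = min \<tau> (e / (2 * (norm w + 1)))"
  have nw: "norm w + 1 > 0" by (simp add: add_nonneg_pos)
  show "\<exists>d>0. \<forall>s'\<in>{0..T}. dist s' s < d \<longrightarrow> dist (infdist (x + (s' - t) *\<^sub>R w) (J s')) (infdist (x + (s - t) *\<^sub>R w) (J s)) < e"
  proof (intro exI[of _ d] conjI ballI impI)
    show "d > 0" using \<tau>(1) e nw by (simp add: d_def)
    fix s' assume s': "s' \<in> {0..T}" "dist s' s < d"
    let ?x = "x + (s - t) *\<^sub>R w" and ?x' = "x + (s' - t) *\<^sub>R w"
    have "\<bar>infdist ?x' (J s') - infdist ?x' (J s)\<bar> < e / 2"
      using \<tau>(2) s' by (auto simp: d_def dist_real_def)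
    moreover have "\<bar>infdist ?x' (J s) - infdist ?x (J s)\<bar> \<le> dist ?x' ?x"
      by (rule infdist_triangle_abs)
    moreover have "dist ?x' ?x \<le> e / 2"
    proof -
      have "?x' - ?x = (s' - s) *\<^sub>R w" by (simp add: algebra_simps)
      then have "dist ?x' ?x = \<bar>s' - s\<bar> * norm w" by (simp add: dist_norm)
      also have "\<dots> \<le> \<bar>s' - s\<bar> * (norm w + 1)" by (intro mult_left_mono) auto
      also have "\<dots> \<le> e / 2"
      proof -
        have "\<bar>s' - s\<bar> \<le> e / 2 / (norm w + 1)" using s'(2) by (simp add: d_def dist_real_def)
        then show ?thesis using nw by (simp only: pos_le_divide_eq)
      qed
      finally show ?thesis .
    qed
    ultimately show "dist (infdist ?x' (J s')) (infdist ?x (J s)) < e"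
      unfolding dist_real_def by linarith
  qed
qed

text \<open>A nearest boundary point \<open>y\<close> moves with velocity \<open>v y s\<close>,
  which is within \<open>\<delta>\<close> of \<open>w\<close>, so in either time direction the
  distance grows at rate at most \<open>\<delta>\<close>, and \<open>dini_bound\<close> integrates
  this. The truncation at \<open>\<rho>\<close> is there because the velocity is controlled only
  within \<open>\<rho>\<close> of the path; where the distance exceeds \<open>\<rho>\<close> the
  truncated estimate is trivial.\<close>

lemma infdist_path_bound:
  assumes fl: "flows_with T v \<Omega>" and seg: "closed_segment t u \<subseteq> {0..T}" and \<delta>: "\<delta> \<ge> 0"
    and near: "\<And>s y. s \<in> closed_segment t u \<Longrightarrow> dist (x + (s - t) *\<^sub>R w) y \<le> \<rho> \<Longrightarrow> norm (v y s - w) \<le> \<delta>"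
  shows "min (infdist x (J t)) \<rho> \<le> min (infdist (x + (u - t) *\<^sub>R w) (J u)) \<rho> + \<delta> * \<bar>u - t\<bar>"
proof -
  define X where "X = (\<lambda>s. x + (s - t) *\<^sub>R w)"
  define f where "f = (\<lambda>s. infdist (X s) (J s))"
  have cf: "continuous_on (closed_segment t u) f"
    unfolding f_def X_def by (rule continuous_on_subset[OF continuous_on_infdist_path seg])
  have "min (f t) \<rho> \<le> min (f u) \<rho> + \<delta> * \<bar>u - t\<bar>"
  proof (rule dini_bound)
    show "continuous_on (closed_segment t u) (\<lambda>s. min (f s) \<rho>)" by (intro continuous_intros cf)
    fix s \<epsilon> :: real assume s: "s \<in> closed_segment t u" and \<epsilon>: "\<epsilon> > 0"
    have sT: "s \<in> {0..T}" using s seg by blast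
    show "\<exists>\<eta>>0. \<forall>s'\<in>closed_segment t u. \<bar>s' - s\<bar> < \<eta> \<longrightarrow> min (f s') \<rho> \<le> min (f s) \<rho> + (\<delta> + \<epsilon>) * \<bar>s' - s\<bar>"
    proof (cases "f s \<le> \<rho>")
      case False
      have "min (f s') \<rho> \<le> min (f s) \<rho> + (\<delta> + \<epsilon>) * \<bar>s' - s\<bar>" for s'
      proof -
        have "0 \<le> (\<delta> + \<epsilon>) * \<bar>s' - s\<bar>" using \<delta> \<epsilon> by (intro mult_nonneg_nonneg) auto
        then show ?thesis using False by linarith
      qed
      then show ?thesis using zero_less_one by blast
    next
      case True
      obtain y where y: "y \<in> J s" "f s = dist (X s) y"
        using infdist_attains_inf[OF frontier_closed domain_facts(7)[OF sT], of "X s"] unfolding f_def by blast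
      have vw: "norm (v y s - w) \<le> \<delta>" using near[OF s] y True by (simp add: X_def)
      obtain \<eta> where \<eta>: "\<eta> > 0" "\<forall>s'\<in>{0..T}. \<bar>s' - s\<bar> < \<eta> \<longrightarrow> infdist (y + (s' - s) *\<^sub>R v y s) (J s') \<le> \<epsilon> * \<bar>s' - s\<bar>"
        using flows_withD[OF fl sT y(1) \<epsilon>] by blast
      have "min (f s') \<rho> \<le> min (f s) \<rho> + (\<delta> + \<epsilon>) * \<bar>s' - s\<bar>" if s': "s' \<in> closed_segment t u" "\<bar>s' - s\<bar> < \<eta>" for s'
      proof -
        let ?y = "y + (s' - s) *\<^sub>R v y s"
        have "f s' \<le> infdist ?y (J s') + dist (X s') ?y" unfolding f_def by (rule infdist_triangle)
        moreover have "infdist ?y (J s') \<le> \<epsilon> * \<bar>s' - s\<bar>" using \<eta>(2) s' seg by blast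
        moreover have "dist (X s') ?y \<le> f s + \<delta> * \<bar>s' - s\<bar>"
        proof -
          have "X s' - ?y = (X s - y) - (s' - s) *\<^sub>R (v y s - w)" by (simp add: X_def algebra_simps)
          then have "dist (X s') ?y \<le> norm (X s - y) + norm ((s' - s) *\<^sub>R (v y s - w))"
            unfolding dist_norm by (metis norm_triangle_ineq4)
          also have "norm ((s' - s) *\<^sub>R (v y s - w)) \<le> \<delta> * \<bar>s' - s\<bar>"
            using mult_left_mono[OF vw, of "\<bar>s' - s\<bar>"] by (simp add: mult.commute)
          finally show ?thesis using y(2) by (simp add: dist_norm)
        qed
        ultimately have "f s' \<le> f s + (\<delta> + \<epsilon>) * \<bar>s' - s\<bar>" by (simp add: distrib_right)
        then show ?thesis using True by linarith
      qed
      then show ?thesis using \<eta>(1) by blast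
    qed
  qed
  then show ?thesis by (simp add: f_def X_def)
qed

text \<open>Away from the boundary, membership is locally constant in space and, by stability, in
  time; the segment of times is connected.\<close>

lemma membership_path:
  assumes seg: "closed_segment t u \<subseteq> {0..T}" and st: "\<And>s. s \<in> closed_segment t u \<Longrightarrow> stable s"
    and miss: "\<And>s. s \<in> closed_segment t u \<Longrightarrow> x + (s - t) *\<^sub>R w \<notin> J s"
  shows "x \<in> \<Omega> t \<longleftrightarrow> x + (u - t) *\<^sub>R w \<in> \<Omega> u"
proof -
  define X where "X = (\<lambda>s. x + (s - t) *\<^sub>R w)"
  have "(X t \<in> \<Omega> t) = (X u \<in> \<Omega> u)"
  proof (rule connected_local_const[of "closed_segment t u" t u "\<lambda>s. X s \<in> \<Omega> s"])
    show "\<forall>s\<in>closed_segment t u. \<forall>\<^sub>F s' in at s within closed_segment t u. (X s \<in> \<Omega> s) = (X s' \<in> \<Omega> s')"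
    proof
      fix s assume s: "s \<in> closed_segment t u"
      then have sT: "s \<in> {0..T}" using seg by blast
      have "X s \<in> - J s" using miss[OF s] by (simp add: X_def)
      then obtain d where d: "d > 0" "cball (X s) d \<subseteq> - J s"
        using open_contains_cball[of "- J s"] by (auto simp: open_Compl)
      have "cball (X s) d \<inter> J s = {}" using d(2) by blast
      from stable_ball[OF sT st[OF s] this] d(1) obtain \<tau> where \<tau>: "\<tau> > 0"
        "\<forall>s'\<in>{0..T}. \<bar>s' - s\<bar> < \<tau> \<longrightarrow> (\<forall>y\<in>cball (X s) d. y \<notin> J s' \<and> (y \<in> \<Omega> s' \<longleftrightarrow> X s \<in> \<Omega> s))" by auto
      have nw: "norm w + 1 > 0" by (simp add: add_nonneg_pos)
      show "\<forall>\<^sub>F s' in at s within closed_segment t u. (X s \<in> \<Omega> s) = (X s' \<in> \<Omega> s')"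
        unfolding eventually_at
      proof (intro exI[of _ "min \<tau> (d / (norm w + 1))"] conjI ballI impI)
        show "0 < min \<tau> (d / (norm w + 1))" using \<tau>(1) d(1) nw by simp
        fix s' assume s': "s' \<in> closed_segment t u" "s' \<noteq> s \<and> dist s' s < min \<tau> (d / (norm w + 1))"
        have "\<bar>s' - s\<bar> * (norm w + 1) < d" using s'(2) nw by (simp add: dist_real_def pos_less_divide_eq)
        moreover have "\<bar>s' - s\<bar> * norm w \<le> \<bar>s' - s\<bar> * (norm w + 1)" by (intro mult_left_mono) auto
        moreover have "X s - X s' = (s - s') *\<^sub>R w" by (simp add: X_def algebra_simps)
        then have "dist (X s) (X s') = \<bar>s' - s\<bar> * norm w" by (simp add: dist_norm abs_minus_commute)
        ultimately have "X s' \<in> cball (X s) d" by simp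
        then show "(X s \<in> \<Omega> s) = (X s' \<in> \<Omega> s')" using \<tau>(2) s' seg by (auto simp: dist_real_def)
      qed
    qed
  qed auto
  then show ?thesis by (simp add: X_def)
qed

end

section \<open>Contributions of single patches\<close>

lemma gradient_zero_outside_closed:
  assumes "closed A" "\<And>x. q x \<noteq> 0 \<Longrightarrow> x \<in> A" "x \<notin> A"
  shows "gradient q x = 0"
proof (rule gradient_zero_outside_support)
  have "support q \<subseteq> A" unfolding support_def by (rule closure_minimal) (use assms in auto)
  then show "x \<notin> support q" using assms(3) by blast
qed

context evolving_C1_domain
begin

lemmas velocity_slice = continuous_on_space_slice[OF continuous_velocity]

definition advection :: "(real^2 \<Rightarrow> real) \<Rightarrow> real \<Rightarrow> real" where
  "advection q t = dint (\<Omega> t) (\<lambda>x. v x t \<bullet> gradient q x)"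

lemma continuous_advection_integrand:
  "smooth q \<Longrightarrow> t \<in> {0..T} \<Longrightarrow> continuous_on UNIV (\<lambda>x. v x t \<bullet> gradient q x)"
  by (intro continuous_intros velocity_slice continuous_on_gradient)

text \<open>A ball away from the boundary stays wholly inside or wholly outside for nearby times. So
  the integral of \<open>q\<close> does not change at all, and the advection is either 0 or the
  integral of \<open>v x t \<bullet> gradient q x\<close> over the whole plane, which vanishes for a
  divergence-free field.\<close>

lemma interior_patch:
  assumes div: "divergence_free (\<lambda>x. v x t)" and t: "t \<in> {0..T}" and st: "stable t"
    and q: "smooth q" "\<And>x. q x \<noteq> 0 \<Longrightarrow> dist z x \<le> r" and r: "r \<ge> 0" and z: "cball z r \<inter> J t = {}"
  shows "\<exists>\<tau>>0. \<forall>s\<in>{0..T}. \<bar>s - t\<bar> < \<tau> \<longrightarrow> dint (\<Omega> s) q - dint (\<Omega> t) q - (s - t) * advection q t = 0"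
proof -
  obtain \<tau> where \<tau>: "\<tau> > 0" "\<forall>s\<in>{0..T}. \<bar>s - t\<bar> < \<tau> \<longrightarrow> (\<forall>y\<in>cball z r. y \<notin> J s \<and> (y \<in> \<Omega> s \<longleftrightarrow> z \<in> \<Omega> t))"
    using stable_ball[OF t st z r] by blast
  have q0: "q x = 0" if "x \<notin> cball z r" for x using q(2)[of x] that by auto
  have g0: "gradient q x = 0" if "x \<notin> cball z r" for x
    by (rule gradient_zero_outside_closed[OF _ _ that]) (use q(2) in auto)
  have "bounded {x. q x \<noteq> 0}" by (rule bounded_subset[OF bounded_cball[of z r]]) (use q(2) in auto)
  then have cs: "compact (support q)" by (simp add: compact_support_iff)
  have zero: "(LINT x|lborel. v x t \<bullet> gradient q x) = 0"
    using div q(1) cs unfolding divergence_free_def by blast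
  have eq: "dint (\<Omega> s) q = of_bool (z \<in> \<Omega> t) * (LINT x|lborel. q x)" if "s \<in> {0..T}" "\<bar>s - t\<bar> < \<tau>" for s
  proof -
    have "indicator (\<Omega> s) x * q x = of_bool (z \<in> \<Omega> t) * q x" for x
      using \<tau>(2)[rule_format, OF that, of x] q0[of x] by (cases "x \<in> cball z r") (auto simp: indicator_def)
    then have "(\<lambda>x. indicator (\<Omega> s) x * q x) = (\<lambda>x. of_bool (z \<in> \<Omega> t) * q x)" by (rule ext)
    then show ?thesis unfolding dint_def by (simp only: integral_mult_right_zero)
  qed
  have "indicator (\<Omega> t) x * (v x t \<bullet> gradient q x) = of_bool (z \<in> \<Omega> t) * (v x t \<bullet> gradient q x)" for x
    using \<tau>(2)[rule_format, OF t, of x] \<tau>(1) g0[of x] by (cases "x \<in> cball z r") (auto simp: indicator_def)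
  then have "(\<lambda>x. indicator (\<Omega> t) x * (v x t \<bullet> gradient q x)) = (\<lambda>x. of_bool (z \<in> \<Omega> t) * (v x t \<bullet> gradient q x))" by (rule ext)
  then have "advection q t = of_bool (z \<in> \<Omega> t) * (LINT x|lborel. v x t \<bullet> gradient q x)"
    unfolding advection_def dint_def by (simp only: integral_mult_right_zero)
  then have "advection q t = 0" by (simp add: zero)
  then show ?thesis using eq eq[OF t] \<tau>(1) by (intro exI[of _ \<tau>]) auto
qed

text \<open>With \<open>w = v z t\<close> three errors add up. Replacing \<open>\<Omega> s\<close>
  by the translate of \<open>\<Omega> t\<close> along \<open>h w\<close> costs at most
  \<open>C\<close> times the area near the boundary. Linearizing \<open>q\<close> costs
  \<open>\<bar>h\<bar> * \<delta> * \<rho>\<close>. Replacing \<open>w\<close> by \<open>v\<close>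
  in the linear term costs \<open>\<delta> * C / \<rho>\<close> on a disc of radius
  \<open>2 * \<rho>\<close>, which is the term with 16.\<close>

lemma boundary_patch:
  assumes fl: "flows_with T v \<Omega>" and ab: "{a..b} \<subseteq> {0..T}" and st: "\<And>s. s \<in> {a..b} \<Longrightarrow> stable s" and t: "t \<in> {a..b}"
    and q: "smooth q" "\<And>x. q x \<noteq> 0 \<Longrightarrow> dist z x \<le> 2 * \<rho>" "\<And>x. \<bar>q x\<bar> \<le> C" "\<And>x. norm (gradient q x) \<le> C / \<rho>"
    and pos: "\<rho> > 0" "\<delta> > 0" "\<tau>0 > 0"
    and near: "\<And>y s. s \<in> {0..T} \<Longrightarrow> \<bar>s - t\<bar> < \<tau>0 \<Longrightarrow> dist z y \<le> 5 * \<rho> \<Longrightarrow> norm (v y s - v z t) \<le> \<delta>"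
  shows "\<exists>\<tau>>0. \<forall>s\<in>{a..b}. \<bar>s - t\<bar> < \<tau> \<longrightarrow>
    \<bar>dint (\<Omega> s) q - dint (\<Omega> t) q - (s - t) * advection q t\<bar> \<le>
      C * measure lborel ({x. infdist x (J t) \<le> 2 * \<delta> * \<bar>s - t\<bar>} \<inter> cball z (3 * \<rho>)) +
      \<bar>s - t\<bar> * \<delta> * \<rho> * (1 + 16 * C * measure lborel (ball (0::real^2) 1))"
proof -
  let ?V = "measure lborel (ball (0::real^2) 1)"
  define w where "w = v z t"
  have tT: "t \<in> {0..T}" using t ab by blast
  have C0: "C \<ge> 0" using q(3)[of z] by linarith
  obtain R where R: "R > 0" and inR: "\<And>x s. x \<in> \<Omega> s \<Longrightarrow> s \<in> {0..T} \<Longrightarrow> x \<in> cball 0 R"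
    using uniformly_bounded_cball by blast
  define m where "m = measure lborel (cball (0::real^2) R)"
  have m0: "m \<ge> 0" by (simp add: m_def)
  have nw: "norm w + 1 > 0" by (simp add: add_nonneg_pos)
  \<comment> \<open>Taylor accuracy: integrated over a ball of area \<open>m\<close>, the error
    \<open>\<epsilon> * \<bar>h\<bar> * norm w\<close> must not exceed
    \<open>\<bar>h\<bar> * \<delta> * \<rho>\<close>. The added ones avoid division by zero.\<close>
  define \<epsilon> where "\<epsilon> = \<delta> * \<rho> / ((norm w + 1) * (m + 1))"
  have \<epsilon>: "\<epsilon> > 0" using pos nw m0 by (simp add: \<epsilon>_def)
  have \<epsilon>2: "\<epsilon> * norm w * m \<le> \<delta> * \<rho>"
  proof -
    have "norm w * m \<le> (norm w + 1) * (m + 1)" using m0 by (intro mult_mono) auto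
    then have "\<epsilon> * (norm w * m) \<le> \<epsilon> * ((norm w + 1) * (m + 1))" using \<epsilon> by (intro mult_left_mono) auto
    also have "\<dots> = \<delta> * \<rho>" using nw m0 by (simp add: \<epsilon>_def)
    finally show ?thesis by (simp add: mult.assoc)
  qed
  obtain d where d: "d > 0" "\<And>x k. x \<in> cball 0 R \<Longrightarrow> norm k < d \<Longrightarrow> \<bar>q (x + k) - q x - gradient q x \<bullet> k\<bar> \<le> \<epsilon> * norm k"
    using smooth_uniform_taylor[OF q(1) \<epsilon>, of R] by blast
  \<comment> \<open>In turn: \<open>near\<close> is applicable,
    \<open>\<delta> * \<bar>h\<bar>\<close> stays below the truncation level \<open>\<rho>\<close>,
    and the shift \<open>h w\<close> is shorter than the Taylor radius \<open>d\<close> and than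
    \<open>\<rho>\<close>.\<close>
  define \<tau> where "\<tau> = min (min \<tau>0 (\<rho> / \<delta>)) (min d \<rho> / (norm w + 1))"
  have \<tau>: "\<tau> > 0" using pos d nw by (simp add: \<tau>_def)
  have "\<bar>dint (\<Omega> s) q - dint (\<Omega> t) q - (s - t) * advection q t\<bar> \<le>
      C * measure lborel ({x. infdist x (J t) \<le> 2 * \<delta> * \<bar>s - t\<bar>} \<inter> cball z (3 * \<rho>)) +
      \<bar>s - t\<bar> * \<delta> * \<rho> * (1 + 16 * C * ?V)" if s: "s \<in> {a..b}" "\<bar>s - t\<bar> < \<tau>" for s
  proof -
    have sT: "s \<in> {0..T}" using s ab by blast
    define h where "h = s - t"
    have h: "\<bar>h\<bar> < \<tau>0" "\<delta> * \<bar>h\<bar> < \<rho>" "\<bar>h\<bar> * norm w < d" "\<bar>h\<bar> * norm w \<le> \<rho>"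
    proof -
      show "\<bar>h\<bar> < \<tau>0" using s(2) by (simp add: \<tau>_def h_def)
      have "\<bar>h\<bar> < \<rho> / \<delta>" using s(2) by (simp add: \<tau>_def h_def)
      then show "\<delta> * \<bar>h\<bar> < \<rho>" using pos by (simp add: pos_less_divide_eq mult.commute)
      have "\<bar>h\<bar> * (norm w + 1) < min d \<rho>" using s(2) nw by (simp add: \<tau>_def h_def pos_less_divide_eq)
      moreover have "\<bar>h\<bar> * norm w \<le> \<bar>h\<bar> * (norm w + 1)" by (intro mult_left_mono) auto
      ultimately show "\<bar>h\<bar> * norm w < d" "\<bar>h\<bar> * norm w \<le> \<rho>" by auto
    qed
    have seg: "closed_segment t s \<subseteq> {a..b}" using t s by (intro closed_segment_subset) auto
    have segh: "\<bar>s' - t\<bar> \<le> \<bar>h\<bar>" if "s' \<in> closed_segment t s" for s'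
      using that by (auto simp: h_def closed_segment_eq_real_ivl split: if_splits)
    let ?N = "{x. infdist x (J t) \<le> 2 * \<delta> * \<bar>h\<bar>} \<inter> cball z (3 * \<rho>)"
    have "compact ?N" by (intro closed_Int_compact closed_Collect_le continuous_intros compact_cball)
    then have N: "?N \<in> fmeasurable lborel" by (rule fmeasurable_compact)
    have cq: "continuous_on UNIV q" by (rule smooth_continuous_on[OF q(1)])
    have cqh: "continuous_on UNIV (\<lambda>x. q (x + h *\<^sub>R w))"
      by (intro continuous_on_compose2[OF cq] continuous_intros) auto
    have cg: "continuous_on UNIV (\<lambda>x. gradient q x \<bullet> u)" for u
      by (intro continuous_intros continuous_on_gradient q)
    \<comment> \<open>If the path met the boundary, \<open>infdist_path_bound\<close> would give
      \<open>min (infdist x (J t)) \<rho> \<le> \<delta> * \<bar>h\<bar>\<close>. The radius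
      \<open>5 * \<rho>\<close> in \<open>near\<close> is made of \<open>3 * \<rho>\<close> for
      \<open>x\<close>, one \<open>\<rho>\<close> for the shift along the path and one for a point
      near the path.\<close>
    have agree: "x \<in> \<Omega> t \<longleftrightarrow> x + h *\<^sub>R w \<in> \<Omega> s" if x: "dist z x \<le> 3 * \<rho>" "infdist x (J t) > 2 * \<delta> * \<bar>h\<bar>" for x
    proof -
      have miss: "x + (s' - t) *\<^sub>R w \<notin> J s'" if s': "s' \<in> closed_segment t s" for s'
      proof
        assume bad: "x + (s' - t) *\<^sub>R w \<in> J s'"
        have sub: "closed_segment t s' \<subseteq> closed_segment t s" using s' by (simp add: subset_closed_segment)
        have "min (infdist x (J t)) \<rho> \<le> min (infdist (x + (s' - t) *\<^sub>R w) (J s')) \<rho> + \<delta> * \<bar>s' - t\<bar>"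
        proof (rule infdist_path_bound[OF fl])
          show "closed_segment t s' \<subseteq> {0..T}" using sub seg ab by blast
          fix r y assume r: "r \<in> closed_segment t s'" and y: "dist (x + (r - t) *\<^sub>R w) y \<le> \<rho>"
          have rs: "r \<in> closed_segment t s" using r sub by blast
          have "dist x (x + (r - t) *\<^sub>R w) = \<bar>r - t\<bar> * norm w" by (simp add: dist_norm)
          also have "\<dots> \<le> \<bar>h\<bar> * norm w" using segh[OF rs] by (intro mult_right_mono) auto
          finally have "dist x (x + (r - t) *\<^sub>R w) \<le> \<rho>" using h by linarith
          then have "dist z y \<le> 5 * \<rho>"
            using x(1) y dist_triangle[of z y x] dist_triangle[of x y "x + (r - t) *\<^sub>R w"] by linarith
          then show "norm (v y r - w) \<le> \<delta>"
            unfolding w_def using near[of r y] rs seg ab segh[OF rs] h(1) by force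
        qed (use pos in simp)
        also have "min (infdist (x + (s' - t) *\<^sub>R w) (J s')) \<rho> = 0" using bad pos by simp
        also have "\<delta> * \<bar>s' - t\<bar> \<le> \<delta> * \<bar>h\<bar>" using segh[OF s'] pos by (intro mult_left_mono) auto
        finally have le: "min (infdist x (J t)) \<rho> \<le> \<delta> * \<bar>h\<bar>" by simp
        have "0 \<le> \<delta> * \<bar>h\<bar>" using pos by simp
        then have "infdist x (J t) > \<delta> * \<bar>h\<bar>" using x(2) by simp
        with le h(2) show False by simp
      qed
      have "x \<in> \<Omega> t \<longleftrightarrow> x + (s - t) *\<^sub>R w \<in> \<Omega> s"
        by (rule membership_path[OF _ _ miss]) (use seg ab st in blast)+
      then show ?thesis by (simp add: h_def)
    qed
    \<comment> \<open>After translation by \<open>h w\<close> the integrand lives where the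
      membership of \<open>x\<close> at time \<open>t\<close> and that of \<open>x + h w\<close> at
      time \<open>s\<close> disagree, that is, close to the boundary.\<close>
    let ?E = "\<lambda>x. (indicator (\<Omega> s) (h *\<^sub>R w + x) - indicator (\<Omega> t) x) * q (h *\<^sub>R w + x)"
    have i1: "integrable lborel (\<lambda>y. indicator (\<Omega> s) y * q y)" by (rule integrable_dint[OF domain_facts(1,4)[OF sT] cq])
    have mb: "(\<lambda>y. indicator (\<Omega> s) y * q y) \<in> borel_measurable borel"
      using borel_measurable_integrable[OF i1] by simp
    have i1': "integrable lborel (\<lambda>x. indicator (\<Omega> s) (h *\<^sub>R w + x) * q (h *\<^sub>R w + x))"
    proof -
      have "integrable (distr lborel borel ((+) (h *\<^sub>R w))) (\<lambda>y. indicator (\<Omega> s) y * q y)"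
        using i1 by (simp add: lborel_distr_plus)
      then show ?thesis by (subst (asm) integrable_distr_eq) (use mb in auto)
    qed
    have i2: "integrable lborel (\<lambda>x. indicator (\<Omega> t) x * q (x + h *\<^sub>R w))"
      by (rule integrable_dint[OF domain_facts(1,4)[OF tT] cqh])
    have E: "?E = (\<lambda>x. indicator (\<Omega> s) (h *\<^sub>R w + x) * q (h *\<^sub>R w + x) - indicator (\<Omega> t) x * q (x + h *\<^sub>R w))"
      by (auto simp: algebra_simps)
    have A: "\<bar>dint (\<Omega> s) q - dint (\<Omega> t) (\<lambda>x. q (x + h *\<^sub>R w))\<bar> \<le> C * measure lborel ?N"
    proof -
      have "dint (\<Omega> s) q = (LINT x|lborel. indicator (\<Omega> s) (h *\<^sub>R w + x) * q (h *\<^sub>R w + x))"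
        unfolding dint_def by (rule lborel_integral_translate[OF mb, symmetric])
      then have "dint (\<Omega> s) q - dint (\<Omega> t) (\<lambda>x. q (x + h *\<^sub>R w)) = (LINT x|lborel. ?E x)"
        unfolding E dint_def by (simp add: Bochner_Integration.integral_diff[OF i1' i2])
      moreover have "\<bar>LINT x|lborel. ?E x\<bar> \<le> C * measure lborel ?N"
      proof (rule abs_lborel_integral_le[OF _ N])
        show "integrable lborel ?E" unfolding E by (rule Bochner_Integration.integrable_diff[OF i1' i2])
        show "\<bar>?E x\<bar> \<le> C" for x
        proof -
          have "\<bar>?E x\<bar> \<le> 1 * \<bar>q (h *\<^sub>R w + x)\<bar>"
            unfolding abs_mult by (intro mult_right_mono) (auto simp: indicator_def)
          then show ?thesis using q(3)[of "h *\<^sub>R w + x"] by simp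
        qed
        show "?E x = 0" if x: "x \<notin> ?N" for x
        proof (cases "q (h *\<^sub>R w + x) = 0")
          case False
          then have "dist z (h *\<^sub>R w + x) \<le> 2 * \<rho>" by (rule q(2))
          moreover have "dist (h *\<^sub>R w + x) x = \<bar>h\<bar> * norm w" by (simp add: dist_norm)
          ultimately have zx: "dist z x \<le> 3 * \<rho>" using dist_triangle[of z x "h *\<^sub>R w + x"] h(4) by linarith
          then have "infdist x (J t) > 2 * \<delta> * \<bar>h\<bar>" using x by auto
          from agree[OF zx this] show ?thesis by (simp add: indicator_def add.commute)
        qed simp
      qed
      ultimately show ?thesis by simp
    qed
    have B: "\<bar>dint (\<Omega> t) (\<lambda>x. q (x + h *\<^sub>R w)) - dint (\<Omega> t) q - h * dint (\<Omega> t) (\<lambda>x. gradient q x \<bullet> w)\<bar> \<le> \<bar>h\<bar> * (\<delta> * \<rho>)"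
    proof -
      have ch: "continuous_on UNIV (\<lambda>x. h * (gradient q x \<bullet> w))" by (intro continuous_on_mult continuous_on_const cg)
      have "dint (\<Omega> t) (\<lambda>x. q (x + h *\<^sub>R w) - q x - h * (gradient q x \<bullet> w)) =
        dint (\<Omega> t) (\<lambda>x. q (x + h *\<^sub>R w)) - dint (\<Omega> t) q - h * dint (\<Omega> t) (\<lambda>x. gradient q x \<bullet> w)"
        by (simp only: dint_diff[OF domain_facts(1,4)[OF tT] continuous_on_diff[OF cqh cq] ch] dint_diff[OF domain_facts(1,4)[OF tT] cqh cq] dint_cmult)
      moreover have "\<bar>dint (\<Omega> t) (\<lambda>x. q (x + h *\<^sub>R w) - q x - h * (gradient q x \<bullet> w))\<bar> \<le> (\<epsilon> * (\<bar>h\<bar> * norm w)) * m"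
        unfolding m_def
      proof (rule abs_dint_le[OF domain_facts(1,4)[OF tT]])
        show "continuous_on UNIV (\<lambda>x. q (x + h *\<^sub>R w) - q x - h * (gradient q x \<bullet> w))"
          by (intro continuous_on_diff cqh cq ch)
        show "\<bar>q (x + h *\<^sub>R w) - q x - h * (gradient q x \<bullet> w)\<bar> \<le> \<epsilon> * (\<bar>h\<bar> * norm w)" if "x \<in> \<Omega> t" for x
          using d(2)[OF inR[OF that tT], of "h *\<^sub>R w"] h(3) by simp
        show "q (x + h *\<^sub>R w) - q x - h * (gradient q x \<bullet> w) = 0" if "x \<in> \<Omega> t" "x \<notin> cball 0 R" for x
          using inR[OF that(1) tT] that(2) by blast
      qed (use \<epsilon> in \<open>auto intro!: fmeasurable_compact\<close>)
      moreover have "(\<epsilon> * (\<bar>h\<bar> * norm w)) * m \<le> \<bar>h\<bar> * (\<delta> * \<rho>)"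
        using mult_left_mono[OF \<epsilon>2, of "\<bar>h\<bar>"] by (simp add: mult_ac)
      ultimately show ?thesis by simp
    qed
    have D: "\<bar>dint (\<Omega> t) (\<lambda>x. gradient q x \<bullet> w) - advection q t\<bar> \<le> \<delta> * (C / \<rho>) * (4 * (2 * \<rho>)\<^sup>2 * ?V)"
    proof -
      have "dint (\<Omega> t) (\<lambda>x. gradient q x \<bullet> w) - advection q t = dint (\<Omega> t) (\<lambda>x. gradient q x \<bullet> w - v x t \<bullet> gradient q x)"
        unfolding advection_def
        by (rule dint_diff[symmetric, OF domain_facts(1,4)[OF tT] cg continuous_advection_integrand[OF q(1) tT]])
      also have "\<bar>\<dots>\<bar> \<le> \<delta> * (C / \<rho>) * measure lborel (cball z (2 * \<rho>))"
      proof (rule abs_dint_le[OF domain_facts(1,4)[OF tT]])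
        show "continuous_on UNIV (\<lambda>x. gradient q x \<bullet> w - v x t \<bullet> gradient q x)"
          by (intro continuous_on_diff cg continuous_advection_integrand q tT)
        show "\<bar>gradient q x \<bullet> w - v x t \<bullet> gradient q x\<bar> \<le> \<delta> * (C / \<rho>)" if "x \<in> cball z (2 * \<rho>)" for x
        proof -
          have "gradient q x \<bullet> w - v x t \<bullet> gradient q x = - ((v x t - w) \<bullet> gradient q x)"
            by (simp add: inner_diff_left inner_diff_right inner_commute)
          then have "\<bar>gradient q x \<bullet> w - v x t \<bullet> gradient q x\<bar> \<le> norm (v x t - w) * norm (gradient q x)"
            using Cauchy_Schwarz_ineq2[of "v x t - w" "gradient q x"] by simp
          also have "\<dots> \<le> \<delta> * (C / \<rho>)"
            using near[OF tT, of x] that pos q(4)[of x] by (intro mult_mono) (auto simp: w_def)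
          finally show ?thesis .
        qed
        show "gradient q x \<bullet> w - v x t \<bullet> gradient q x = 0" if "x \<notin> cball z (2 * \<rho>)" for x
          using gradient_zero_outside_closed[of "cball z (2 * \<rho>)" q x] q(2) that by auto
      qed (use C0 pos in \<open>auto intro!: fmeasurable_compact\<close>)
      also have "\<dots> \<le> \<delta> * (C / \<rho>) * (4 * (2 * \<rho>)\<^sup>2 * ?V)"
        using C0 pos by (intro mult_left_mono measure_cball_le) auto
      finally show ?thesis .
    qed
    have D': "\<bar>h * dint (\<Omega> t) (\<lambda>x. gradient q x \<bullet> w) - h * advection q t\<bar> \<le> \<bar>h\<bar> * (16 * \<delta> * C * \<rho> * ?V)"
    proof -
      have "\<bar>h * dint (\<Omega> t) (\<lambda>x. gradient q x \<bullet> w) - h * advection q t\<bar> = \<bar>h\<bar> * \<bar>dint (\<Omega> t) (\<lambda>x. gradient q x \<bullet> w) - advection q t\<bar>"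
        by (simp add: abs_mult[symmetric] right_diff_distrib)
      also have "\<dots> \<le> \<bar>h\<bar> * (\<delta> * (C / \<rho>) * (4 * (2 * \<rho>)\<^sup>2 * ?V))" by (intro mult_left_mono D) simp
      also have "\<delta> * (C / \<rho>) * (4 * (2 * \<rho>)\<^sup>2 * ?V) = 16 * \<delta> * C * \<rho> * ?V" using pos(1) by (simp add: power2_eq_square)
      finally show ?thesis .
    qed
    have "\<bar>dint (\<Omega> s) q - dint (\<Omega> t) q - h * advection q t\<bar> \<le> C * measure lborel ?N + \<bar>h\<bar> * (\<delta> * \<rho>) + \<bar>h\<bar> * (16 * \<delta> * C * \<rho> * ?V)"
      using A B D' by linarith
    also have "\<dots> = C * measure lborel ?N + \<bar>h\<bar> * \<delta> * \<rho> * (1 + 16 * C * ?V)" by (simp add: algebra_simps)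
    finally show ?thesis by (simp add: h_def)
  qed
  then show ?thesis using \<tau> by blast
qed

text \<open>The order of choice is \<open>\<delta>\<close>, then the patch size
  \<open>\<rho>\<close> from the continuity of \<open>v\<close>, and only then the time step, which
  may depend on all patches. The total error is bounded independently of \<open>\<rho>\<close>: the
  areas near the boundary are added with bounded overlap, and the remaining terms are proportional
  to \<open>\<rho>\<close> for each of the O(1/\<rho>) boundary patches.\<close>

lemma space_derivative:
  assumes fl: "flows_with T v \<Omega>" and div: "\<And>t. t \<in> {0..T} \<Longrightarrow> divergence_free (\<lambda>x. v x t)"
    and ab: "{a..b} \<subseteq> {0..T}" and st: "\<And>s. s \<in> {a..b} \<Longrightarrow> stable s" and t: "t \<in> {a..b}"
    and \<psi>: "smooth \<psi>" "compact (support \<psi>)" and e: "e > 0"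
  shows "\<exists>\<tau>>0. \<forall>s\<in>{a..b}. \<bar>s - t\<bar> < \<tau> \<longrightarrow> \<bar>dint (\<Omega> s) \<psi> - dint (\<Omega> t) \<psi> - (s - t) * advection \<psi> t\<bar> \<le> e * \<bar>s - t\<bar>"
proof -
  let ?V = "measure lborel (ball (0::real^2) 1)" and ?J = "J t"
  let ?N = "\<lambda>r. {x. infdist x ?J \<le> r}"
  have V: "?V > 0" by (rule content_ball_pos) simp
  have tT: "t \<in> {0..T}" using t ab by blast
  obtain C where C: "C > 0" and part: "\<And>\<rho>. 0 < \<rho> \<Longrightarrow> \<rho> \<le> 1 \<Longrightarrow> \<exists>Z q. patch_partition \<psi> C \<rho> Z q"
    using smooth_partition[OF \<psi>] by blast
  obtain Cm where Cm: "Cm > 0" "\<And>r. 0 < r \<Longrightarrow> r \<le> 1 \<Longrightarrow> measure lborel (?N r) \<le> Cm * r"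
    using frontier_neighbourhood_measure[OF bounded_domain_at[OF tT] C1_at[OF tT]] by blast
  \<comment> \<open>The coefficient of \<open>\<delta> * \<bar>s - t\<bar>\<close> in the final
    estimate: 98 is the overlap 49 times the 2 in \<open>2 * \<delta>\<close>, and
    \<open>147 * Cm / ?V\<close>, with 147 = 49 * 3, bounds \<open>\<rho>\<close> times the number
    of boundary patches.\<close>
  define K where "K = 98 * C * Cm + 147 * Cm / ?V * (1 + 16 * C * ?V)"
  have K: "K > 0" using C Cm V unfolding K_def by (intro add_pos_pos mult_pos_pos divide_pos_pos) auto
  define \<delta> where "\<delta> = e / K"
  have \<delta>: "\<delta> > 0" "K * \<delta> = e" using e K by (auto simp: \<delta>_def)
  obtain R where R: "R > 0" "\<And>s. s \<in> {0..T} \<Longrightarrow> closure (\<Omega> s) \<subseteq> ball 0 R" using uniformly_bounded by blast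
  have "uniformly_continuous_on (cball 0 (R + 3) \<times> {0..T}) (\<lambda>(x, t). v x t)"
    by (intro compact_uniformly_continuous continuous_on_subset[OF continuous_velocity] compact_Times) auto
  then obtain d where d: "d > 0" "\<And>p p'. p \<in> cball 0 (R + 3) \<times> {0..T} \<Longrightarrow> p' \<in> cball 0 (R + 3) \<times> {0..T} \<Longrightarrow> dist p' p < d \<Longrightarrow>
      dist (case p' of (x, t) \<Rightarrow> v x t) (case p of (x, t) \<Rightarrow> v x t) < \<delta>"
    using \<delta>(1) unfolding uniformly_continuous_on_def by metis
  \<comment> \<open>\<open>3 * \<rho> \<le> 1\<close> admits the area bound for the neighbourhood of
    radius \<open>3 * \<rho>\<close>; \<open>5 * \<rho> < d / 2\<close> leaves the other half of
    \<open>d\<close> for the time difference.\<close>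
  define \<rho> where "\<rho> = min (1 / 3) (d / 12)"
  have \<rho>: "\<rho> > 0" "3 * \<rho> \<le> 1" "5 * \<rho> < d / 2" "\<rho> \<le> 1" using d(1) by (auto simp: \<rho>_def)
  obtain Z q where Zq: "patch_partition \<psi> C \<rho> Z q" using part \<rho> by blast
  then have Z: "finite Z" by (simp add: patch_partition_def)
  have q: "smooth (q z)" "\<And>x. q z x \<noteq> 0 \<Longrightarrow> dist z x \<le> 2 * \<rho>" "\<And>x. \<bar>q z x\<bar> \<le> C" "\<And>x. norm (gradient (q z) x) \<le> C / \<rho>"
    if "z \<in> Z" for z using Zq that unfolding patch_partition_def by auto
  have sum: "\<psi> x = (\<Sum>z\<in>Z. q z x)" for x using Zq unfolding patch_partition_def by blast
  have card: "card {z\<in>Z. dist z p \<le> 3 * \<rho>} \<le> 49" for p using Zq unfolding patch_partition_def by blast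
  define D where "D = (\<lambda>s q. dint (\<Omega> s) q - dint (\<Omega> t) q - (s - t) * advection q t)"
  define Zb where "Zb = {z\<in>Z. cball z (2 * \<rho>) \<inter> ?J \<noteq> {}}"
  define bound where "bound = (\<lambda>s z. if z \<in> Zb then
      C * measure lborel ((?N (2 * \<delta> * \<bar>s - t\<bar>)) \<inter> cball z (3 * \<rho>)) + \<bar>s - t\<bar> * \<delta> * \<rho> * (1 + 16 * C * ?V) else 0)"
  have "\<exists>\<tau>>0. \<forall>s\<in>{a..b}. \<bar>s - t\<bar> < \<tau> \<longrightarrow> \<bar>D s (q z)\<bar> \<le> bound s z" if z: "z \<in> Z" for z
  proof (cases "z \<in> Zb")
    case True
    then obtain p where p: "p \<in> ?J" "dist z p \<le> 2 * \<rho>" unfolding Zb_def by auto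
    have "norm p < R" using p(1) R(2)[OF tT] closure_Un_frontier[of "\<Omega> t"] by (force simp: subset_eq)
    then have nz: "norm z \<le> R + 1"
      using p(2) \<rho>(2) norm_triangle_ineq2[of z p] \<rho>(1) by (simp add: dist_norm)
    have near: "norm (v y s - v z t) \<le> \<delta>" if "s \<in> {0..T}" "\<bar>s - t\<bar> < d / 2" "dist z y \<le> 5 * \<rho>" for y s
    proof -
      have "norm y \<le> R + 3" using nz that(3) norm_triangle_ineq2[of y z] \<rho>(2) by (simp add: dist_norm norm_minus_commute)
      moreover have "dist (y, s) (z, t) \<le> dist y z + \<bar>s - t\<bar>"
        using norm_Pair_le[of "y - z" "s - t"] by (simp add: dist_norm)
      then have "dist (y, s) (z, t) < d" using that \<rho>(3) by (simp add: dist_commute)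
      ultimately have "dist (v y s) (v z t) < \<delta>" using d(2)[of "(z, t)" "(y, s)"] that(1) tT nz by auto
      then show ?thesis by (simp add: dist_norm)
    qed
    have "\<exists>\<tau>>0. \<forall>s\<in>{a..b}. \<bar>s - t\<bar> < \<tau> \<longrightarrow>
      \<bar>dint (\<Omega> s) (q z) - dint (\<Omega> t) (q z) - (s - t) * advection (q z) t\<bar> \<le>
      C * measure lborel ((?N (2 * \<delta> * \<bar>s - t\<bar>)) \<inter> cball z (3 * \<rho>)) +
      \<bar>s - t\<bar> * \<delta> * \<rho> * (1 + 16 * C * ?V)"
      by (rule boundary_patch[OF fl ab st t q(1)[OF z] q(2)[OF z] q(3)[OF z] q(4)[OF z] \<rho>(1) \<delta>(1) half_gt_zero[OF d(1)] near])
    then show ?thesis using True by (simp add: D_def bound_def)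
  next
    case False
    then have "cball z (2 * \<rho>) \<inter> ?J = {}" using z by (simp add: Zb_def)
    from interior_patch[OF div[OF tT] tT st[OF t] q(1)[OF z] q(2)[OF z] _ this]
    obtain \<tau> where "\<tau> > 0" "\<forall>s\<in>{0..T}. \<bar>s - t\<bar> < \<tau> \<longrightarrow> D s (q z) = 0" using \<rho>(1) unfolding D_def by auto
    then show ?thesis using False ab by (intro exI[of _ \<tau>]) (auto simp: bound_def)
  qed
  then obtain \<tau> where \<tau>: "\<And>z. z \<in> Z \<Longrightarrow> \<tau> z > 0" "\<And>z s. z \<in> Z \<Longrightarrow> s \<in> {a..b} \<Longrightarrow> \<bar>s - t\<bar> < \<tau> z \<Longrightarrow> \<bar>D s (q z)\<bar> \<le> bound s z"
    by metis
  \<comment> \<open>The extra entry keeps \<open>2 * \<delta> * \<bar>s - t\<bar>\<close> at most 1,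
    where the area bound for neighbourhoods applies.\<close>
  define \<tau>' where "\<tau>' = Min (insert (1 / (2 * \<delta>)) (\<tau> ` Z))"
  have \<tau>': "\<tau>' > 0" "\<tau>' \<le> 1 / (2 * \<delta>)" "\<And>z. z \<in> Z \<Longrightarrow> \<tau>' \<le> \<tau> z"
    using Z \<tau>(1) \<delta>(1) by (auto simp: \<tau>'_def)
  have fm: "(?N r) \<in> fmeasurable lborel" if "r > 0" for r
    by (rule fmeasurable_compact[OF compact_infdist_le[OF domain_facts(7,6)[OF tT] that]])
  \<comment> \<open>About the centre of each boundary patch, the disc of radius
    \<open>\<rho>\<close> lies in the neighbourhood of radius \<open>3 * \<rho>\<close> of the
    curve. These discs overlap at most 49 times, and the neighbourhood has area at most
    \<open>3 * Cm * \<rho>\<close>.\<close>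
  have number: "real (card Zb) * \<rho> \<le> 147 * Cm / ?V"
  proof -
    have "real (card Zb) * (\<rho>\<^sup>2 * ?V) = (\<Sum>z\<in>Zb. measure lborel (ball z \<rho>))"
      using measure_ball_plane[of \<rho>] \<rho>(1) by simp
    also have "\<dots> \<le> (\<Sum>z\<in>Zb. measure lborel ((?N (3 * \<rho>)) \<inter> cball z (3 * \<rho>)))"
    proof (rule sum_mono, rule measure_mono_fmeasurable)
      fix z assume "z \<in> Zb"
      then obtain p where p: "p \<in> ?J" "dist z p \<le> 2 * \<rho>" unfolding Zb_def by auto
      have "infdist x ?J \<le> 3 * \<rho>" if "dist z x < \<rho>" for x
        using infdist_le[OF p(1), of x] dist_triangle[of x p z] p(2) that by (simp add: dist_commute)
      then show "ball z \<rho> \<subseteq> (?N (3 * \<rho>)) \<inter> cball z (3 * \<rho>)" using \<rho>(1) by auto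
      show "(?N (3 * \<rho>)) \<inter> cball z (3 * \<rho>) \<in> fmeasurable lborel"
        using \<rho>(1) by (intro fmeasurable.Int fm fmeasurable_compact compact_cball) auto
    qed auto
    also have "\<dots> \<le> (\<Sum>z\<in>Z. measure lborel ((?N (3 * \<rho>)) \<inter> cball z (3 * \<rho>)))"
      by (rule sum_mono2[OF Z]) (auto simp: Zb_def)
    also have "\<dots> \<le> real 49 * measure lborel (?N (3 * \<rho>))"
      by (rule sum_measure_overlap[OF Z card fm]) (use \<rho>(1) in simp)
    also have "\<dots> \<le> real 49 * (Cm * (3 * \<rho>))" using \<rho> by (intro mult_left_mono Cm(2)) auto
    finally have "(real (card Zb) * \<rho> * ?V) * \<rho> \<le> (147 * Cm) * \<rho>" by (simp add: power2_eq_square mult_ac)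
    then have "real (card Zb) * \<rho> * ?V \<le> 147 * Cm" by (rule mult_right_le_imp_le) (rule \<rho>(1))
    then show ?thesis using V by (simp only: pos_le_divide_eq)
  qed
  have linear: "D s \<psi> = (\<Sum>z\<in>Z. D s (q z))" if s: "s \<in> {0..T}" for s
  proof -
    have \<psi>eq: "\<psi> = (\<lambda>x. \<Sum>z\<in>Z. q z x)" using sum by auto
    have "gradient \<psi> x = (\<Sum>z\<in>Z. gradient (q z) x)" for x
    proof (rule gradient_eqI)
      show "(\<psi> has_derivative (\<lambda>w. \<Sum>z\<in>Z. gradient (q z) x \<bullet> w)) (at x)"
        unfolding \<psi>eq by (intro has_derivative_sum smooth_has_derivative_gradient q)
    qed (simp add: inner_sum_left)
    then have "advection \<psi> t = dint (\<Omega> t) (\<lambda>x. \<Sum>z\<in>Z. v x t \<bullet> gradient (q z) x)"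
      unfolding advection_def by (simp add: inner_sum_right)
    also have "\<dots> = (\<Sum>z\<in>Z. advection (q z) t)"
      unfolding advection_def by (rule dint_sum[OF domain_facts(1,4)[OF tT] continuous_advection_integrand[OF q(1) tT]])
    finally have "advection \<psi> t = (\<Sum>z\<in>Z. advection (q z) t)" .
    moreover have "dint (\<Omega> r) \<psi> = (\<Sum>z\<in>Z. dint (\<Omega> r) (q z))" if "r \<in> {0..T}" for r
      unfolding \<psi>eq by (rule dint_sum[OF domain_facts(1,4)[OF that] smooth_continuous_on[OF q(1)]])
    ultimately show ?thesis using s tT by (simp add: D_def sum_subtractf sum_distrib_left)
  qed
  have "\<bar>D s \<psi>\<bar> \<le> e * \<bar>s - t\<bar>" if s: "s \<in> {a..b}" "\<bar>s - t\<bar> < \<tau>'" for s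
  proof (cases "s = t")
    case True
    then show ?thesis by (simp add: D_def)
  next
    case False
    define h where "h = \<bar>s - t\<bar>"
    have h: "h > 0" "2 * \<delta> * h \<le> 1"
    proof -
      show "h > 0" using False by (simp add: h_def)
      have "h \<le> 1 / (2 * \<delta>)" using s(2) \<tau>'(2) by (simp add: h_def)
      then show "2 * \<delta> * h \<le> 1" using \<delta>(1) by (simp add: field_simps)
    qed
    have "\<bar>D s \<psi>\<bar> \<le> (\<Sum>z\<in>Z. \<bar>D s (q z)\<bar>)" using linear[of s] s ab by (auto intro: sum_abs)
    also have "\<dots> \<le> (\<Sum>z\<in>Z. bound s z)"
    proof (rule sum_mono)
      fix z assume z: "z \<in> Z"
      show "\<bar>D s (q z)\<bar> \<le> bound s z" using \<tau>(2)[OF z s(1)] \<tau>'(3)[OF z] s(2) by linarith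
    qed
    also have "\<dots> = (\<Sum>z\<in>Zb. C * measure lborel ((?N (2 * \<delta> * h)) \<inter> cball z (3 * \<rho>)) + h * \<delta> * \<rho> * (1 + 16 * C * ?V))"
      unfolding bound_def h_def by (subst sum.inter_restrict[symmetric, OF Z]) (auto simp: Zb_def intro: sum.cong)
    also have "\<dots> = C * (\<Sum>z\<in>Zb. measure lborel ((?N (2 * \<delta> * h)) \<inter> cball z (3 * \<rho>))) +
        (real (card Zb) * \<rho>) * (h * \<delta> * (1 + 16 * C * ?V))"
      by (simp add: sum.distrib sum_distrib_left)
    also have "\<dots> \<le> C * (real 49 * (Cm * (2 * \<delta> * h))) + 147 * Cm / ?V * (h * \<delta> * (1 + 16 * C * ?V))"
    proof (rule add_mono)
      have "(\<Sum>z\<in>Zb. measure lborel ((?N (2 * \<delta> * h)) \<inter> cball z (3 * \<rho>))) \<le>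
        (\<Sum>z\<in>Z. measure lborel ((?N (2 * \<delta> * h)) \<inter> cball z (3 * \<rho>)))"
        by (rule sum_mono2[OF Z]) (auto simp: Zb_def)
      also have "\<dots> \<le> real 49 * measure lborel (?N (2 * \<delta> * h))"
        by (rule sum_measure_overlap[OF Z card fm]) (use \<delta>(1) h(1) in simp)
      also have "\<dots> \<le> real 49 * (Cm * (2 * \<delta> * h))" using h \<delta>(1) by (intro mult_left_mono Cm(2)) auto
      finally show "C * (\<Sum>z\<in>Zb. measure lborel ((?N (2 * \<delta> * h)) \<inter> cball z (3 * \<rho>))) \<le> C * (real 49 * (Cm * (2 * \<delta> * h)))"
        using C by (intro mult_left_mono) auto
      show "(real (card Zb) * \<rho>) * (h * \<delta> * (1 + 16 * C * ?V)) \<le> 147 * Cm / ?V * (h * \<delta> * (1 + 16 * C * ?V))"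
        using h(1) \<delta>(1) C by (intro mult_right_mono number) auto
    qed
    also have "\<dots> = K * \<delta> * h"
    proof -
      have "C * (real 49 * (Cm * (2 * \<delta> * h))) + B * (h * \<delta> * G) = (98 * C * Cm + B * G) * \<delta> * h" for B G :: real
        by (simp add: algebra_simps)
      then show ?thesis unfolding K_def .
    qed
    finally show ?thesis by (simp add: \<delta>(2) h_def)
  qed
  then show ?thesis using \<tau>'(1) unfolding D_def by blast
qed


section \<open>Derivative of the mass for a flow\<close>

lemma flux_eq_time_plus_advection:
  assumes \<phi>: "smooth \<phi>" and t: "t \<in> {0..T}"
  shows "flux \<phi> t = dint (\<Omega> t) (\<lambda>x. frechet_derivative \<phi> (at (x, t)) (0, 1)) + advection (\<lambda>x. \<phi> (x, t)) t"
proof -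
  have eq: "transport \<phi> x t = frechet_derivative \<phi> (at (x, t)) (0, 1) + v x t \<bullet> gradient (\<lambda>x. \<phi> (x, t)) x" for x
    using transport_eq[OF \<phi>, of x t] by (simp add: time_derivative[OF \<phi>])
  have c: "continuous_on UNIV (\<lambda>x. frechet_derivative \<phi> (at (x, t)) (0, 1))"
    by (rule continuous_on_compose2[OF smooth_continuous_on_frechet[OF \<phi>, of UNIV]]) (auto intro!: continuous_intros)
  show ?thesis
    unfolding flux_def advection_def eq
    by (rule dint_add[OF domain_facts(1,4)[OF t] c continuous_advection_integrand[OF smooth_slice[OF \<phi>] t]])
qed

text \<open>The increment splits into a Taylor error in time on \<open>\<Omega> s\<close>, the
  change of the integral of the time derivative \<open>p\<close>, which is small by stability, and
  the increment for the slice \<open>\<psi>\<close> frozen at time \<open>t\<close>, which is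
  \<open>space_derivative\<close>. The interval \<open>{a..b}\<close> is general because the lemma
  is also applied on intervals of stable times before stability is known everywhere.\<close>

lemma flows_mass_derivative:
  assumes fl: "flows_with T v \<Omega>" and div: "\<And>t. t \<in> {0..T} \<Longrightarrow> divergence_free (\<lambda>x. v x t)"
    and ab: "{a..b} \<subseteq> {0..T}" and st: "\<And>s. s \<in> {a..b} \<Longrightarrow> stable s" and t: "t \<in> {a..b}"
    and \<phi>: "smooth \<phi>" "compact (support \<phi>)"
  shows "(mass \<phi> has_real_derivative flux \<phi> t) (at t within {a..b})"
proof -
  have tT: "t \<in> {0..T}" using t ab by blast
  obtain R where R: "R > 0" and inR: "\<And>x s. x \<in> \<Omega> s \<Longrightarrow> s \<in> {0..T} \<Longrightarrow> x \<in> cball 0 R"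
    using uniformly_bounded_cball by blast
  define m where "m = measure lborel (cball (0::real^2) R)"
  have m0: "m \<ge> 0" by (simp add: m_def)
  define \<psi> where "\<psi> = (\<lambda>x. \<phi> (x, t))"
  have \<psi>: "smooth \<psi>" unfolding \<psi>_def by (rule smooth_slice[OF \<phi>(1)])
  have "bounded {p. \<phi> p \<noteq> 0}" using \<phi>(2) by (simp add: compact_support_iff)
  then have "bounded (fst ` {p. \<phi> p \<noteq> 0})" by (rule bounded_fst)
  then have "bounded {x. \<psi> x \<noteq> 0}" by (rule bounded_subset) (force simp: \<psi>_def)
  then have cs: "compact (support \<psi>)" by (simp add: compact_support_iff)
  define p where "p = (\<lambda>x. frechet_derivative \<phi> (at (x, t)) (0, 1))"
  have cp: "continuous_on UNIV p"
    unfolding p_def by (rule continuous_on_compose2[OF smooth_continuous_on_frechet[OF \<phi>(1), of UNIV]]) (auto intro!: continuous_intros)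
  have c\<phi>: "continuous_on UNIV (\<lambda>x. \<phi> (x, s))" for s by (rule smooth_continuous_on[OF smooth_slice[OF \<phi>(1)]])
  have fx: "flux \<phi> t = dint (\<Omega> t) p + advection \<psi> t"
    unfolding p_def \<psi>_def by (rule flux_eq_time_plus_advection[OF \<phi>(1) tT])
  have "\<exists>\<tau>>0. \<forall>s\<in>{a..b}. \<bar>s - t\<bar> < \<tau> \<longrightarrow> \<bar>mass \<phi> s - mass \<phi> t - (s - t) * flux \<phi> t\<bar> \<le> e * \<bar>s - t\<bar>" if e: "e > 0" for e
  proof -
    define \<epsilon> where "\<epsilon> = e / (3 * (m + 1))"
    have \<epsilon>: "\<epsilon> > 0" "\<epsilon> * m \<le> e / 3"
    proof -
      show "\<epsilon> > 0" using e m0 by (simp add: \<epsilon>_def)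
      have "\<epsilon> * (m + 1) = e / 3" using m0 by (simp add: \<epsilon>_def field_simps)
      then show "\<epsilon> * m \<le> e / 3" using \<open>\<epsilon> > 0\<close> by (simp add: distrib_left)
    qed
    obtain d1 where d1: "d1 > 0" "\<forall>x\<in>cball 0 (R + \<bar>t\<bar>). \<forall>k. norm k < d1 \<longrightarrow> \<bar>\<phi> (x + k) - \<phi> x - gradient \<phi> x \<bullet> k\<bar> \<le> \<epsilon> * norm k"
      using smooth_uniform_taylor[OF \<phi>(1) \<epsilon>(1), of "R + \<bar>t\<bar>"] by blast
    have "continuous_on (UNIV \<times> {0..T}) (\<lambda>(x, s). p x)"
      unfolding case_prod_beta by (rule continuous_on_compose2[OF cp]) (auto intro!: continuous_intros)
    from stable_dint_tendsto[OF tT st[OF t] this]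
    have "((\<lambda>s. dint (\<Omega> s) p) \<longlongrightarrow> dint (\<Omega> t) p) (at t within {0..T})" .
    from tendstoD[OF this, of "e / 3"] obtain d2 where d2: "d2 > 0" "\<forall>s\<in>{0..T}. s \<noteq> t \<and> dist s t < d2 \<longrightarrow> dist (dint (\<Omega> s) p) (dint (\<Omega> t) p) < e / 3"
      using e unfolding eventually_at by auto
    obtain d3 where d3: "d3 > 0" "\<forall>s\<in>{a..b}. \<bar>s - t\<bar> < d3 \<longrightarrow> \<bar>dint (\<Omega> s) \<psi> - dint (\<Omega> t) \<psi> - (s - t) * advection \<psi> t\<bar> \<le> e / 3 * \<bar>s - t\<bar>"
      using space_derivative[OF fl div ab st t \<psi> cs, of "e / 3"] e by auto
    have "\<bar>mass \<phi> s - mass \<phi> t - (s - t) * flux \<phi> t\<bar> \<le> e * \<bar>s - t\<bar>" if s: "s \<in> {a..b}" "\<bar>s - t\<bar> < min d1 (min d2 d3)" for s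
    proof -
      have sT: "s \<in> {0..T}" using s ab by blast
      have A: "\<bar>dint (\<Omega> s) (\<lambda>x. \<phi> (x, s) - \<psi> x - (s - t) * p x)\<bar> \<le> e / 3 * \<bar>s - t\<bar>"
      proof -
        have "\<bar>dint (\<Omega> s) (\<lambda>x. \<phi> (x, s) - \<psi> x - (s - t) * p x)\<bar> \<le> (\<epsilon> * \<bar>s - t\<bar>) * m"
          unfolding m_def
        proof (rule abs_dint_le[OF domain_facts(1,4)[OF sT]])
          show "continuous_on UNIV (\<lambda>x. \<phi> (x, s) - \<psi> x - (s - t) * p x)"
            by (intro continuous_on_diff continuous_on_mult continuous_on_const cp c\<phi> smooth_continuous_on[OF \<psi>])
          show "\<bar>\<phi> (x, s) - \<psi> x - (s - t) * p x\<bar> \<le> \<epsilon> * \<bar>s - t\<bar>" if x: "x \<in> \<Omega> s" for x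
          proof -
            have "(x, t) \<in> cball 0 (R + \<bar>t\<bar>)" using inR[OF x sT] norm_Pair_le[of x t] by simp
            moreover have "norm (0::real^2, s - t) < d1" using s(2) by (simp add: norm_Pair)
            ultimately have "\<bar>\<phi> ((x, t) + (0, s - t)) - \<phi> (x, t) - gradient \<phi> (x, t) \<bullet> (0, s - t)\<bar> \<le> \<epsilon> * norm (0::real^2, s - t)"
              using d1(2) by blast
            moreover have "gradient \<phi> (x, t) \<bullet> (0, s - t) = (s - t) * p x"
            proof -
              have e01: "(0::real^2, s - t) = (s - t) *\<^sub>R (0, 1)" by simp
              have "gradient \<phi> (x, t) \<bullet> (0, s - t) = (s - t) * (gradient \<phi> (x, t) \<bullet> (0, 1))"
                unfolding e01 by (simp only: inner_scaleR_right)
              also have "gradient \<phi> (x, t) \<bullet> (0, 1) = p x"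
                using inner_gradient[OF \<phi>(1), of "(0, 1)" "(x, t)"] by (simp only: p_def inner_commute)
              finally show ?thesis .
            qed
            ultimately show ?thesis by (simp add: \<psi>_def norm_Pair)
          qed
          show "\<phi> (x, s) - \<psi> x - (s - t) * p x = 0" if "x \<in> \<Omega> s" "x \<notin> cball 0 R" for x
            using inR[OF that(1) sT] that(2) by blast
        qed (use \<epsilon> in \<open>auto intro!: fmeasurable_compact\<close>)
        also have "\<dots> = (\<epsilon> * m) * \<bar>s - t\<bar>" by simp
        also have "\<dots> \<le> e / 3 * \<bar>s - t\<bar>" by (intro mult_right_mono \<epsilon>) simp
        finally show ?thesis .
      qed
      have B: "\<bar>(s - t) * (dint (\<Omega> s) p - dint (\<Omega> t) p)\<bar> \<le> e / 3 * \<bar>s - t\<bar>"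
      proof (cases "s = t")
        case False
        then have "\<bar>dint (\<Omega> s) p - dint (\<Omega> t) p\<bar> \<le> e / 3" using d2(2) sT s(2) by (force simp: dist_real_def)
        from mult_left_mono[OF this, of "\<bar>s - t\<bar>"] show ?thesis by (simp add: abs_mult mult.commute)
      qed simp
      have D: "\<bar>dint (\<Omega> s) \<psi> - dint (\<Omega> t) \<psi> - (s - t) * advection \<psi> t\<bar> \<le> e / 3 * \<bar>s - t\<bar>" using d3(2) s by auto
      have "dint (\<Omega> s) (\<lambda>x. \<phi> (x, s) - \<psi> x - (s - t) * p x) = mass \<phi> s - dint (\<Omega> s) \<psi> - (s - t) * dint (\<Omega> s) p"
      proof -
        have c1: "continuous_on UNIV (\<lambda>x. (s - t) * p x)" by (intro continuous_on_mult continuous_on_const cp)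
        have c2: "continuous_on UNIV (\<lambda>x. \<phi> (x, s) - \<psi> x)" by (intro continuous_on_diff c\<phi> smooth_continuous_on[OF \<psi>])
        show ?thesis
          unfolding mass_def
          by (simp only: dint_diff[OF domain_facts(1,4)[OF sT] c2 c1] dint_diff[OF domain_facts(1,4)[OF sT] c\<phi> smooth_continuous_on[OF \<psi>]] dint_cmult)
      qed
      then have "mass \<phi> s - mass \<phi> t - (s - t) * flux \<phi> t =
        dint (\<Omega> s) (\<lambda>x. \<phi> (x, s) - \<psi> x - (s - t) * p x) + (s - t) * (dint (\<Omega> s) p - dint (\<Omega> t) p) +
        (dint (\<Omega> s) \<psi> - dint (\<Omega> t) \<psi> - (s - t) * advection \<psi> t)"
        unfolding fx by (simp add: mass_def[of \<phi> t] \<psi>_def[symmetric] algebra_simps)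
      with A B D show ?thesis by linarith
    qed
    moreover have "min d1 (min d2 d3) > 0" using d1 d2 d3 by simp
    ultimately show ?thesis by blast
  qed
  then have "(mass \<phi> has_derivative (\<lambda>h. h * flux \<phi> t)) (at t within {a..b})"
    unfolding has_derivative_within_alt
    by (auto intro!: bounded_linear_mult_left)
  moreover have "(\<lambda>h. h * flux \<phi> t) = (*) (flux \<phi> t)" by (auto simp: mult.commute)
  ultimately show ?thesis by (simp only: has_field_derivative_def)
qed

section \<open>Conservation of area and exclusion of collapse\<close>

lemma flows_area_constant:
  assumes fl: "flows_with T v \<Omega>" and div: "\<And>t. t \<in> {0..T} \<Longrightarrow> divergence_free (\<lambda>x. v x t)"
    and seg: "closed_segment t u \<subseteq> {0..T}" and st: "\<And>s. s \<in> closed_segment t u \<Longrightarrow> stable s"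
  shows "area t = area u"
proof -
  obtain \<phi> where \<phi>: "smooth \<phi>" "compact (support \<phi>)" "\<forall>t\<in>{0..T}. mass \<phi> t = area t \<and> flux \<phi> t = 0"
    using unit_test_function by blast
  let ?S = "{min t u..max t u}"
  have S: "?S = closed_segment t u" by (auto simp: closed_segment_eq_real_ivl min_def max_def)
  have "norm (mass \<phi> t - mass \<phi> u) \<le> 0 * norm (t - u)"
  proof (rule field_differentiable_bound[of ?S "mass \<phi>" "flux \<phi>"])
    show "(mass \<phi> has_field_derivative flux \<phi> s) (at s within ?S)" if "s \<in> ?S" for s
      by (rule flows_mass_derivative[OF fl div _ _ that \<phi>(1,2)]) (use seg st S in auto)
    show "norm (flux \<phi> s) \<le> 0" if "s \<in> ?S" for s using that S seg \<phi>(3) by auto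
  qed auto
  moreover have "t \<in> {0..T}" "u \<in> {0..T}" using seg by auto
  ultimately show ?thesis using \<phi>(3) by simp
qed

text \<open>Only the first endpoint \<open>m\<close> may be unstable: as \<open>s\<close> tends to \<open>m\<close> the area tends to \<open>area m\<close> or
  to 0, and being constant and positive it cannot tend to 0.\<close>

lemma area_ge_at_endpoint:
  assumes fl: "flows_with T v \<Omega>" and div: "\<And>t. t \<in> {0..T} \<Longrightarrow> divergence_free (\<lambda>x. v x t)"
    and m: "m \<in> {0..T}" and t: "t \<in> {0..T}" and ne: "m \<noteq> t"
    and st: "\<And>s. s \<in> closed_segment m t \<Longrightarrow> s \<noteq> m \<Longrightarrow> stable s"
  shows "area t \<ge> area m"
proof (rule field_le_epsilon)
  fix e :: real assume e: "e > 0"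
  \<comment> \<open>\<open>X\<close> starts at \<open>t\<close> and tends to \<open>m\<close>
    without reaching it, so each segment from \<open>X n\<close> to \<open>t\<close> consists of
    stable times.\<close>
  define X where "X = (\<lambda>n. m + (1 / (real n + 1)) * (t - m))"
  have seg: "closed_segment m t \<subseteq> {0..T}" using m t by (intro closed_segment_subset) auto
  have Xs: "X n \<in> closed_segment m t" for n
  proof -
    have eq: "m + l * (t - m) = (1 - l) *\<^sub>R m + l *\<^sub>R t" for l :: real by (simp add: algebra_simps)
    show ?thesis
      unfolding closed_segment_def X_def
      by (intro CollectI exI[of _ "1 / (real n + 1)"] conjI eq) auto
  qed
  have Xm: "X n \<noteq> m" for n using ne by (simp add: X_def)
  have XT: "X n \<in> {0..T}" for n using Xs seg by blast
  have area: "area (X n) = area t" for n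
  proof (rule flows_area_constant[OF fl div])
    have sub: "closed_segment (X n) t \<subseteq> closed_segment m t" using Xs by (simp add: subset_closed_segment)
    then show "closed_segment (X n) t \<subseteq> {0..T}" using seg by blast
    have "m \<notin> closed_segment (X n) t"
    proof -
      have pos: "1 / (real n + 1) > 0" by simp
      show ?thesis
      proof (cases "m < t")
        case True
        then have "m < X n" using pos by (simp add: X_def)
        then show ?thesis using True by (auto simp: closed_segment_eq_real_ivl)
      next
        case False
        then have "t < m" using ne by simp
        then have "X n < m" using pos mult_pos_neg[OF pos, of "t - m"] by (simp add: X_def)
        then show ?thesis using \<open>t < m\<close> by (auto simp: closed_segment_eq_real_ivl)
      qed
    qed
    then show "stable s" if "s \<in> closed_segment (X n) t" for s using st sub that by blast
  qed
  have "(\<lambda>n. 1 / (real n + 1)) \<longlonglongrightarrow> 0" using LIMSEQ_inverse_real_of_nat by (simp add: inverse_eq_divide add.commute)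
  then have "(\<lambda>n. m + (1 / (real n + 1)) * (t - m)) \<longlonglongrightarrow> m + 0 * (t - m)" by (intro tendsto_intros)
  then have Xlim: "X \<longlonglongrightarrow> m" by (simp add: X_def)
  obtain y where y: "y \<in> \<Omega> m" using domain_facts(5)[OF m] by blast
  \<comment> \<open>Closeness below \<open>area t\<close> rules out the alternative 0; closeness
    below \<open>e\<close> then gives the estimate.\<close>
  have "eventually (\<lambda>n. dist (area (X n) - of_bool (y \<in> \<Omega> (X n)) * area m) 0 < min e (area t)) sequentially"
    by (rule tendstoD[OF area_tendsto[OF m XT Xlim y]]) (use e area_pos[OF t] in simp)
  then obtain n where "\<bar>area t - of_bool (y \<in> \<Omega> (X n)) * area m\<bar> < min e (area t)"
    unfolding eventually_sequentially area by auto
  then show "area m \<le> area t + e" by (cases "y \<in> \<Omega> (X n)") auto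
qed

text \<open>By Baire, if \<open>Bad\<close> were nonempty then the area would be bounded below on some relatively open part
  of \<open>Bad\<close>; the bound extends to the gaps of \<open>Bad\<close> from their endpoints.\<close>

lemma flows_stable:
  assumes fl: "flows_with T v \<Omega>" and div: "\<And>t. t \<in> {0..T} \<Longrightarrow> divergence_free (\<lambda>x. v x t)" and t: "t \<in> {0..T}"
  shows "stable t"
proof -
  \<comment> \<open>Unlike stability itself, a local lower bound for the area is visibly an open
    condition, so \<open>Bad\<close> is closed; and it implies stability.\<close>
  define good where "good = (\<lambda>s. \<exists>c>0. \<exists>\<tau>>0. \<forall>s'\<in>{0..T}. \<bar>s' - s\<bar> < \<tau> \<longrightarrow> area s' \<ge> c)"
  define Bad where "Bad = {s\<in>{0..T}. \<not> good s}"
  have good_stable: "stable s" if "s \<in> {0..T}" "good s" for s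
    using that stable_if_area_bounded_below[OF that(1)] unfolding good_def by blast
  have closedBad: "closed Bad"
    unfolding closed_sequential_limits
  proof (intro allI impI, elim conjE)
    fix X s assume X: "\<forall>n. X n \<in> Bad" "X \<longlonglongrightarrow> s"
    have sT: "s \<in> {0..T}" using closed_sequentially[of "{0..T}" X s] X by (auto simp: Bad_def)
    show "s \<in> Bad"
    proof (rule ccontr)
      assume "s \<notin> Bad"
      then have "good s" using sT by (simp add: Bad_def)
      then obtain c \<tau> where c: "c > 0" "\<tau> > 0" "\<forall>s'\<in>{0..T}. \<bar>s' - s\<bar> < \<tau> \<longrightarrow> area s' \<ge> c" unfolding good_def by blast
      have "eventually (\<lambda>n. dist (X n) s < \<tau> / 2) sequentially" using X(2) by (rule tendstoD) (use c in simp)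
      then obtain n where n: "\<bar>X n - s\<bar> < \<tau> / 2" unfolding eventually_sequentially dist_real_def by auto
      have "area s' \<ge> c" if "s' \<in> {0..T}" "\<bar>s' - X n\<bar> < \<tau> / 2" for s'
      proof -
        have "\<bar>s' - s\<bar> < \<tau>" using that(2) n by linarith
        then show ?thesis using c(3) that(1) by blast
      qed
      then have "good (X n)" unfolding good_def using c by (meson half_gt_zero)
      then show False using X(1) by (simp add: Bad_def)
    qed
  qed
  \<comment> \<open>These sets are closed by \<open>area_limit\<close>, and positivity of the area
    makes them exhaust the time interval.\<close>
  define S where "S = (\<lambda>n::nat. {s\<in>{0..T}. area s \<ge> 1 / (real n + 1)})"
  have closedS: "closed (S n)" for n
    unfolding closed_sequential_limits
  proof (intro allI impI, elim conjE)
    fix X s assume X: "\<forall>k. X k \<in> S n" "X \<longlonglongrightarrow> s"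
    have sT: "s \<in> {0..T}" using closed_sequentially[of "{0..T}" X s] X by (auto simp: S_def)
    have "area s \<ge> 1 / (real n + 1)" by (rule area_limit[OF sT _ X(2)]) (use X(1) in \<open>auto simp: S_def\<close>)
    with sT show "s \<in> S n" by (simp add: S_def)
  qed
  have "Bad = {}"
  proof (rule ccontr)
    assume ne: "Bad \<noteq> {}"
    \<comment> \<open>Otherwise every \<open>Bad - S n\<close> would be relatively open and dense in
      \<open>Bad\<close>, and Baire's theorem would produce a bad time lying in no
      \<open>S n\<close>.\<close>
    have "\<exists>n. \<not> Bad \<subseteq> closure (Bad - S n)"
    proof (rule ccontr)
      assume "\<not> ?thesis"
      then have dense: "Bad \<subseteq> closure (Bad - S n)" for n by blast
      have "Bad \<subseteq> closure (\<Inter>(range (\<lambda>n. Bad - S n)))"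
      proof (rule Baire[OF closedBad])
        fix U assume "U \<in> range (\<lambda>n. Bad - S n)"
        then obtain n where U: "U = Bad - S n" by blast
        have "openin (top_of_set Bad) (Bad - S n)"
          using openin_open_Int[of "- S n" Bad] closedS[of n] by (simp add: open_Compl Diff_eq)
        then show "openin (top_of_set Bad) U \<and> Bad \<subseteq> closure U" using dense U by simp
      qed simp
      moreover have "\<Inter>(range (\<lambda>n. Bad - S n)) = {}"
      proof -
        have "\<exists>n. s \<in> S n" if "s \<in> Bad" for s
        proof -
          have sT: "s \<in> {0..T}" using that by (simp add: Bad_def)
          obtain n where "inverse (real (Suc n)) < area s" using reals_Archimedean[OF area_pos[OF sT]] by blast
          then show ?thesis using sT by (intro exI[of _ n]) (simp add: S_def inverse_eq_divide add.commute)
        qed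
        then show ?thesis by blast
      qed
      ultimately have "Bad \<subseteq> closure {}" by (simp only:)
      then show False using ne by simp
    qed
    then obtain n p where p: "p \<in> Bad" "p \<notin> closure (Bad - S n)" by blast
    then obtain \<tau> where \<tau>: "\<tau> > 0" "\<forall>s\<in>Bad - S n. \<not> dist s p < \<tau>" unfolding closure_approachable by blast
    define c where "c = 1 / (real n + 1)"
    have c: "c > 0" by (simp add: c_def)
    have badc: "area s \<ge> c" if "s \<in> Bad" "\<bar>s - p\<bar> < \<tau>" for s
      using \<tau>(2) that by (auto simp: S_def c_def dist_real_def)
    have pT: "p \<in> {0..T}" using p(1) by (simp add: Bad_def)
    have "area s \<ge> c" if s: "s \<in> {0..T}" "\<bar>s - p\<bar> < \<tau>" for s
    proof (cases "s \<in> Bad")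
      case True
      then show ?thesis using badc s by blast
    next
      case False
      have segT: "closed_segment p s \<subseteq> {0..T}" using pT s by (intro closed_segment_subset) auto
      have "compact (Bad \<inter> closed_segment p s)" by (intro closed_Int_compact closedBad compact_segment)
      moreover have "Bad \<inter> closed_segment p s \<noteq> {}" using p(1) by auto
      moreover have "continuous_on (Bad \<inter> closed_segment p s) (dist s)" by (intro continuous_intros)
      \<comment> \<open>\<open>m\<close> is the bad time nearest to \<open>s\<close> among those
        between \<open>p\<close> and \<open>s\<close>. The times from \<open>m\<close> to
        \<open>s\<close> other than \<open>m\<close> are good, so \<open>m\<close> is the endpoint
        of the gap from which the bound is carried to \<open>s\<close>.\<close>
      ultimately obtain m where m: "m \<in> Bad" "m \<in> closed_segment p s"
        and min: "\<forall>r\<in>Bad \<inter> closed_segment p s. dist s m \<le> dist s r"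
        using continuous_attains_inf[of "Bad \<inter> closed_segment p s" "dist s"] by blast
      have ms: "m \<noteq> s" using m(1) False by blast
      have mp: "\<bar>m - p\<bar> < \<tau>" using m(2) s(2) by (auto simp: closed_segment_eq_real_ivl split: if_splits)
      have "area s \<ge> area m"
      proof (rule area_ge_at_endpoint[OF fl div _ s(1) ms])
        show mT: "m \<in> {0..T}" using m(1) by (simp add: Bad_def)
        fix r assume r: "r \<in> closed_segment m s" "r \<noteq> m"
        have rps: "r \<in> closed_segment p s" using r(1) m(2) subset_closed_segment[of m s p s] by auto
        have "dist s r < dist s m" using r by (auto simp: closed_segment_eq_real_ivl dist_real_def split: if_splits)
        then have "r \<notin> Bad" using min rps by force
        moreover have "r \<in> {0..T}" using rps segT by blast
        ultimately show "stable r" using good_stable[of r] by (simp add: Bad_def)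
      qed
      then show ?thesis using badc[OF m(1) mp] by simp
    qed
    then have "good p" unfolding good_def using c \<tau>(1) by blast
    then show False using p(1) by (simp add: Bad_def)
  qed
  then have "good t" using t by (auto simp: Bad_def)
  then show ?thesis by (rule good_stable[OF t])
qed

text \<open>Integrate the derivative of the mass over \<open>[0, T]\<close>; a test function
  vanishes at time \<open>T\<close>, so only the initial mass remains.\<close>

lemma flows_imp_weak:
  assumes fl: "flows_with T v \<Omega>" and div: "\<And>t. t \<in> {0..T} \<Longrightarrow> divergence_free (\<lambda>x. v x t)"
  shows "weak_solution T v \<Omega>"
  unfolding weak_solution_iff
proof (intro allI impI)
  fix \<phi> assume tf: "test_function T \<phi>"
  then have \<phi>: "smooth \<phi>" "compact (support \<phi>)" "support \<phi> \<subseteq> UNIV \<times> {..<T}" by (auto simp: test_function_def)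
  note st = flows_stable[OF fl div]
  have "(LINT t:{0..T}|lborel. flux \<phi> t) = mass \<phi> T - mass \<phi> 0"
  proof (rule integral_set_FTC)
    show "(mass \<phi> has_real_derivative flux \<phi> x) (at x within {0..T})" if "x \<in> {0..T}" for x
      by (rule flows_mass_derivative[OF fl div order_refl st that \<phi>(1,2)])
    show "continuous_on {0..T} (flux \<phi>)" by (rule continuous_on_flux[OF st \<phi>(1)])
  qed (use T_pos in simp)
  moreover have "\<phi> (x, T) = 0" for x using \<phi>(3) by (intro support_zero) auto
  then have "mass \<phi> T = 0" by (simp add: mass_def dint_def)
  ultimately show "mass \<phi> 0 = - (LINT t:{0..T}|lborel. flux \<phi> t)" by simp
qed

end

theorem lemma3p3:
  fixes T :: real
    and v :: "real^2 \<Rightarrow> real \<Rightarrow> real^2"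
    and \<Omega> :: "real \<Rightarrow> (real^2) set"
  assumes "T > 0"
    and "continuous_on (UNIV \<times> {0..T}) (\<lambda>(x, t). v x t)"
    and "\<And>t. t \<in> {0..T} \<Longrightarrow> divergence_free (\<lambda>x. v x t)"
    and "uniformly_continuous_in_space T v"
    and "evolving_domain T \<Omega>"
    and "\<And>t. t \<in> {0..T} \<Longrightarrow> C1_domain (\<Omega> t)"
  shows "weak_solution T v \<Omega> \<longleftrightarrow> flows_with T v \<Omega>"
proof -
  interpret evolving_C1_domain T v \<Omega> using assms(1,2,5,6) by unfold_locales
  show ?thesis using weak_imp_flows flows_imp_weak[OF _ assms(3)] by blast
qed

end
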